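(* Let $M$ be a 6-dimensional generalized Calabi-Yau manifold with $\mathrm{SU}(3)$-structure $(\kappa,\Omega)$. Then the scalar curvature of the induced metric is everywhere non-positive, and it vanishes identically if and only if the $\mathrm{SU}(3)$-structure has no torsion (i.e. all its torsion forms vanish identically).
   Context: Notation: $e^{i_1\dots i_r}=e^{i_1}\wedge\dots\wedge e^{i_r}$. An $\mathrm{SU}(3)$-structure on a smooth 6-manifold $M$ is a pair $(\kappa,\Omega)$, with $\kappa$ a non-degenerate 2-form and $\Omega$ a 3-form such that at every point there is a coframe $e^1,\dots,e^6$ with $$\kappa=e^{12}+e^{34}+e^{56},\qquad \Omega=e^{135}-e^{146}-e^{245}-e^{236}$$ (i.e. $\Omega$ is a normalized $\kappa$-positive 3-form). In the dual frame the induced almost complex structure $J$ is $Je_1=e_2$, $Je_3=e_4$, $Je_5=e_6$; the induced metric is $g=\sum_i e^i\otimes e^i$, i.e. $g(X,Y)=\kappa(X,JY)$. $J$ acts on $r$-forms by $(J\alpha)(X_1,\dots,X_r)=\alpha(JX_1,\dots,JX_r)$. The complex volume form $\varepsilon=\Omega+iJ\Omega$ is of type $(3,0)$ with respect to $J$. $(M,\kappa,\Omega)$ is a generalized Calabi-Yau manifold if $d\kappa=0$ and $\bar\partial_J\varepsilon=0$, where $\bar\partial_J\varepsilon$ denotes the $(3,1)$-component of $d\varepsilon$ with respect to $J$. Let $\Lambda^2_8M=\{\varphi\in\Lambda^2M: J\varphi=\varphi,\ \varphi\wedge\kappa^2=0\}$ and $\Lambda^3_{12}M=\{\gamma\in\Lambda^3M:\gamma\wedge\kappa=0,\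 \gamma\wedge\Omega=0,\ \gamma\wedge J\Omega=0\}$. The torsion forms are the uniquely determined functions $\pi_0,\sigma_0$, 1-forms $\pi_1,\nu_1$, 2-forms $\pi_2,\sigma_2\in\Lambda^2_8M$ and 3-form $\nu_3\in\Lambda^3_{12}M$ such that $$ d\kappa=-\tfrac32\sigma_0\Omega+\tfrac32\pi_0J\Omega+\nu_1\wedge\kappa+\nu_3,\quad d\Omega=\pi_0\kappa^2+\pi_1\wedge\Omega-\pi_2\wedge\kappa,\quad dJ\Omega=\sigma_0\kappa^2+J\pi_1\wedge\Omega-\sigma_2\wedge\kappa . $$ *)

theory Defs
  imports "HOL-Analysis.Analysis"
begin

section \<open>Smooth maps on open subsets of Euclidean space\<close>

fun Ck_on :: "nat \<Rightarrow> 'a::euclidean_space set \<Rightarrow> ('a \<Rightarrow> 'b::real_normed_vector) \<Rightarrow> bool" where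
  "Ck_on 0 S f \<longleftrightarrow> continuous_on S f"
| "Ck_on (Suc k) S f \<longleftrightarrow>
     (\<forall>x\<in>S. f differentiable (at x)) \<and>
     (\<forall>b\<in>Basis. Ck_on k S (\<lambda>x. frechet_derivative f (at x) b))"

definition smooth_on :: "'a::euclidean_space set \<Rightarrow> ('a \<Rightarrow> 'b::real_normed_vector) \<Rightarrow> bool" where
  "smooth_on S f \<longleftrightarrow> (\<forall>k. Ck_on k S f)"


section \<open>Smooth manifolds\<close>

text \<open>The dimension is the cardinality of the index type \<open>'n\<close>. A chart is a pair of its domain and
  its coordinate map; the values of the map outside the domain are irrelevant.\<close>

type_synonym ('m, 'n) chart = "'m set \<times> ('m \<Rightarrow> real ^ 'n)"

abbreviation chart_dom :: "('m, 'n) chart \<Rightarrow> 'm set" where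
  "chart_dom c \<equiv> fst c"

abbreviation chart_map :: "('m, 'n) chart \<Rightarrow> 'm \<Rightarrow> real ^ 'n" where
  "chart_map c \<equiv> snd c"

abbreviation chart_img :: "('m, 'n) chart \<Rightarrow> (real ^ 'n) set" where
  "chart_img c \<equiv> chart_map c ` chart_dom c"

definition is_chart :: "'m topology \<Rightarrow> ('m, 'n::finite) chart \<Rightarrow> bool" where
  "is_chart X c \<longleftrightarrow>
     openin X (chart_dom c) \<and> open (chart_img c) \<and>
     homeomorphic_map (subtopology X (chart_dom c)) (top_of_set (chart_img c)) (chart_map c)"

definition transition :: "('m, 'n) chart \<Rightarrow> ('m, 'n) chart \<Rightarrow> real ^ 'n \<Rightarrow> real ^ 'n" where
  "transition c c' = chart_map c' \<circ> inv_into (chart_dom c) (chart_map c)"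

text \<open>The atlas need not be maximal; any atlas determines the smooth structure.\<close>

definition smooth_manifold :: "'m topology \<Rightarrow> ('m, 'n::finite) chart set \<Rightarrow> bool" where
  "smooth_manifold X A \<longleftrightarrow>
     Hausdorff_space X \<and> second_countable X \<and>
     (\<forall>c\<in>A. is_chart X c) \<and> (\<Union>c\<in>A. chart_dom c) = topspace X \<and>
     (\<forall>c\<in>A. \<forall>c'\<in>A. smooth_on (chart_map c ` (chart_dom c \<inter> chart_dom c')) (transition c c'))"


section \<open>Exterior algebra\<close>

text \<open>A form on a vector space is a function on lists of vectors; a form of degree \<open>k\<close> vanishes by
  convention on lists of length other than \<open>k\<close>, so that equality of forms is equality of functions.\<close>

type_synonym ('v, 'b) form = "'v list \<Rightarrow> 'b"

definition alternating_form ::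
    "nat \<Rightarrow> ('v::real_vector, 'b::real_vector) form \<Rightarrow> bool" where
  "alternating_form k \<alpha> \<longleftrightarrow>
     (\<forall>vs. length vs \<noteq> k \<longrightarrow> \<alpha> vs = 0) \<and>
     (\<forall>vs i. length vs = k \<longrightarrow> i < k \<longrightarrow> linear (\<lambda>v. \<alpha> (vs[i := v]))) \<and>
     (\<forall>vs i j. length vs = k \<longrightarrow> i < j \<longrightarrow> j < k \<longrightarrow> vs ! i = vs ! j \<longrightarrow> \<alpha> vs = 0)"

text \<open>The wedge product as a signed sum over shuffles, with the normalisation
  \<open>(\<alpha> \<and> \<beta>)(v, w) = \<alpha>(v) \<beta>(w) - \<alpha>(w) \<beta>(v)\<close> for 1-forms. The set \<open>S\<close> holds the positions of the
  arguments passed to \<open>\<alpha>\<close>, and the exponent counts the inversions of the shuffle. The degrees need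
  not be given: by the convention above, terms with \<open>card S\<close> other than the degree of \<open>\<alpha>\<close> are 0.\<close>

definition wedge :: "('v, real) form \<Rightarrow> ('v, real) form \<Rightarrow> ('v, real) form"
    (infixr "\<^bold>\<and>" 72) where
  "(\<alpha> \<^bold>\<and> \<beta>) vs =
     (\<Sum>S\<in>Pow {..<length vs}.
        (-1) ^ card {(i, j). i < j \<and> i \<in> {..<length vs} - S \<and> j \<in> S}
        * \<alpha> (nths vs S) * \<beta> (nths vs (- S)))"

definition endo_act :: "('v \<Rightarrow> 'v) \<Rightarrow> ('v, 'b) form \<Rightarrow> ('v, 'b) form" where
  "endo_act J \<alpha> = (\<lambda>vs. \<alpha> (map J vs))"

text \<open>The \<open>(p, q)\<close>-component of a complex-valued \<open>(p+q)\<close>-form: sum, over all choices of \<open>p\<close>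
  slots \<open>S\<close>, of the complex multilinear extension of \<open>\<alpha>\<close> with the argument \<open>v\<close> replaced by its
  \<open>(1,0)\<close>-part \<open>(v - \<i> J v) / 2\<close> in the slots in \<open>S\<close> and by its \<open>(0,1)\<close>-part \<open>(v + \<i> J v) / 2\<close> in
  the others. The inner sum expands this extension, \<open>T\<close> being the slots contributing \<open>J v\<close>.\<close>

definition type_component ::
    "('v \<Rightarrow> 'v) \<Rightarrow> nat \<Rightarrow> nat \<Rightarrow> ('v, complex) form \<Rightarrow> ('v, complex) form" where
  "type_component J p q \<alpha> vs =
     (if length vs = p + q then
        \<Sum>S | S \<subseteq> {..<p + q} \<and> card S = p.
          (\<Sum>T\<in>Pow {..<p + q}.
             (\<Prod>i\<in>T. if i \<in> S then - \<i> else \<i>)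
             * \<alpha> (map (\<lambda>i. if i \<in> T then J (vs ! i) else vs ! i) [0..<p + q]))
          / 2 ^ (p + q)
      else 0)"


section \<open>Differential forms on a manifold\<close>

definition ext_deriv ::
    "('v::real_normed_vector \<Rightarrow> ('v, 'b::real_normed_vector) form) \<Rightarrow> 'v \<Rightarrow> ('v, 'b) form" where
  "ext_deriv \<omega> x vs =
     (\<Sum>i<length vs. (-1) ^ i *\<^sub>R
        frechet_derivative (\<lambda>y. \<omega> y (take i vs @ drop (Suc i) vs)) (at x) (vs ! i))"

text \<open>A differential form on a manifold is given by its coordinate expressions in the charts of the
  atlas, related to one another by pullback along the transition maps.\<close>

type_synonym ('m, 'n) form_field =
  "('m, 'n) chart \<Rightarrow> real ^ 'n \<Rightarrow> (real ^ 'n, real) form"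

definition differential_form ::
    "nat \<Rightarrow> ('m, 'n::finite) chart set \<Rightarrow> ('m, 'n) form_field \<Rightarrow> bool" where
  "differential_form k A \<omega> \<longleftrightarrow>
     (\<forall>c\<in>A. \<forall>x\<in>chart_img c. alternating_form k (\<omega> c x)) \<and>
     (\<forall>c\<in>A. \<forall>vs. smooth_on (chart_img c) (\<lambda>x. \<omega> c x vs)) \<and>
     (\<forall>c\<in>A. \<forall>c'\<in>A. \<forall>p\<in>chart_dom c \<inter> chart_dom c'. \<forall>vs.
        \<omega> c (chart_map c p) vs =
        \<omega> c' (chart_map c' p)
          (map (frechet_derivative (transition c c') (at (chart_map c p))) vs))"


section \<open>Scalar curvature\<close>

definition pd :: "'n::finite \<Rightarrow> (real ^ 'n \<Rightarrow> real) \<Rightarrow> real ^ 'n \<Rightarrow> real" where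
  "pd i f x = frechet_derivative f (at x) (axis i 1)"

text \<open>Here \<open>G x $ i $ j\<close> is the component \<open>g(\<partial>\<^sub>i, \<partial>\<^sub>j)\<close> of the metric at \<open>x\<close>.\<close>

definition christoffel ::
    "(real ^ 'n \<Rightarrow> real ^ 'n ^ 'n) \<Rightarrow> 'n::finite \<Rightarrow> 'n \<Rightarrow> 'n \<Rightarrow> real ^ 'n \<Rightarrow> real" where
  "christoffel G k i j x =
     (\<Sum>l\<in>UNIV. matrix_inv (G x) $ k $ l *
        (pd i (\<lambda>y. G y $ j $ l) x + pd j (\<lambda>y. G y $ i $ l) x - pd l (\<lambda>y. G y $ i $ j) x)) / 2"

text \<open>\<open>R(\<partial>\<^sub>i, \<partial>\<^sub>j) \<partial>\<^sub>k = (\<Sum>l. riemann G l k i j \<partial>\<^sub>l)\<close>, where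
  \<open>R(X, Y) = [\<nabla>\<^sub>X, \<nabla>\<^sub>Y] - \<nabla>\<^bsub>[X, Y]\<^esub>\<close>; the scalar curvature of a round sphere is positive.\<close>

definition riemann ::
    "(real ^ 'n \<Rightarrow> real ^ 'n ^ 'n) \<Rightarrow> 'n::finite \<Rightarrow> 'n \<Rightarrow> 'n \<Rightarrow> 'n \<Rightarrow> real ^ 'n \<Rightarrow> real" where
  "riemann G l k i j x =
     pd i (christoffel G l j k) x - pd j (christoffel G l i k) x
     + (\<Sum>m\<in>UNIV. christoffel G l i m x * christoffel G m j k x
                  - christoffel G l j m x * christoffel G m i k x)"

definition ricci ::
    "(real ^ 'n \<Rightarrow> real ^ 'n ^ 'n) \<Rightarrow> 'n::finite \<Rightarrow> 'n \<Rightarrow> real ^ 'n \<Rightarrow> real" where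
  "ricci G j k x = (\<Sum>i\<in>UNIV. riemann G i k i j x)"

definition scalar_curvature ::
    "(real ^ 'n \<Rightarrow> real ^ 'n ^ 'n) \<Rightarrow> real ^ 'n::finite \<Rightarrow> real" where
  "scalar_curvature G x =
     (\<Sum>j\<in>UNIV. \<Sum>k\<in>UNIV. matrix_inv (G x) $ j $ k * ricci G j k x)"


section \<open>SU(3)-structures\<close>

text \<open>A coframe \<open>e\<^sup>1, \<dots>, e\<^sup>6\<close> is encoded as the linear isomorphism \<open>u\<close> onto \<open>\<real>\<^sup>6\<close> whose \<open>i\<close>-th
  component is \<open>e\<^sup>i\<close>. The elements of the index type \<open>6\<close> are \<open>1, \<dots>, 6\<close> (with \<open>6 = 0\<close>).\<close>

definition coframe :: "(real ^ 6 \<Rightarrow> real ^ 6) \<Rightarrow> bool" where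
  "coframe u \<longleftrightarrow> linear u \<and> bij u"

definition covec :: "(real ^ 6 \<Rightarrow> real ^ 6) \<Rightarrow> 6 \<Rightarrow> (real ^ 6, real) form" where
  "covec u i vs = (case vs of [v] \<Rightarrow> u v $ i | _ \<Rightarrow> 0)"

definition adapted_coframe ::
    "(real ^ 6, real) form \<Rightarrow> (real ^ 6, real) form \<Rightarrow> (real ^ 6 \<Rightarrow> real ^ 6) \<Rightarrow> bool" where
  "adapted_coframe \<kappa> \<Omega> u \<longleftrightarrow>
     coframe u \<and>
     (let e = covec u in
       \<kappa> = (\<lambda>vs. (e 1 \<^bold>\<and> e 2) vs + (e 3 \<^bold>\<and> e 4) vs + (e 5 \<^bold>\<and> e 6) vs) \<and>
       \<Omega> = (\<lambda>vs. (e 1 \<^bold>\<and> e 3 \<^bold>\<and> e 5) vs - (e 1 \<^bold>\<and> e 4 \<^bold>\<and> e 6) vs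
                 - (e 2 \<^bold>\<and> e 4 \<^bold>\<and> e 5) vs - (e 2 \<^bold>\<and> e 3 \<^bold>\<and> e 6) vs))"

definition nondegenerate :: "(real ^ 'n, real) form \<Rightarrow> bool" where
  "nondegenerate \<kappa> \<longleftrightarrow> (\<forall>v. v \<noteq> 0 \<longrightarrow> (\<exists>w. \<kappa> [v, w] \<noteq> 0))"

definition su3_structure ::
    "('m, 6) chart set \<Rightarrow> ('m, 6) form_field \<Rightarrow> ('m, 6) form_field \<Rightarrow> bool" where
  "su3_structure A \<kappa> \<Omega> \<longleftrightarrow>
     differential_form 2 A \<kappa> \<and> differential_form 3 A \<Omega> \<and>
     (\<forall>c\<in>A. \<forall>x\<in>chart_img c.
        nondegenerate (\<kappa> c x) \<and> (\<exists>u. adapted_coframe (\<kappa> c x) (\<Omega> c x) u))"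

text \<open>Two adapted coframes at a point differ by an element of SU(3), so the almost complex structure
  and the metric below do not depend on the chosen coframe.\<close>

definition su3_coframe ::
    "(real ^ 6, real) form \<Rightarrow> (real ^ 6, real) form \<Rightarrow> real ^ 6 \<Rightarrow> real ^ 6" where
  "su3_coframe \<kappa> \<Omega> = (SOME u. adapted_coframe \<kappa> \<Omega> u)"

definition su3_J ::
    "(real ^ 6, real) form \<Rightarrow> (real ^ 6, real) form \<Rightarrow> real ^ 6 \<Rightarrow> real ^ 6" where
  "su3_J \<kappa> \<Omega> v =
     (let u = su3_coframe \<kappa> \<Omega>; E = (\<lambda>i. inv u (axis i 1)) in
        (u v $ 1) *\<^sub>R E 2 - (u v $ 2) *\<^sub>R E 1
      + (u v $ 3) *\<^sub>R E 4 - (u v $ 4) *\<^sub>R E 3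
      + (u v $ 5) *\<^sub>R E 6 - (u v $ 6) *\<^sub>R E 5)"

definition su3_metric ::
    "(real ^ 6, real) form \<Rightarrow> (real ^ 6, real) form \<Rightarrow> real ^ 6 \<Rightarrow> real ^ 6 \<Rightarrow> real" where
  "su3_metric \<kappa> \<Omega> v w =
     (let u = su3_coframe \<kappa> \<Omega> in \<Sum>i\<in>UNIV. u v $ i * u w $ i)"

definition J_Omega ::
    "(real ^ 6, real) form \<Rightarrow> (real ^ 6, real) form \<Rightarrow> (real ^ 6, real) form" where
  "J_Omega \<kappa> \<Omega> = endo_act (su3_J \<kappa> \<Omega>) \<Omega>"

definition su3_eps ::
    "(real ^ 6, real) form \<Rightarrow> (real ^ 6, real) form \<Rightarrow> (real ^ 6, complex) form" where
  "su3_eps \<kappa> \<Omega> = (\<lambda>vs. complex_of_real (\<Omega> vs) + \<i> * complex_of_real (J_Omega \<kappa> \<Omega> vs))"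

definition su3_scalar_curvature ::
    "('m, 6) form_field \<Rightarrow> ('m, 6) form_field \<Rightarrow> ('m, 6) chart \<Rightarrow> 'm \<Rightarrow> real" where
  "su3_scalar_curvature \<kappa> \<Omega> c p =
     scalar_curvature
       (\<lambda>x. \<chi> i j. su3_metric (\<kappa> c x) (\<Omega> c x) (axis i 1) (axis j 1)) (chart_map c p)"

definition generalized_calabi_yau ::
    "('m, 6) chart set \<Rightarrow> ('m, 6) form_field \<Rightarrow> ('m, 6) form_field \<Rightarrow> bool" where
  "generalized_calabi_yau A \<kappa> \<Omega> \<longleftrightarrow>
     su3_structure A \<kappa> \<Omega> \<and>
     (\<forall>c\<in>A. \<forall>x\<in>chart_img c.
        ext_deriv (\<kappa> c) x = (\<lambda>_. 0) \<and>
        type_component (su3_J (\<kappa> c x) (\<Omega> c x)) 3 1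
          (ext_deriv (\<lambda>y. su3_eps (\<kappa> c y) (\<Omega> c y)) x) = (\<lambda>_. 0))"


section \<open>Torsion forms\<close>

definition Lambda2_8 ::
    "(real ^ 6, real) form \<Rightarrow> (real ^ 6, real) form \<Rightarrow> (real ^ 6, real) form set" where
  "Lambda2_8 \<kappa> \<Omega> =
     {\<phi>. alternating_form 2 \<phi> \<and> endo_act (su3_J \<kappa> \<Omega>) \<phi> = \<phi> \<and> \<phi> \<^bold>\<and> \<kappa> \<^bold>\<and> \<kappa> = (\<lambda>_. 0)}"

definition Lambda3_12 ::
    "(real ^ 6, real) form \<Rightarrow> (real ^ 6, real) form \<Rightarrow> (real ^ 6, real) form set" where
  "Lambda3_12 \<kappa> \<Omega> =
     {\<gamma>. alternating_form 3 \<gamma> \<and> \<gamma> \<^bold>\<and> \<kappa> = (\<lambda>_. 0) \<and>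
         \<gamma> \<^bold>\<and> \<Omega> = (\<lambda>_. 0) \<and> \<gamma> \<^bold>\<and> J_Omega \<kappa> \<Omega> = (\<lambda>_. 0)}"

record su3_torsion =
  pi0 :: real
  sigma0 :: real
  pi1 :: "(real ^ 6, real) form"
  nu1 :: "(real ^ 6, real) form"
  pi2 :: "(real ^ 6, real) form"
  sigma2 :: "(real ^ 6, real) form"
  nu3 :: "(real ^ 6, real) form"

text \<open>The torsion forms at a point are determined by the values there of \<open>\<kappa>\<close>, \<open>\<Omega>\<close> and of the
  exterior derivatives \<open>d\<kappa>\<close>, \<open>d\<Omega>\<close>, \<open>dJ\<Omega>\<close>, which are passed as separate arguments.\<close>

definition is_torsion ::
    "(real ^ 6, real) form \<Rightarrow> (real ^ 6, real) form \<Rightarrow>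
     (real ^ 6, real) form \<Rightarrow> (real ^ 6, real) form \<Rightarrow> (real ^ 6, real) form \<Rightarrow>
     su3_torsion \<Rightarrow> bool" where
  "is_torsion \<kappa> \<Omega> d\<kappa> d\<Omega> dJ\<Omega> \<tau> \<longleftrightarrow>
     alternating_form 1 (pi1 \<tau>) \<and> alternating_form 1 (nu1 \<tau>) \<and>
     pi2 \<tau> \<in> Lambda2_8 \<kappa> \<Omega> \<and> sigma2 \<tau> \<in> Lambda2_8 \<kappa> \<Omega> \<and> nu3 \<tau> \<in> Lambda3_12 \<kappa> \<Omega> \<and>
     d\<kappa> = (\<lambda>vs. - (3/2) * sigma0 \<tau> * \<Omega> vs + (3/2) * pi0 \<tau> * J_Omega \<kappa> \<Omega> vs
                + (nu1 \<tau> \<^bold>\<and> \<kappa>) vs + nu3 \<tau> vs) \<and>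
     d\<Omega> = (\<lambda>vs. pi0 \<tau> * (\<kappa> \<^bold>\<and> \<kappa>) vs + (pi1 \<tau> \<^bold>\<and> \<Omega>) vs - (pi2 \<tau> \<^bold>\<and> \<kappa>) vs) \<and>
     dJ\<Omega> = (\<lambda>vs. sigma0 \<tau> * (\<kappa> \<^bold>\<and> \<kappa>) vs + (endo_act (su3_J \<kappa> \<Omega>) (pi1 \<tau>) \<^bold>\<and> \<Omega>) vs
                - (sigma2 \<tau> \<^bold>\<and> \<kappa>) vs)"

definition torsion_at ::
    "('m, 6) form_field \<Rightarrow> ('m, 6) form_field \<Rightarrow> ('m, 6) chart \<Rightarrow> 'm \<Rightarrow> su3_torsion" where
  "torsion_at \<kappa> \<Omega> c p =
     (let x = chart_map c p in
      THE \<tau>. is_torsion (\<kappa> c x) (\<Omega> c x)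
        (ext_deriv (\<kappa> c) x) (ext_deriv (\<Omega> c) x)
        (ext_deriv (\<lambda>y. J_Omega (\<kappa> c y) (\<Omega> c y)) x) \<tau>)"

definition torsion_free ::
    "('m, 6) chart set \<Rightarrow> ('m, 6) form_field \<Rightarrow> ('m, 6) form_field \<Rightarrow> bool" where
  "torsion_free A \<kappa> \<Omega> \<longleftrightarrow>
     (\<forall>c\<in>A. \<forall>p\<in>chart_dom c.
        let \<tau> = torsion_at \<kappa> \<Omega> c p in
          pi0 \<tau> = 0 \<and> sigma0 \<tau> = 0 \<and> pi1 \<tau> = (\<lambda>_. 0) \<and> nu1 \<tau> = (\<lambda>_. 0) \<and>
          pi2 \<tau> = (\<lambda>_. 0) \<and> sigma2 \<tau> = (\<lambda>_. 0) \<and> nu3 \<tau> = (\<lambda>_. 0))"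

end

theory Submission
  imports Defs "HOL-Library.Sublist"
begin

text \<open>Write \<open>g\<close>, \<open>J\<close> for the induced metric and almost complex structure. Everything happens in one coordinate
domain and, in the end, at one point; the theorem follows from the pointwise formula
\<open>scal = - \<Sum> g(A(e\<^sub>a, e\<^sub>b), e\<^sub>c)\<^sup>2\<close>, the sum running over an orthonormal frame, together with the fact that
the tensor \<open>A\<close> vanishes at a point exactly when the torsion forms do.

Here \<open>A\<^sub>X = - 1/2 J (\<nabla>\<^sub>X J)\<close> is built from the Levi-Civita connection \<open>\<nabla>\<close>. The connection \<open>B = \<nabla> + A\<close> is metric and
preserves \<open>J\<close>. As \<open>\<nabla>\<^sub>X J\<close> anti-commutes with \<open>J\<close>, \<open>A\<^sub>X Y\<close> is anti-linear in \<open>Y\<close>. The symplectic condition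
\<open>d\<kappa> = 0\<close> makes it anti-linear in \<open>X\<close> as well and makes the cyclic sum of \<open>g(A\<^sub>X Y, Z)\<close> vanish. Since \<open>B\<close>
preserves \<open>g\<close> and \<open>J\<close>, it can change the complex volume form \<open>\<epsilon>\<close> only by a phase, \<open>B\<^sub>X \<epsilon> = - \<i> \<mu>(X) \<epsilon>\<close>. The torsion \<open>T(X, Y) = A\<^sub>X Y - A\<^sub>Y X\<close> of \<open>B\<close> is anti-linear in both
arguments and therefore contributes only to the (2,2)-part of \<open>d\<epsilon>\<close>; the (3,1)-part is given by \<open>\<mu>\<close>.
So \<open>\<mu> = 0\<close>, that is, \<open>B\<close> is an SU(3)-connection (\<open>parallel_Omega\<close>).

The curvature \<open>F\<close> of \<open>B\<close> then takes values in su(3). In particular its trace against \<open>J\<close>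
vanishes. On the other hand \<open>F\<close> differs from the Riemann tensor by the \<open>B\<close>-derivative of \<open>A\<close> and by terms quadratic in
\<open>A\<close>. The derivative of \<open>A\<close> has the same symmetries as \<open>A\<close>, and a trace over \<open>{e\<^sub>a}\<close> equals the same trace over
\<open>{J e\<^sub>a}\<close>, so all traces of the derivative cancel. The first Bianchi identity turns the vanishing trace of \<open>F\<close> into
the value of its scalar trace, and what is left of the scalar curvature is \<open>- |A|\<^sup>2\<close>
(\<open>scalar_curvature_algebra\<close>, \<open>scalar_curvature_eq\<close>).

Finally \<open>d\<Omega>\<close> and \<open>d(J\<Omega>)\<close> are obtained by inserting \<open>T\<close> and \<open>- J T\<close> into \<open>\<Omega>\<close>, and each such 4-form is
\<open>- \<phi> \<and> \<kappa>\<close> for an explicit \<open>\<phi>\<close> in \<open>\<Lambda>\<^sup>2\<^sub>8\<close>. By uniqueness of the decomposition the torsion forms are these two 2-forms, all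
others being zero (\<open>torsion_eq\<close>), and they vanish together exactly when \<open>A\<close> does (\<open>torsion_form_eq_0_iff\<close>).

The adapted coframe at a point is an arbitrary choice and need not vary smoothly. Smoothness of \<open>g\<close> and \<open>J\<close> comes
instead from formulas for them that are rational in the components of \<open>\<kappa>\<close> and \<open>\<Omega>\<close>. All derivatives
are derivatives of components along constant vectors, so frames are only ever used at a single point.\<close>


section \<open>Smooth functions on open sets\<close>

lemma Ck_on_cong:
  assumes "open S" "\<And>x. x \<in> S \<Longrightarrow> f x = g x"
  shows "Ck_on k S f \<longleftrightarrow> Ck_on k S g"
  using assms(2)
proof (induction k arbitrary: f g)
  case 0
  then show ?case by (simp cong: continuous_on_cong)
next
  case (Suc k)
  have diff: "f differentiable (at x) \<longleftrightarrow> g differentiable (at x)" if "x \<in> S" for x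
    unfolding differentiable_def
    using has_derivative_transform_within_open[OF _ assms(1) that] Suc.prems by metis
  have fd: "f differentiable (at x) \<Longrightarrow> frechet_derivative f (at x) = frechet_derivative g (at x)" if "x \<in> S" for x
    using frechet_derivative_transform_within_open[OF _ assms(1) that] Suc.prems by blast
  have "Ck_on k S (\<lambda>x. frechet_derivative f (at x) b) \<longleftrightarrow> Ck_on k S (\<lambda>x. frechet_derivative g (at x) b)"
    if "\<forall>x\<in>S. f differentiable (at x)" for b
    by (rule Suc.IH) (use that fd in auto)
  then show ?case using diff by auto
qed

lemma Ck_on_Suc_imp: "open S \<Longrightarrow> Ck_on (Suc k) S f \<Longrightarrow> Ck_on k S f"
proof (induction k arbitrary: f)
  case 0
  then show ?case
    by (auto intro!: continuous_at_imp_continuous_on differentiable_imp_continuous_within)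
next
  case (Suc k)
  then show ?case by (metis Ck_on.simps(2))
qed

lemma Ck_on_const: "Ck_on k S (\<lambda>_. c)"
  by (induction k arbitrary: c) auto

lemma frechet_eqI: "(f has_derivative f') (at x) \<Longrightarrow> frechet_derivative f (at x) h = f' h"
  by (metis frechet_derivative_at)

lemma Ck_on_linear:
  assumes "open S" "bounded_linear L" "Ck_on k S f"
  shows "Ck_on k S (\<lambda>x. L (f x))"
  using assms(3)
proof (induction k arbitrary: f)
  case 0
  then show ?case using assms(2) by (auto intro: linear_continuous_on_compose bounded_linear.continuous_on)
next
  case (Suc k)
  have d: "((\<lambda>x. L (f x)) has_derivative (\<lambda>h. L (frechet_derivative f (at x) h))) (at x)" if "x \<in> S" for x
    using bounded_linear.has_derivative[OF assms(2)] Suc.prems that by (auto simp: frechet_derivative_works)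
  have "Ck_on k S (\<lambda>x. frechet_derivative (\<lambda>x. L (f x)) (at x) b)" if "b \<in> Basis" for b
    using Suc.IH[of "\<lambda>x. frechet_derivative f (at x) b"] Suc.prems that
    by (subst Ck_on_cong[OF assms(1) frechet_eqI[OF d]]) auto
  then show ?case using d by (auto simp: differentiable_def)
qed

lemma Ck_on_add:
  assumes "open S" "Ck_on k S f" "Ck_on k S g"
  shows "Ck_on k S (\<lambda>x. f x + g x)"
  using assms(2,3)
proof (induction k arbitrary: f g)
  case 0
  then show ?case by (auto intro: continuous_intros)
next
  case (Suc k)
  have d: "((\<lambda>x. f x + g x) has_derivative (\<lambda>h. frechet_derivative f (at x) h + frechet_derivative g (at x) h)) (at x)" if "x \<in> S" for x
    using Suc.prems that by (auto simp: frechet_derivative_works intro!: derivative_intros)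
  have "Ck_on k S (\<lambda>x. frechet_derivative (\<lambda>x. f x + g x) (at x) b)" if "b \<in> Basis" for b
    by (subst Ck_on_cong[OF assms(1) frechet_eqI[OF d]]) (use Suc that in auto)
  then show ?case using d by (auto simp: differentiable_def)
qed

lemma Ck_on_bilinear:
  assumes "open S" "bounded_bilinear P" "Ck_on k S f" "Ck_on k S g"
  shows "Ck_on k S (\<lambda>x. P (f x) (g x))"
  using assms(3,4)
proof (induction k arbitrary: f g)
  case 0
  then show ?case using bounded_bilinear.continuous_on[OF assms(2)] by auto
next
  case (Suc k)
  have d: "((\<lambda>x. P (f x) (g x)) has_derivative
      (\<lambda>h. P (f x) (frechet_derivative g (at x) h) + P (frechet_derivative f (at x) h) (g x))) (at x)" if "x \<in> S" for x
    using Suc.prems that by (auto simp: frechet_derivative_works intro!: bounded_bilinear.FDERIV[OF assms(2)])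
  have "Ck_on k S (\<lambda>x. frechet_derivative (\<lambda>x. P (f x) (g x)) (at x) b)" if "b \<in> Basis" for b
    apply (subst Ck_on_cong[OF assms(1) frechet_eqI[OF d]], assumption)
    apply (intro Ck_on_add[OF assms(1)] Suc.IH)
    using Suc that Ck_on_Suc_imp[OF assms(1)] by auto
  then show ?case using d by (auto simp: differentiable_def)
qed

lemma Ck_on_inverse:
  fixes f :: "'a::euclidean_space \<Rightarrow> real"
  assumes "open S" "Ck_on k S f" "\<And>x. x \<in> S \<Longrightarrow> f x \<noteq> 0"
  shows "Ck_on k S (\<lambda>x. inverse (f x))"
  using assms(2)
proof (induction k)
  case 0
  then show ?case using assms(3) by (auto intro: continuous_intros)
next
  case (Suc k)
  have d: "((\<lambda>x. inverse (f x)) has_derivative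
      (\<lambda>h. - (inverse (f x) * frechet_derivative f (at x) h * inverse (f x)))) (at x)" if "x \<in> S" for x
    using Suc.prems that assms(3) by (auto simp: frechet_derivative_works intro!: has_derivative_inverse)
  have "Ck_on k S (\<lambda>x. frechet_derivative (\<lambda>x. inverse (f x)) (at x) b)" if "b \<in> Basis" for b
    apply (subst Ck_on_cong[OF assms(1) frechet_eqI[OF d]], assumption)
    apply (intro Ck_on_linear[OF assms(1) bounded_linear_minus[OF bounded_linear_ident]]
        Ck_on_bilinear[OF assms(1) bounded_bilinear_mult] Suc.IH)
    using Suc that Ck_on_Suc_imp[OF assms(1)] by auto
  then show ?case using d by (auto simp: differentiable_def)
qed

lemma smooth_on_cong: "open S \<Longrightarrow> (\<And>x. x \<in> S \<Longrightarrow> f x = g x) \<Longrightarrow> smooth_on S f \<longleftrightarrow> smooth_on S g"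
  unfolding smooth_on_def using Ck_on_cong by blast

lemma smooth_on_const: "smooth_on S (\<lambda>_. c)"
  by (simp add: smooth_on_def Ck_on_const)

lemma smooth_on_linear: "open S \<Longrightarrow> bounded_linear L \<Longrightarrow> smooth_on S f \<Longrightarrow> smooth_on S (\<lambda>x. L (f x))"
  by (simp add: smooth_on_def Ck_on_linear)

lemma smooth_on_add: "open S \<Longrightarrow> smooth_on S f \<Longrightarrow> smooth_on S g \<Longrightarrow> smooth_on S (\<lambda>x. f x + g x)"
  by (simp add: smooth_on_def Ck_on_add)

lemma smooth_on_minus: "open S \<Longrightarrow> smooth_on S f \<Longrightarrow> smooth_on S (\<lambda>x. - f x)"
  by (rule smooth_on_linear[OF _ bounded_linear_minus[OF bounded_linear_ident]])

lemma smooth_on_diff: "open S \<Longrightarrow> smooth_on S f \<Longrightarrow> smooth_on S g \<Longrightarrow> smooth_on S (\<lambda>x. f x - g x)"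
  using smooth_on_add[OF _ _ smooth_on_minus, of S f g] by simp

lemma smooth_on_mult:
  fixes f g :: "'a::euclidean_space \<Rightarrow> real"
  shows "open S \<Longrightarrow> smooth_on S f \<Longrightarrow> smooth_on S g \<Longrightarrow> smooth_on S (\<lambda>x. f x * g x)"
  by (simp add: smooth_on_def Ck_on_bilinear[OF _ bounded_bilinear_mult])

lemma smooth_on_scaleR:
  "open S \<Longrightarrow> smooth_on S f \<Longrightarrow> smooth_on S g \<Longrightarrow> smooth_on S (\<lambda>x. f x *\<^sub>R g x)"
  by (simp add: smooth_on_def Ck_on_bilinear[OF _ bounded_bilinear_scaleR])

lemma smooth_on_divide:
  fixes f g :: "'a::euclidean_space \<Rightarrow> real"
  shows "open S \<Longrightarrow> smooth_on S f \<Longrightarrow> smooth_on S g \<Longrightarrow> (\<And>x. x \<in> S \<Longrightarrow> g x \<noteq> 0) \<Longrightarrow>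
    smooth_on S (\<lambda>x. f x / g x)"
  unfolding divide_inverse by (intro smooth_on_mult) (auto simp: smooth_on_def Ck_on_inverse)

lemma smooth_on_sum:
  "open S \<Longrightarrow> (\<And>i. i \<in> I \<Longrightarrow> smooth_on S (f i)) \<Longrightarrow> smooth_on S (\<lambda>x. \<Sum>i\<in>I. f i x)"
  by (induction I rule: infinite_finite_induct) (auto intro: smooth_on_const smooth_on_add)

lemma smooth_on_prod:
  fixes f :: "'i \<Rightarrow> 'a::euclidean_space \<Rightarrow> real"
  shows "open S \<Longrightarrow> (\<And>i. i \<in> I \<Longrightarrow> smooth_on S (f i)) \<Longrightarrow> smooth_on S (\<lambda>x. \<Prod>i\<in>I. f i x)"
  by (induction I rule: infinite_finite_induct) (auto intro: smooth_on_const smooth_on_mult)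

lemma smooth_on_differentiable: "smooth_on S f \<Longrightarrow> x \<in> S \<Longrightarrow> f differentiable (at x)"
  unfolding smooth_on_def by (metis Ck_on.simps(2))

lemma smooth_on_derivative:
  assumes "open S" "smooth_on S f"
  shows "smooth_on S (\<lambda>x. frechet_derivative f (at x) h)"
proof -
  have *: "smooth_on S (\<lambda>x. \<Sum>b\<in>Basis. (h \<bullet> b) *\<^sub>R frechet_derivative f (at x) b)"
    using assms(2) by (intro smooth_on_sum smooth_on_scaleR smooth_on_const assms(1))
      (metis Ck_on.simps(2) smooth_on_def)
  have "frechet_derivative f (at x) h = (\<Sum>b\<in>Basis. (h \<bullet> b) *\<^sub>R frechet_derivative f (at x) b)" if "x \<in> S" for x
  proof -
    have "linear (frechet_derivative f (at x))"
      using linear_frechet_derivative smooth_on_differentiable[OF assms(2) that] by blast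
    then show ?thesis
      by (subst euclidean_representation[of h, symmetric]) (simp add: linear_sum linear_scale)
  qed
  then show ?thesis using * smooth_on_cong[OF assms(1)] by (metis (no_types, lifting))
qed

lemma matrix_inv_invertible:
  assumes "invertible A"
  shows "A ** matrix_inv A = mat 1" "matrix_inv A ** A = mat 1"
  using someI_ex[OF assms[unfolded invertible_def]] by (simp_all add: matrix_inv_def)

text \<open>Cramer's rule writes each entry of the inverse as a quotient of two determinants, hence as a rational function of the entries.\<close>

lemma smooth_on_matrix_inv:
  fixes M :: "'a::euclidean_space \<Rightarrow> real ^ 'n ^ 'n"
  assumes S: "open S" and M: "\<And>i j. smooth_on S (\<lambda>x. M x $ i $ j)" and inv: "\<And>x. x \<in> S \<Longrightarrow> invertible (M x)"
  shows "smooth_on S (\<lambda>x. matrix_inv (M x) $ i $ j)"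
proof -
  have det: "smooth_on S (\<lambda>x. det (N x))" if "\<And>i j. smooth_on S (\<lambda>x. N x $ i $ j)"
    for N :: "'a \<Rightarrow> real ^ 'n ^ 'n"
    unfolding det_def by (intro smooth_on_sum smooth_on_mult smooth_on_prod smooth_on_const S that)
  have eq: "matrix_inv (M x) $ i $ j = det (\<chi> r s. if s = i then axis j 1 $ r else M x $ r $ s) / det (M x)"
    if "x \<in> S" for x
  proof -
    have "M x *v (matrix_inv (M x) *v axis j 1) = axis j 1"
      using inv[OF that] by (simp add: matrix_vector_mul_assoc matrix_inv_invertible)
    then have "matrix_inv (M x) *v axis j 1 =
        (\<chi> k. det (\<chi> r s. if s = k then (axis j 1 :: real ^ 'n) $ r else M x $ r $ s) / det (M x))"
      using cramer inv[OF that] invertible_det_nz by blast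
    moreover have "matrix_inv (M x) $ i $ j = (matrix_inv (M x) *v axis j 1) $ i"
      by (simp add: matrix_vector_mult_basis column_def)
    ultimately show ?thesis by simp
  qed
  have "smooth_on S (\<lambda>x. (\<chi> r s. if s = i then axis j 1 $ r else M x $ r $ s) $ a $ b)" for a b
    by (cases "b = i") (auto intro: smooth_on_const M)
  then have "smooth_on S (\<lambda>x. det (\<chi> r s. if s = i then axis j 1 $ r else M x $ r $ s) / det (M x))"
    using inv by (intro smooth_on_divide S det M) (auto simp: invertible_det_nz)
  then show ?thesis using smooth_on_cong[OF S eq] by simp
qed

lemma linear_axis_expansion:
  fixes f :: "real ^ 'n \<Rightarrow> 'b::real_vector"
  assumes "linear f"
  shows "f v = (\<Sum>i\<in>UNIV. (v $ i) *\<^sub>R f (axis i 1))"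
proof -
  have "v = (\<Sum>i\<in>UNIV. (v $ i) *\<^sub>R axis i 1)"
    by (simp add: vec_eq_iff axis_def if_distrib cong: if_cong)
  then have "f v = f (\<Sum>i\<in>UNIV. (v $ i) *\<^sub>R axis i 1)" by simp
  also have "\<dots> = (\<Sum>i\<in>UNIV. (v $ i) *\<^sub>R f (axis i 1))"
    by (simp add: linear_sum[OF assms] linear_scale[OF assms])
  finally show ?thesis .
qed

lemma bilinear_axis_expansion:
  fixes b :: "real ^ 'n \<Rightarrow> real ^ 'n \<Rightarrow> real"
  assumes "\<And>w. linear (\<lambda>v. b v w)" "\<And>v. linear (b v)"
  shows "b v w = (\<Sum>j\<in>UNIV. \<Sum>k\<in>UNIV. v $ j * w $ k * b (axis j 1) (axis k 1))"
  by (subst linear_axis_expansion[OF assms(1)], subst linear_axis_expansion[OF assms(2)])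
    (simp add: sum_distrib_left mult_ac)

lemma smooth_on_transform: "open S \<Longrightarrow> smooth_on S f \<Longrightarrow> (\<And>x. x \<in> S \<Longrightarrow> f' x = f x) \<Longrightarrow> smooth_on S f'"
  using smooth_on_cong[of S f' f] by simp

lemma smooth_on_vec:
  fixes f :: "'a::euclidean_space \<Rightarrow> real ^ 'n"
  assumes "open S" "\<And>i. smooth_on S (\<lambda>x. f x $ i)"
  shows "smooth_on S f"
proof -
  have "smooth_on S (\<lambda>x. \<Sum>i\<in>UNIV. f x $ i *\<^sub>R (axis i 1 :: real ^ 'n))"
    by (intro smooth_on_sum smooth_on_scaleR smooth_on_const assms)
  moreover have "(\<Sum>i\<in>UNIV. f x $ i *\<^sub>R (axis i 1 :: real ^ 'n)) = f x" for x
    using linear_axis_expansion[OF linear_id, of "f x"] by simp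
  ultimately show ?thesis by simp
qed

lemma smooth_on_nth: "open S \<Longrightarrow> smooth_on S f \<Longrightarrow> smooth_on S (\<lambda>x. f x $ i)"
  by (rule smooth_on_linear[OF _ bounded_linear_vec_nth])

lemma smooth_on_apply:
  fixes M :: "'a::euclidean_space \<Rightarrow> real ^ 'n \<Rightarrow> 'b::real_normed_vector"
  assumes "open S" "\<And>y. y \<in> S \<Longrightarrow> linear (M y)" "\<And>v. smooth_on S (\<lambda>y. M y v)" "smooth_on S w"
  shows "smooth_on S (\<lambda>y. M y (w y))"
proof -
  have "smooth_on S (\<lambda>y. \<Sum>i\<in>UNIV. w y $ i *\<^sub>R M y (axis i 1))"
    by (intro smooth_on_sum smooth_on_scaleR smooth_on_nth assms)
  then show ?thesis by (rule smooth_on_transform[OF assms(1)]) (rule linear_axis_expansion[OF assms(2)])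
qed

abbreviation dd :: "('a::real_normed_vector \<Rightarrow> 'b::real_normed_vector) \<Rightarrow> 'a \<Rightarrow> 'a \<Rightarrow> 'b" where
  "dd f x h \<equiv> frechet_derivative f (at x) h"

text \<open>Both sides choose from the same set of derivatives, since that set depends only on the germ of the function at
  \<open>x\<close>. Identities that hold throughout \<open>S\<close> are differentiated by means of this lemma.\<close>

lemma dd_cong:
  assumes "open S" "x \<in> S" "\<And>y. y \<in> S \<Longrightarrow> f y = f' y"
  shows "dd f x h = dd f' x h"
proof -
  have "(f has_derivative L) (at x) \<longleftrightarrow> (f' has_derivative L) (at x)" for L
    using has_derivative_transform_within_open[OF _ assms(1,2)] assms(3) by metis
  then show ?thesis by (simp add: frechet_derivative_def)
qed

lemma dd_add: "f differentiable (at x) \<Longrightarrow> f' differentiable (at x) \<Longrightarrow> dd (\<lambda>y. f y + f' y) x h = dd f x h + dd f' x h"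
  by (rule frechet_eqI) (auto simp: frechet_derivative_works intro!: derivative_eq_intros)

lemma dd_diff: "f differentiable (at x) \<Longrightarrow> f' differentiable (at x) \<Longrightarrow> dd (\<lambda>y. f y - f' y) x h = dd f x h - dd f' x h"
  by (rule frechet_eqI) (auto simp: frechet_derivative_works intro!: derivative_eq_intros)

lemma dd_minus: "f differentiable (at x) \<Longrightarrow> dd (\<lambda>y. - f y) x h = - dd f x h"
  by (rule frechet_eqI) (auto simp: frechet_derivative_works intro!: derivative_eq_intros)

lemma dd_scaleR: "f differentiable (at x) \<Longrightarrow> dd (\<lambda>y. r *\<^sub>R f y) x h = r *\<^sub>R dd f x h"
  by (rule frechet_eqI) (auto simp: frechet_derivative_works intro!: derivative_eq_intros)

lemma dd_linear: "f differentiable (at x) \<Longrightarrow> linear (dd f x)"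
  by (rule linear_frechet_derivative)

lemma dd_linear_family:
  assumes S: "open S" "x \<in> S" and lin: "\<And>y. y \<in> S \<Longrightarrow> linear (M y)" and diff: "\<And>v. (\<lambda>y. M y v) differentiable (at x)"
  shows "linear (\<lambda>v. dd (\<lambda>y. M y v) x h)"
proof (rule linearI)
  fix v w
  have "dd (\<lambda>y. M y (v + w)) x h = dd (\<lambda>y. M y v + M y w) x h"
    using linear_add[OF lin] by (intro dd_cong[OF S]) auto
  then show "dd (\<lambda>y. M y (v + w)) x h = dd (\<lambda>y. M y v) x h + dd (\<lambda>y. M y w) x h"
    by (simp add: dd_add diff)
next
  fix r v
  have "dd (\<lambda>y. M y (r *\<^sub>R v)) x h = dd (\<lambda>y. r *\<^sub>R M y v) x h"
    using linear_scale[OF lin] by (intro dd_cong[OF S]) auto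
  then show "dd (\<lambda>y. M y (r *\<^sub>R v)) x h = r *\<^sub>R dd (\<lambda>y. M y v) x h"
    by (simp add: dd_scaleR diff)
qed

text \<open>The product rule for a field of linear maps applied to a field of vectors. It is reduced to products of scalar and vector
  functions by expanding the vector field in the standard basis.\<close>

lemma has_derivative_apply:
  fixes M :: "'a::real_normed_vector \<Rightarrow> real ^ 'n \<Rightarrow> 'b::real_normed_vector"
  assumes S: "open S" "x \<in> S" and lin: "\<And>y. y \<in> S \<Longrightarrow> linear (M y)" and diff: "\<And>v. (\<lambda>y. M y v) differentiable (at x)"
    and w: "w differentiable (at x)"
  shows "((\<lambda>y. M y (w y)) has_derivative (\<lambda>h. dd (\<lambda>y. M y (w x)) x h + M x (dd w x h))) (at x)"
proof -
  have wi: "((\<lambda>y. w y $ i) has_derivative (\<lambda>h. dd w x h $ i)) (at x)" for i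
    using w bounded_linear.has_derivative[OF bounded_linear_vec_nth, of w] by (simp add: frechet_derivative_works)
  have "((\<lambda>y. \<Sum>i\<in>UNIV. w y $ i *\<^sub>R M y (axis i 1)) has_derivative
      (\<lambda>h. \<Sum>i\<in>UNIV. w x $ i *\<^sub>R dd (\<lambda>y. M y (axis i 1)) x h + dd w x h $ i *\<^sub>R M x (axis i 1))) (at x)"
    by (intro has_derivative_sum has_derivative_scaleR wi) (use diff in \<open>simp add: frechet_derivative_works\<close>)
  moreover have "(\<Sum>i\<in>UNIV. w x $ i *\<^sub>R dd (\<lambda>y. M y (axis i 1)) x h + dd w x h $ i *\<^sub>R M x (axis i 1)) =
      dd (\<lambda>y. M y (w x)) x h + M x (dd w x h)" for h
    by (simp add: sum.distrib linear_axis_expansion[OF dd_linear_family[OF S lin diff], symmetric]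
        linear_axis_expansion[OF lin[OF S(2)], symmetric])
  ultimately have "((\<lambda>y. \<Sum>i\<in>UNIV. w y $ i *\<^sub>R M y (axis i 1)) has_derivative
      (\<lambda>h. dd (\<lambda>y. M y (w x)) x h + M x (dd w x h))) (at x)" by simp
  then show ?thesis
    by (rule has_derivative_transform_within_open[OF _ S]) (rule linear_axis_expansion[OF lin, symmetric])
qed

lemma dd_apply:
  fixes M :: "'a::real_normed_vector \<Rightarrow> real ^ 'n \<Rightarrow> 'b::real_normed_vector"
  assumes "open S" "x \<in> S" "\<And>y. y \<in> S \<Longrightarrow> linear (M y)" "\<And>v. (\<lambda>y. M y v) differentiable (at x)"
    "w differentiable (at x)"
  shows "dd (\<lambda>y. M y (w y)) x h = dd (\<lambda>y. M y (w x)) x h + M x (dd w x h)"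
    and "(\<lambda>y. M y (w y)) differentiable (at x)"
  using has_derivative_apply[OF assms] by (auto intro: frechet_eqI differentiableI)

lemma deriv_line:
  fixes f :: "'a::euclidean_space \<Rightarrow> real"
  assumes "f differentiable (at (p + t *\<^sub>R v))"
  shows "((\<lambda>t. f (p + t *\<^sub>R v)) has_real_derivative frechet_derivative f (at (p + t *\<^sub>R v)) v) (at t)"
proof -
  let ?D = "frechet_derivative f (at (p + t *\<^sub>R v))"
  have D: "(f has_derivative ?D) (at (p + t *\<^sub>R v))" using assms by (simp add: frechet_derivative_works)
  have "((\<lambda>t. f (p + t *\<^sub>R v)) has_derivative (\<lambda>s. ?D (s *\<^sub>R v))) (at t)"
    by (rule has_derivative_compose[where f = "\<lambda>t. p + t *\<^sub>R v" and g = f, OF _ D])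
      (auto intro!: derivative_eq_intros)
  moreover have "?D (s *\<^sub>R v) = ?D v * s" for s
    using linear_frechet_derivative[OF assms] by (simp add: linear_scale mult.commute)
  ultimately show ?thesis by (simp add: has_field_derivative_def)
qed

text \<open>Two applications of the mean value theorem, one for each direction.\<close>

lemma second_difference_mvt:
  fixes f :: "'a::euclidean_space \<Rightarrow> real"
  assumes f: "smooth_on S f" "open S" and h: "h > 0"
    and sub: "\<And>s t. 0 \<le> s \<Longrightarrow> s \<le> h \<Longrightarrow> 0 \<le> t \<Longrightarrow> t \<le> h \<Longrightarrow> p + s *\<^sub>R v + t *\<^sub>R w \<in> S"
  shows "\<exists>s t. 0 \<le> s \<and> s \<le> h \<and> 0 \<le> t \<and> t \<le> h \<and>
     f (p + h *\<^sub>R v + h *\<^sub>R w) - f (p + h *\<^sub>R v) - f (p + h *\<^sub>R w) + f p =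
     h * h * frechet_derivative (\<lambda>y. frechet_derivative f (at y) v) (at (p + s *\<^sub>R v + t *\<^sub>R w)) w"
proof -
  define \<phi> where "\<phi> s = f ((p + h *\<^sub>R w) + s *\<^sub>R v) - f (p + s *\<^sub>R v)" for s
  let ?g = "\<lambda>y. frechet_derivative f (at y) v"
  have "(\<phi> has_real_derivative (?g ((p + h *\<^sub>R w) + s *\<^sub>R v) - ?g (p + s *\<^sub>R v))) (at s)"
    if "0 \<le> s" "s \<le> h" for s
  proof -
    have "p + h *\<^sub>R w + s *\<^sub>R v \<in> S" "p + s *\<^sub>R v \<in> S"
      using sub[OF that, of h] sub[OF that, of 0] h by (auto simp: add_ac)
    then show ?thesis
      unfolding \<phi>_def by (intro DERIV_diff) (rule deriv_line, erule smooth_on_differentiable[OF f(1)])+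
  qed
  then obtain s where s: "0 < s" "s < h"
    "\<phi> h - \<phi> 0 = (h - 0) * (?g ((p + h *\<^sub>R w) + s *\<^sub>R v) - ?g (p + s *\<^sub>R v))"
    using MVT2[of 0 h \<phi> "\<lambda>s. ?g ((p + h *\<^sub>R w) + s *\<^sub>R v) - ?g (p + s *\<^sub>R v)"] h by auto
  have "((\<lambda>t. ?g ((p + s *\<^sub>R v) + t *\<^sub>R w)) has_real_derivative
      frechet_derivative ?g (at ((p + s *\<^sub>R v) + t *\<^sub>R w)) w) (at t)" if "0 \<le> t" "t \<le> h" for t
    by (rule deriv_line, rule smooth_on_differentiable[OF smooth_on_derivative[OF f(2,1)]])
      (use sub[of s t] s that in auto)
  then obtain t where t: "0 < t" "t < h"
    "?g ((p + s *\<^sub>R v) + h *\<^sub>R w) - ?g ((p + s *\<^sub>R v) + 0 *\<^sub>R w) =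
       (h - 0) * frechet_derivative ?g (at ((p + s *\<^sub>R v) + t *\<^sub>R w)) w"
    using MVT2[of 0 h "\<lambda>t. ?g ((p + s *\<^sub>R v) + t *\<^sub>R w)"
        "\<lambda>t. frechet_derivative ?g (at ((p + s *\<^sub>R v) + t *\<^sub>R w)) w"] h by auto
  have "f (p + h *\<^sub>R v + h *\<^sub>R w) - f (p + h *\<^sub>R v) - f (p + h *\<^sub>R w) + f p = \<phi> h - \<phi> 0"
    by (simp add: \<phi>_def add.assoc add.commute[of "h *\<^sub>R w"])
  also have "\<dots> = h * h * frechet_derivative ?g (at (p + s *\<^sub>R v + t *\<^sub>R w)) w"
    unfolding s(3) using t(3) by (simp add: add.assoc add.commute[of "h *\<^sub>R w"])
  finally show ?thesis using s t by (intro exI[of _ s] exI[of _ t]) auto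
qed

lemma second_difference_tendsto:
  fixes f :: "'a::euclidean_space \<Rightarrow> real"
  assumes f: "smooth_on S f" "open S" and p: "p \<in> S"
  shows "((\<lambda>h. (f (p + h *\<^sub>R v + h *\<^sub>R w) - f (p + h *\<^sub>R v) - f (p + h *\<^sub>R w) + f p) / (h * h))
     \<longlongrightarrow> frechet_derivative (\<lambda>y. frechet_derivative f (at y) v) (at p) w) (at_right 0)"
proof (rule tendstoI)
  fix e :: real assume e: "e > 0"
  let ?G = "\<lambda>x. frechet_derivative (\<lambda>y. frechet_derivative f (at y) v) (at x) w"
  have "smooth_on S ?G" by (intro smooth_on_derivative f)
  then have "isCont ?G p" using p smooth_on_differentiable differentiable_imp_continuous_within by blast
  then obtain d where d: "d > 0" "\<And>x. dist x p < d \<Longrightarrow> dist (?G x) (?G p) < e"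
    using e unfolding continuous_at_eps_delta by blast
  obtain d' where d': "d' > 0" "ball p d' \<subseteq> S" using f(2) p open_contains_ball by blast
  define r where "r = min d d' / (norm v + norm w + 1)"
  have r: "r > 0" using d d' by (simp add: r_def add_nonneg_pos)
  have near: "dist (p + s *\<^sub>R v + t *\<^sub>R w) p < min d d'" if "0 \<le> s" "s < r" "0 \<le> t" "t < r" for s t
  proof -
    have "dist (p + s *\<^sub>R v + t *\<^sub>R w) p \<le> s * norm v + t * norm w"
      using that norm_triangle_ineq[of "s *\<^sub>R v" "t *\<^sub>R w"] by (simp add: dist_norm)
    also have "\<dots> \<le> r * norm v + r * norm w" using that by (intro add_mono mult_right_mono) auto
    also have "\<dots> < r * (norm v + norm w + 1)" using r by (simp add: algebra_simps)
    also have "\<dots> = min d d'"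
      using add_nonneg_pos[OF add_nonneg_nonneg[OF norm_ge_zero[of v] norm_ge_zero[of w]] zero_less_one] unfolding r_def
      by (intro nonzero_eq_divide_eq[THEN iffD1, OF _ refl]) linarith
    finally show ?thesis .
  qed
  have "dist ((f (p + h *\<^sub>R v + h *\<^sub>R w) - f (p + h *\<^sub>R v) - f (p + h *\<^sub>R w) + f p) / (h * h)) (?G p) < e"
    if h: "0 < h" "h < r" for h
  proof -
    have "p + s *\<^sub>R v + t *\<^sub>R w \<in> S" if "0 \<le> s" "s \<le> h" "0 \<le> t" "t \<le> h" for s t
      using near[of s t] h that by (intro subsetD[OF d'(2)]) (simp add: dist_commute)
    then obtain s t where st: "0 \<le> s" "s \<le> h" "0 \<le> t" "t \<le> h"
      "f (p + h *\<^sub>R v + h *\<^sub>R w) - f (p + h *\<^sub>R v) - f (p + h *\<^sub>R w) + f p = h * h * ?G (p + s *\<^sub>R v + t *\<^sub>R w)"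
      using second_difference_mvt[OF f h(1), of p v w] by metis
    have "dist (?G (p + s *\<^sub>R v + t *\<^sub>R w)) (?G p) < e" using near[of s t] st h by (intro d(2)) auto
    then show ?thesis unfolding st(5) using h by simp
  qed
  then show "\<forall>\<^sub>F h in at_right 0. dist ((f (p + h *\<^sub>R v + h *\<^sub>R w) - f (p + h *\<^sub>R v) - f (p + h *\<^sub>R w) + f p) / (h * h)) (?G p) < e"
    unfolding eventually_at_right_field using r by (intro exI[of _ r]) simp
qed

text \<open>The second difference quotient is symmetric in the two directions, and it converges to either mixed derivative.\<close>

lemma second_derivative_symmetric:
  fixes f :: "'a::euclidean_space \<Rightarrow> real"
  assumes f: "smooth_on S f" "open S" and p: "p \<in> S"
  shows "frechet_derivative (\<lambda>y. frechet_derivative f (at y) v) (at p) w =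
         frechet_derivative (\<lambda>y. frechet_derivative f (at y) w) (at p) v"
proof -
  define Q where "Q v w h = (f (p + h *\<^sub>R v + h *\<^sub>R w) - f (p + h *\<^sub>R v) - f (p + h *\<^sub>R w) + f p) / (h * h)"
    for v w h
  have "Q w v h = Q v w h" for h
  proof -
    have swap: "(a - b - c + d) / k = (a' - c - b + d) / k" if "a = a'" for a a' b c d k :: real
      using that by simp
    have "p + h *\<^sub>R w + h *\<^sub>R v = p + h *\<^sub>R v + h *\<^sub>R w" by (metis add.assoc add.commute)
    then show ?thesis unfolding Q_def by (intro swap arg_cong[of _ _ f])
  qed
  then have "Q w v = Q v w" by blast
  moreover have lim: "(Q v w \<longlongrightarrow> frechet_derivative (\<lambda>y. frechet_derivative f (at y) v) (at p) w) (at_right 0)" for v w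
    using second_difference_tendsto[OF f p, of v w] unfolding Q_def .
  ultimately have "(Q v w \<longlongrightarrow> frechet_derivative (\<lambda>y. frechet_derivative f (at y) w) (at p) v) (at_right 0)"
    using lim[of w v] by simp
  then show ?thesis by (rule tendsto_unique[OF trivial_limit_at_right_real lim])
qed

section \<open>Exterior algebra\<close>

text \<open>Only the vanishing of a form of degree \<open>p\<close> on lists of any other length matters for evaluating the wedge product; a contraction
  of such a form has degree \<open>p - 1\<close>.\<close>

definition degree_form :: "nat \<Rightarrow> ('v, real) form \<Rightarrow> bool" where
  "degree_form p \<alpha> \<longleftrightarrow> (\<forall>vs. length vs \<noteq> p \<longrightarrow> \<alpha> vs = 0)"

lemma degree_form_Cons: "degree_form (Suc p) \<alpha> \<Longrightarrow> degree_form p (\<lambda>l. \<alpha> (v # l))"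
  by (simp add: degree_form_def)

lemma wedge_Nil: "(\<alpha> \<^bold>\<and> \<beta>) [] = \<alpha> [] * \<beta> []"
  by (simp add: wedge_def)

text \<open>Splitting the subsets of the positions of a list \<open>v # vs\<close> according to whether they contain the position of \<open>v\<close>; the other
  positions are shifted by one.\<close>

lemma Pow_lessThan_Suc:
  "Pow {..<Suc n} = (`) Suc ` Pow {..<n} \<union> (\<lambda>S. insert 0 (Suc ` S)) ` Pow {..<n}"
proof -
  have "S \<in> (`) Suc ` Pow {..<n} \<union> (\<lambda>S. insert 0 (Suc ` S)) ` Pow {..<n}" if S: "S \<subseteq> {..<Suc n}" for S
  proof -
    define T where "T = {j. Suc j \<in> S}"
    have "T \<in> Pow {..<n}" using S by (auto simp: T_def)
    moreover have "S = Suc ` T \<or> S = insert 0 (Suc ` T)"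
      unfolding T_def set_eq_iff image_iff by (metis (mono_tags, lifting) insert_iff image_iff mem_Collect_eq not0_implies_Suc old.nat.distinct(2))
    ultimately show ?thesis by blast
  qed
  then show ?thesis by (auto simp: lessThan_Suc_eq_insert_0)
qed

text \<open>Contraction with a vector is an anti-derivation of the wedge product. In terms of shuffles: if the first argument goes to
  \<open>\<beta>\<close>, it forms an inversion with each of the \<open>p\<close> arguments that go to \<open>\<alpha>\<close>. This recursion on the list of arguments
  is what all explicit evaluations and the alternation of wedge products rest on.\<close>

lemma wedge_Cons:
  assumes "degree_form p \<alpha>"
  shows "(\<alpha> \<^bold>\<and> \<beta>) (v # vs) = ((\<lambda>l. \<alpha> (v # l)) \<^bold>\<and> \<beta>) vs + (-1) ^ p * (\<alpha> \<^bold>\<and> (\<lambda>l. \<beta> (v # l))) vs"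
proof -
  define n where "n = length vs"
  define inv where "inv n S = {(i, j). i < j \<and> i \<in> {..<n} - S \<and> j \<in> S}" for n :: nat and S
  define t where "t S = (-1) ^ card (inv (Suc n) S) * \<alpha> (nths (v # vs) S) * \<beta> (nths (v # vs) (- S))" for S
  have fin: "finite (inv n S)" if "S \<subseteq> {..<n}" for S
    by (rule finite_subset[of _ "{..<n} \<times> {..<n}"]) (use that in \<open>auto simp: inv_def\<close>)
  have card1: "card (inv (Suc n) (insert 0 (Suc ` S))) = card (inv n S)" if "S \<subseteq> {..<n}" for S
  proof -
    have "inv (Suc n) (insert 0 (Suc ` S)) = map_prod Suc Suc ` inv n S"
      by (auto simp: inv_def map_prod_def image_iff less_Suc_eq_0_disj)
    then show ?thesis by (simp add: card_image prod.inj_map inj_on_subset[OF _ subset_UNIV])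
  qed
  have card2: "card (inv (Suc n) (Suc ` S)) = card S + card (inv n S)" if "S \<subseteq> {..<n}" for S
  proof -
    have e: "inv (Suc n) (Suc ` S) = Pair 0 ` Suc ` S \<union> map_prod Suc Suc ` inv n S"
      by (auto simp: inv_def map_prod_def image_iff less_Suc_eq_0_disj)
    have "card (Pair (0::nat) ` Suc ` S) = card S" by (simp add: card_image inj_on_def)
    moreover have "card (map_prod Suc Suc ` inv n S) = card (inv n S)"
      by (simp add: card_image prod.inj_map inj_on_subset[OF _ subset_UNIV])
    moreover have "finite S" using that finite_subset by blast
    moreover have "Pair 0 ` Suc ` S \<inter> map_prod Suc Suc ` inv n S = {}" by auto
    ultimately show ?thesis using fin[OF that] unfolding e by (simp add: card_Un_disjoint)
  qed
  have nths1: "{j. Suc j \<in> insert 0 (Suc ` S)} = S" "{j. Suc j \<in> - insert 0 (Suc ` S)} = - S"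
    "{j. Suc j \<in> Suc ` S} = S" "{j. Suc j \<in> - (Suc ` S)} = - S"
    "{j. Suc j \<notin> Suc ` S} = - S" for S :: "nat set"
    by auto
  have "(\<alpha> \<^bold>\<and> \<beta>) (v # vs) = (\<Sum>S\<in>Pow {..<Suc n}. t S)"
    by (simp add: wedge_def t_def n_def inv_def)
  also have "\<dots> = (\<Sum>S\<in>(`) Suc ` Pow {..<n}. t S) + (\<Sum>S\<in>(\<lambda>S. insert 0 (Suc ` S)) ` Pow {..<n}. t S)"
    unfolding Pow_lessThan_Suc by (rule sum.union_disjoint) auto
  also have "(\<Sum>S\<in>(`) Suc ` Pow {..<n}. t S) = (\<Sum>S\<in>Pow {..<n}. t (Suc ` S))"
    by (rule sum.reindex[unfolded comp_def]) (auto simp: inj_on_def inj_image_eq_iff)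
  also have "(\<Sum>S\<in>(\<lambda>S. insert 0 (Suc ` S)) ` Pow {..<n}. t S) = (\<Sum>S\<in>Pow {..<n}. t (insert 0 (Suc ` S)))"
  proof (rule sum.reindex[unfolded comp_def], rule inj_onI)
    fix S T :: "nat set"
    assume "insert 0 (Suc ` S) = insert 0 (Suc ` T)"
    then have "{j. Suc j \<in> insert 0 (Suc ` S)} = {j. Suc j \<in> insert 0 (Suc ` T)}" by simp
    then show "S = T" by (simp only: nths1)
  qed
  also have "(\<Sum>S\<in>Pow {..<n}. t (insert 0 (Suc ` S))) = ((\<lambda>l. \<alpha> (v # l)) \<^bold>\<and> \<beta>) vs"
    unfolding wedge_def n_def[symmetric]
    by (rule sum.cong) (simp_all add: t_def card1 nths_Cons nths1, simp add: inv_def)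
  also have "(\<Sum>S\<in>Pow {..<n}. t (Suc ` S)) = (-1) ^ p * (\<alpha> \<^bold>\<and> (\<lambda>l. \<beta> (v # l))) vs"
    unfolding wedge_def n_def[symmetric] sum_distrib_left
  proof (rule sum.cong[OF refl])
    fix S assume "S \<in> Pow {..<n}"
    then have S: "S \<subseteq> {..<n}" by simp
    have "length (nths vs S) = card S"
    proof -
      have "{i. i < n \<and> i \<in> S} = S" using S by auto
      then show ?thesis by (simp add: length_nths n_def[symmetric])
    qed
    then have "\<alpha> (nths vs S) = 0" if "card S \<noteq> p" using assms that by (auto simp: degree_form_def)
    then show "t (Suc ` S) = (-1) ^ p * ((-1) ^ card {(i, j). i < j \<and> i \<in> {..<n} - S \<and> j \<in> S} *
        \<alpha> (nths vs S) * \<beta> (v # nths vs (- S)))"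
      by (cases "card S = p") (simp_all add: t_def card2[OF S] nths_Cons nths1 power_add, simp_all add: inv_def)
  qed
  finally show ?thesis by simp
qed

lemma wedge_scalar: assumes "degree_form 0 \<alpha>" shows "(\<alpha> \<^bold>\<and> \<beta>) vs = \<alpha> [] * \<beta> vs"
proof (induction vs arbitrary: \<beta>)
  case (Cons v vs)
  have "(\<lambda>l. \<alpha> (v # l)) = (\<lambda>_. 0)" using assms by (auto simp: degree_form_def)
  then show ?case using Cons by (simp add: wedge_Cons[OF assms]) (simp add: wedge_def)
qed (simp add: wedge_Nil)

lemma degree_form_wedge:
  fixes \<alpha> \<beta> :: "('v, real) form"
  shows "degree_form p \<alpha> \<Longrightarrow> degree_form q \<beta> \<Longrightarrow> degree_form (p + q) (\<alpha> \<^bold>\<and> \<beta>)"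
  unfolding degree_form_def
proof (intro allI impI)
  fix vs :: "'v list"
  assume "\<forall>vs. length vs \<noteq> p \<longrightarrow> \<alpha> vs = 0" "\<forall>vs. length vs \<noteq> q \<longrightarrow> \<beta> vs = 0" "length vs \<noteq> p + q"
  then show "(\<alpha> \<^bold>\<and> \<beta>) vs = 0"
  proof (induction vs arbitrary: p q \<alpha> \<beta>)
    case Nil
    then show ?case by (auto simp: wedge_Nil)
  next
    case (Cons v vs)
    have 1: "((\<lambda>l. \<alpha> (v # l)) \<^bold>\<and> \<beta>) vs = 0"
    proof (cases p)
      case 0
      then have "(\<lambda>l. \<alpha> (v # l)) = (\<lambda>_. 0)" using Cons.prems by auto
      then show ?thesis by (simp add: wedge_def)
    next
      case (Suc p')
      then show ?thesis using Cons.prems by (intro Cons.IH[of p' _ q]) auto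
    qed
    have 2: "(\<alpha> \<^bold>\<and> (\<lambda>l. \<beta> (v # l))) vs = 0"
    proof (cases q)
      case 0
      then have "(\<lambda>l. \<beta> (v # l)) = (\<lambda>_. 0)" using Cons.prems by auto
      then show ?thesis by (simp add: wedge_def)
    next
      case (Suc q')
      then show ?thesis using Cons.prems by (intro Cons.IH[of p _ q']) auto
    qed
    show ?case using wedge_Cons[of p \<alpha>] 1 2 Cons.prems(1) by (simp add: degree_form_def)
  qed
qed

lemma wedge_one_form:
  "degree_form (Suc 0) \<alpha> \<Longrightarrow> (\<alpha> \<^bold>\<and> \<beta>) (v # vs) = \<alpha> [v] * \<beta> vs - (\<alpha> \<^bold>\<and> (\<lambda>l. \<beta> (v # l))) vs"
  by (simp add: wedge_Cons wedge_scalar degree_form_Cons)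

lemma wedge_one_form_Nil: "degree_form (Suc 0) \<alpha> \<Longrightarrow> (\<alpha> \<^bold>\<and> \<beta>) [] = 0"
  by (simp add: wedge_Nil degree_form_def)

lemma wedge_two_form:
  "degree_form 2 \<alpha> \<Longrightarrow> (\<alpha> \<^bold>\<and> \<beta>) (v # vs) = ((\<lambda>l. \<alpha> (v # l)) \<^bold>\<and> \<beta>) vs + (\<alpha> \<^bold>\<and> (\<lambda>l. \<beta> (v # l))) vs"
  by (simp add: wedge_Cons)

lemma wedge_two_form_Nil: "degree_form 2 \<alpha> \<Longrightarrow> (\<alpha> \<^bold>\<and> \<beta>) [] = 0"
  by (simp add: wedge_Nil degree_form_def)

lemma wedge_three_form:
  "degree_form 3 \<alpha> \<Longrightarrow> (\<alpha> \<^bold>\<and> \<beta>) (v # vs) = ((\<lambda>l. \<alpha> (v # l)) \<^bold>\<and> \<beta>) vs - (\<alpha> \<^bold>\<and> (\<lambda>l. \<beta> (v # l))) vs"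
  by (simp add: wedge_Cons)

lemma wedge_three_form_Nil: "degree_form 3 \<alpha> \<Longrightarrow> (\<alpha> \<^bold>\<and> \<beta>) [] = 0"
  by (simp add: wedge_Nil degree_form_def)

lemma degree_form_12: "degree_form 2 \<alpha> \<Longrightarrow> degree_form (Suc 0) (\<lambda>l. \<alpha> (v # l))"
  by (metis numeral_2_eq_2 degree_form_Cons)
lemma degree_form_23: "degree_form 3 \<alpha> \<Longrightarrow> degree_form 2 (\<lambda>l. \<alpha> (v # l))"
  by (metis numeral_3_eq_3 numeral_2_eq_2 degree_form_Cons)

lemma degree_form_13: "degree_form 3 \<alpha> \<Longrightarrow> degree_form (Suc 0) (\<lambda>l. \<alpha> (v # w # l))"
  by (simp add: degree_form_def)

lemmas wedge_eval = degree_form_13 wedge_one_form wedge_one_form_Nil wedge_two_form wedge_two_form_Nil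
  wedge_three_form wedge_three_form_Nil degree_form_12 degree_form_23

lemma wedge_2_2:
  assumes "degree_form 2 \<alpha>" "degree_form 2 \<beta>"
  shows "(\<alpha> \<^bold>\<and> \<beta>) [a,b,c,d] = \<alpha>[a,b]*\<beta>[c,d] - \<alpha>[a,c]*\<beta>[b,d] + \<alpha>[a,d]*\<beta>[b,c] + \<alpha>[b,c]*\<beta>[a,d] - \<alpha>[b,d]*\<beta>[a,c] + \<alpha>[c,d]*\<beta>[a,b]"
  using assms(2) by (simp add: wedge_eval assms(1))

lemma wedge_1_3:
  assumes "degree_form (Suc 0) \<alpha>" "degree_form 3 \<beta>"
  shows "(\<alpha> \<^bold>\<and> \<beta>) [a,b,c,d] = \<alpha>[a]*\<beta>[b,c,d] - \<alpha>[b]*\<beta>[a,c,d] + \<alpha>[c]*\<beta>[a,b,d] - \<alpha>[d]*\<beta>[a,b,c]"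
  using assms(2) by (simp add: wedge_eval assms(1))

lemma wedge_1_2:
  assumes "degree_form (Suc 0) \<alpha>" "degree_form 2 \<beta>"
  shows "(\<alpha> \<^bold>\<and> \<beta>) [a,b,c] = \<alpha>[a]*\<beta>[b,c] - \<alpha>[b]*\<beta>[a,c] + \<alpha>[c]*\<beta>[a,b]"
  using assms(2) by (simp add: wedge_eval assms(1))

lemma wedge_1_1:
  assumes "degree_form (Suc 0) \<alpha>" "degree_form (Suc 0) \<beta>"
  shows "(\<alpha> \<^bold>\<and> \<beta>) [a,b] = \<alpha>[a]*\<beta>[b] - \<alpha>[b]*\<beta>[a]"
  using assms(2) by (simp add: wedge_eval assms(1))

lemma wedge_3_2:
  assumes "degree_form 3 \<alpha>" "degree_form 2 \<beta>"
  shows "(\<alpha> \<^bold>\<and> \<beta>) [a,b,c,d,e] = \<alpha>[a,b,c]*\<beta>[d,e] - \<alpha>[a,b,d]*\<beta>[c,e] + \<alpha>[a,b,e]*\<beta>[c,d]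
   + \<alpha>[a,c,d]*\<beta>[b,e] - \<alpha>[a,c,e]*\<beta>[b,d] + \<alpha>[a,d,e]*\<beta>[b,c]
   - \<alpha>[b,c,d]*\<beta>[a,e] + \<alpha>[b,c,e]*\<beta>[a,d] - \<alpha>[b,d,e]*\<beta>[a,c] + \<alpha>[c,d,e]*\<beta>[a,b]"
  using assms(2) by (simp add: wedge_eval assms(1))

lemma wedge_2_4:
  assumes "degree_form 2 \<alpha>" "degree_form 4 \<beta>"
  shows "(\<alpha> \<^bold>\<and> \<beta>) [a,b,c,d,e,f] =
     \<alpha>[a,b]*\<beta>[c,d,e,f] - \<alpha>[a,c]*\<beta>[b,d,e,f] + \<alpha>[a,d]*\<beta>[b,c,e,f] - \<alpha>[a,e]*\<beta>[b,c,d,f] + \<alpha>[a,f]*\<beta>[b,c,d,e]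
   + \<alpha>[b,c]*\<beta>[a,d,e,f] - \<alpha>[b,d]*\<beta>[a,c,e,f] + \<alpha>[b,e]*\<beta>[a,c,d,f] - \<alpha>[b,f]*\<beta>[a,c,d,e]
   + \<alpha>[c,d]*\<beta>[a,b,e,f] - \<alpha>[c,e]*\<beta>[a,b,d,f] + \<alpha>[c,f]*\<beta>[a,b,d,e]
   + \<alpha>[d,e]*\<beta>[a,b,c,f] - \<alpha>[d,f]*\<beta>[a,b,c,e] + \<alpha>[e,f]*\<beta>[a,b,c,d]"
  using assms(2) by (simp add: wedge_eval assms(1))

lemma alternating_degree: "alternating_form k \<alpha> \<Longrightarrow> degree_form k \<alpha>"
  by (simp add: alternating_form_def degree_form_def)

lemma alternating_linear:
  "alternating_form (length xs + Suc (length ys)) \<alpha> \<Longrightarrow> linear (\<lambda>v. \<alpha> (xs @ v # ys))"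
  unfolding alternating_form_def
  by (drule conjunct2, drule conjunct1, drule spec[of _ "xs @ undefined # ys"], drule spec[of _ "length xs"]) simp

lemma alternating_repeat:
  "alternating_form k \<alpha> \<Longrightarrow> length vs = k \<Longrightarrow> \<not> distinct vs \<Longrightarrow> \<alpha> vs = 0"
  unfolding alternating_form_def distinct_conv_nth by (metis linorder_neqE_nat order.strict_trans)

lemma adjacent_swap:
  fixes \<alpha> :: "('v::real_vector, 'b::real_vector) form"
  assumes lin: "\<And>xs ys. linear (\<lambda>v. \<alpha> (xs @ v # ys))" and adj: "\<And>xs a ys. \<alpha> (xs @ a # a # ys) = 0"
  shows "\<alpha> (xs @ a # b # ys) = - \<alpha> (xs @ b # a # ys)"
proof -
  have 1: "\<alpha> (xs @ (a + b) # c # ys) = \<alpha> (xs @ a # c # ys) + \<alpha> (xs @ b # c # ys)" for c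
    by (rule linear_add[OF lin])
  have 2: "\<alpha> (xs @ c # (a + b) # ys) = \<alpha> (xs @ c # a # ys) + \<alpha> (xs @ c # b # ys)" for c
    using linear_add[OF lin[of "xs @ [c]" ys], of a b] by simp
  have "0 = \<alpha> (xs @ (a + b) # (a + b) # ys)" by (rule adj[symmetric])
  also have "\<dots> = (0 + \<alpha> (xs @ a # b # ys)) + (\<alpha> (xs @ b # a # ys) + 0)" unfolding 1 unfolding 2 unfolding adj ..
  finally show ?thesis by (simp add: eq_neg_iff_add_eq_0)
qed

text \<open>Vanishing on repeated neighbours suffices: by polarisation neighbours can be swapped up to sign, and so two equal arguments
  can be brought next to each other. The conditions are imposed for lists of every length, where they are trivial off degree \<open>k\<close>;
  this avoids bookkeeping of lengths.\<close>

lemma alternating_formI: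
  fixes \<alpha> :: "('v::real_vector, 'b::real_vector) form"
  assumes deg: "\<And>vs. length vs \<noteq> k \<Longrightarrow> \<alpha> vs = 0"
    and lin: "\<And>xs ys. linear (\<lambda>v. \<alpha> (xs @ v # ys))" and adj: "\<And>xs a ys. \<alpha> (xs @ a # a # ys) = 0"
  shows "alternating_form k \<alpha>"
  unfolding alternating_form_def
proof (intro conjI allI impI)
  fix vs :: "'v list" and i assume "length vs = k" "i < k"
  then show "linear (\<lambda>v. \<alpha> (vs[i := v]))"
    using lin[of "take i vs" "drop (Suc i) vs"] by (simp add: upd_conv_take_nth_drop)
next
  have rep: "\<alpha> (xs @ a # ys @ a # zs) = 0" for xs a ys zs
  proof (induction ys arbitrary: xs)
    case (Cons y ys)
    have "\<alpha> (xs @ a # (y # ys) @ a # zs) = - \<alpha> ((xs @ [y]) @ a # ys @ a # zs)"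
      using adjacent_swap[of \<alpha> xs a y "ys @ a # zs", OF lin adj] by simp
    then show ?case by (simp only: Cons.IH) simp
  qed (simp add: adj)
  fix vs :: "'v list" and i j assume "length vs = k" "i < j" "j < k" "vs ! i = vs ! j"
  note ij = this
  have "drop (Suc i) vs = take (j - Suc i) (drop (Suc i) vs) @ vs ! j # drop (Suc (j - Suc i)) (drop (Suc i) vs)"
    using id_take_nth_drop[of "j - Suc i" "drop (Suc i) vs"] ij by simp
  then have "vs = take i vs @ vs ! i # take (j - Suc i) (drop (Suc i) vs) @ vs ! i # drop (Suc (j - Suc i)) (drop (Suc i) vs)"
    using id_take_nth_drop[of i vs] ij by simp
  then show "\<alpha> vs = 0" using rep by metis
qed (rule deg)

lemma alternating_form_linear: "alternating_form k \<alpha> \<Longrightarrow> linear (\<lambda>v. \<alpha> (xs @ v # ys))"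
proof (cases "length xs + Suc (length ys) = k")
  case False
  assume "alternating_form k \<alpha>"
  with False have "(\<lambda>v. \<alpha> (xs @ v # ys)) = (\<lambda>v. 0)" by (auto simp: alternating_form_def)
  then show ?thesis by (simp add: linear_zero)
qed (auto intro: alternating_linear)

lemma alternating_form_adjacent: "alternating_form k \<alpha> \<Longrightarrow> \<alpha> (xs @ a # a # ys) = 0"
  by (cases "length (xs @ a # a # ys) = k") (auto intro!: alternating_repeat simp: alternating_form_def)

lemma alternating_swap:
  fixes \<alpha> :: "('v::real_vector, 'b::real_vector) form"
  assumes "alternating_form k \<alpha>"
  shows "\<alpha> (xs @ a # b # ys) = - \<alpha> (xs @ b # a # ys)"
  using adjacent_swap[of \<alpha> xs a b ys] alternating_form_linear[OF assms] alternating_form_adjacent[OF assms] by blast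

text \<open>Permuting the arguments changes only the sign; the prefix \<open>pre\<close> makes the induction go through.\<close>

lemma alternating_perm:
  fixes \<alpha> :: "('v::real_vector, 'b::real_vector) form"
  assumes "alternating_form k \<alpha>" "mset xs = mset ys" "length (pre @ xs) = k"
  shows "\<alpha> (pre @ xs) = 0 \<longleftrightarrow> \<alpha> (pre @ ys) = 0"
  using assms(2,3)
proof (induction xs arbitrary: pre ys)
  case (Cons x xs)
  obtain y1 y2 where y: "ys = y1 @ x # y2"
    by (metis Cons.prems(1) list.set_intros(1) mset_eq_setD split_list)
  have front: "\<alpha> (p @ y1 @ x # y2) = 0 \<longleftrightarrow> \<alpha> (p @ x # y1 @ y2) = 0" if "length (p @ y1 @ x # y2) = k" for p
    using that
  proof (induction y1 arbitrary: p)
    case (Cons y y1)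
    have "\<alpha> (p @ (y # y1) @ x # y2) = 0 \<longleftrightarrow> \<alpha> ((p @ [y]) @ x # y1 @ y2) = 0"
      using Cons.IH[of "p @ [y]"] Cons.prems by simp
    also have "\<dots> \<longleftrightarrow> \<alpha> (p @ x # y # y1 @ y2) = 0"
      using alternating_swap[OF assms(1), of p x y "y1 @ y2"] by simp
    finally show ?case by simp
  qed simp
  have "mset xs = mset (y1 @ y2)" using Cons.prems(1) y by simp
  then have "\<alpha> ((pre @ [x]) @ xs) = 0 \<longleftrightarrow> \<alpha> ((pre @ [x]) @ y1 @ y2) = 0"
    using Cons.prems by (intro Cons.IH) auto
  moreover have "length (pre @ y1 @ x # y2) = k" using Cons.prems y by (metis length_append size_mset)
  ultimately show ?case using front[of pre] y by simp
qed simp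

text \<open>By multilinearity the values on lists of basis vectors decide, and by alternation those on subsequences of the basis.
  This turns identities between forms into finitely many component identities.\<close>

lemma alternating_form_eq_0:
  fixes \<alpha> :: "('v::real_vector, 'b::real_vector) form"
  assumes alt: "alternating_form k \<alpha>" and B: "distinct B" "span (set B) = UNIV"
    and van: "\<And>xs. xs \<in> set (subseqs B) \<Longrightarrow> length xs = k \<Longrightarrow> \<alpha> xs = 0"
  shows "\<alpha> = (\<lambda>_. 0)"
proof
  fix vs
  have basis: "\<alpha> xs = 0" if "length xs = k" "set xs \<subseteq> set B" for xs
  proof (cases "distinct xs")
    case False
    then show ?thesis using alternating_repeat[OF alt] that by blast
  next
    case True
    let ?ys = "filter (\<lambda>x. x \<in> set xs) B"
    have "mset xs = mset ?ys"
      using True B that by (intro set_eq_iff_mset_eq_distinct[THEN iffD1]) auto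
    moreover have "?ys \<in> set (subseqs B)" by simp
    ultimately show ?thesis using alternating_perm[OF alt, of xs ?ys "[]"] van[of ?ys] that
      by (metis append_Nil size_mset)
  qed
  have "\<alpha> vs = 0" if "m \<le> k" "length vs = k" "\<forall>i\<in>{m..<k}. vs ! i \<in> set B" for m vs
    using that
  proof (induction m arbitrary: vs)
    case 0
    then have "set vs \<subseteq> set B" by (auto simp: set_conv_nth)
    then show ?case using basis 0 by blast
  next
    case (Suc m)
    have lin: "linear (\<lambda>v. \<alpha> (vs[m := v]))" using alt Suc.prems by (auto simp: alternating_form_def)
    have "\<alpha> (vs[m := v]) = 0" if "v \<in> set B" for v
      using Suc.prems that by (intro Suc.IH) (auto simp: nth_list_update)
    then have "\<alpha> (vs[m := vs ! m]) = 0"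
      using linear_eq_0_on_span[OF lin, of "set B" "vs ! m"] B(2) by auto
    then show ?case by simp
  qed
  from this[of k] show "\<alpha> vs = 0"
    using alt unfolding alternating_form_def by (cases "length vs = k") auto
qed

text \<open>Both multilinearity and vanishing on equal neighbours are inherited from the factors through the anti-derivation rule. For two
  equal leading arguments the two mixed contractions cancel, because the degree of the contracted left factor has dropped by one.\<close>

lemma alternating_form_wedge:
  fixes \<alpha> \<beta> :: "('v::real_vector, real) form"
  assumes "alternating_form p \<alpha>" "alternating_form q \<beta>"
  shows "alternating_form (p + q) (\<alpha> \<^bold>\<and> \<beta>)"
proof (rule alternating_formI)
  define multi where "multi \<alpha> \<longleftrightarrow> (\<forall>xs ys. linear (\<lambda>v. \<alpha> (xs @ v # ys))) \<and> (\<forall>xs a ys. \<alpha> (xs @ a # a # ys) = 0)"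
    for \<alpha> :: "('v, real) form"
  have contract: "multi (\<lambda>l. \<alpha> (w # l))" if "multi \<alpha>" for \<alpha> w
    unfolding multi_def
    using that[unfolded multi_def, THEN conjunct1, rule_format, of "w # xs" for xs]
      that[unfolded multi_def, THEN conjunct2, rule_format, of "w # xs" for xs] by simp
  have contract_degree: "\<exists>p. degree_form p (\<lambda>l. \<alpha> (w # l))" if "degree_form p \<alpha>" for p w and \<alpha> :: "('v, real) form"
  proof (cases p)
    case 0
    then have "degree_form 0 (\<lambda>l. \<alpha> (w # l))" using that by (simp add: degree_form_def)
    then show ?thesis ..
  next
    case (Suc p')
    have "degree_form p' (\<lambda>l. \<alpha> (w # l))" by (rule degree_form_Cons) (use that Suc in simp)
    then show ?thesis ..
  qed
  have zero: "((\<lambda>_. 0) \<^bold>\<and> \<beta>) vs = 0" "(\<alpha> \<^bold>\<and> (\<lambda>_. 0)) vs = 0" for \<alpha> \<beta> :: "('v, real) form" and vs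
    by (simp_all add: wedge_def)
  \<comment> \<open>The factors and the degree of the left one are generalised, since both change under contraction.\<close>
  have lin: "linear (\<lambda>v. (\<alpha> \<^bold>\<and> \<beta>) (xs @ v # ys))" if "multi \<alpha>" "multi \<beta>" "degree_form p \<alpha>" for \<alpha> \<beta> xs ys p
    using that
  proof (induction xs arbitrary: \<alpha> \<beta> p)
    case Nil
    have l: "linear (\<lambda>v. \<alpha> (v # l))" "linear (\<lambda>v. \<beta> (v # l))" for l
      using Nil(1,2)[unfolded multi_def, THEN conjunct1, rule_format, of "[]"] by simp_all
    show ?case
      unfolding append_Nil wedge_Cons[OF Nil(3)] unfolding wedge_def
      by (auto intro!: linearI simp: linear_add[OF l(1)] linear_add[OF l(2)] linear_scale[OF l(1)] linear_scale[OF l(2)]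
          algebra_simps sum.distrib sum_distrib_left)
  next
    case (Cons w xs)
    obtain p' where p': "degree_form p' (\<lambda>l. \<alpha> (w # l))" using contract_degree[OF Cons.prems(3)] by blast
    have 1: "linear (\<lambda>v. ((\<lambda>l. \<alpha> (w # l)) \<^bold>\<and> \<beta>) (xs @ v # ys))"
      by (rule Cons.IH[OF contract[OF Cons.prems(1)] Cons.prems(2) p'])
    have 2: "linear (\<lambda>v. (-1) ^ p *\<^sub>R (\<alpha> \<^bold>\<and> (\<lambda>l. \<beta> (w # l))) (xs @ v # ys))"
      by (rule linear_compose_scale_right, rule Cons.IH[OF Cons.prems(1) contract[OF Cons.prems(2)] Cons.prems(3)])
    show ?case
      using linear_compose_add[OF 1 2] unfolding append_Cons wedge_Cons[OF Cons.prems(3)] by simp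
  qed
  have adj: "(\<alpha> \<^bold>\<and> \<beta>) (xs @ a # a # ys) = 0" if "multi \<alpha>" "multi \<beta>" "degree_form p \<alpha>" for \<alpha> \<beta> xs a ys p
    using that
  proof (induction xs arbitrary: \<alpha> \<beta> p)
    case Nil
    have 0: "(\<lambda>l. \<alpha> (a # a # l)) = (\<lambda>_. 0)" "(\<lambda>l. \<beta> (a # a # l)) = (\<lambda>_. 0)"
      using Nil(1,2)[unfolded multi_def, THEN conjunct2, rule_format, of "[]"] by simp_all
    show ?case
    proof (cases p)
      case 0
      then have "(\<lambda>l. \<alpha> (a # l)) = (\<lambda>_. 0)" using Nil by (auto simp: degree_form_def)
      then show ?thesis by (simp add: wedge_Cons[OF Nil(3)] zero \<open>(\<lambda>l. \<beta> (a # a # l)) = (\<lambda>_. 0)\<close>)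
    next
      case (Suc p')
      have "degree_form p' (\<lambda>l. \<alpha> (a # l))" using Nil Suc by (simp add: degree_form_Cons)
      then show ?thesis by (simp add: wedge_Cons[OF Nil(3)] wedge_Cons[of p'] 0 zero Suc)
    qed
  next
    case (Cons w xs)
    obtain p' where p': "degree_form p' (\<lambda>l. \<alpha> (w # l))" using contract_degree[OF Cons.prems(3)] by blast
    have "((\<lambda>l. \<alpha> (w # l)) \<^bold>\<and> \<beta>) (xs @ a # a # ys) = 0"
      by (rule Cons.IH[OF contract[OF Cons.prems(1)] Cons.prems(2) p'])
    moreover have "(\<alpha> \<^bold>\<and> (\<lambda>l. \<beta> (w # l))) (xs @ a # a # ys) = 0"
      by (rule Cons.IH[OF Cons.prems(1) contract[OF Cons.prems(2)] Cons.prems(3)])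
    ultimately show ?case by (simp add: wedge_Cons[OF Cons.prems(3)])
  qed
  have m: "multi \<alpha>" "multi \<beta>" unfolding multi_def
    using alternating_form_linear[OF assms(1)] alternating_form_adjacent[OF assms(1)]
      alternating_form_linear[OF assms(2)] alternating_form_adjacent[OF assms(2)] by simp_all
  show "linear (\<lambda>v. (\<alpha> \<^bold>\<and> \<beta>) (xs @ v # ys))" for xs ys
    by (rule lin[OF m alternating_degree[OF assms(1)]])
  show "(\<alpha> \<^bold>\<and> \<beta>) (xs @ a # a # ys) = 0" for xs a ys
    by (rule adj[OF m alternating_degree[OF assms(1)]])
  show "(\<alpha> \<^bold>\<and> \<beta>) vs = 0" if "length vs \<noteq> p + q" for vs
    using degree_form_wedge[OF alternating_degree[OF assms(1)] alternating_degree[OF assms(2)]] that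
    by (simp add: degree_form_def)
qed

lemma alternating_form_add:
  "alternating_form k \<alpha> \<Longrightarrow> alternating_form k \<beta> \<Longrightarrow> alternating_form k (\<lambda>vs. \<alpha> vs + \<beta> vs)"
  unfolding alternating_form_def by (auto intro: linear_compose_add)

lemma alternating_form_minus: "alternating_form k \<alpha> \<Longrightarrow> alternating_form k (\<lambda>vs. - \<alpha> vs)"
  unfolding alternating_form_def by (auto intro: linear_compose_neg)

lemma alternating_form_2I:
  fixes f :: "'v::real_vector \<Rightarrow> 'v \<Rightarrow> real"
  assumes "\<And>b. linear (\<lambda>a. f a b)" "\<And>a. linear (f a)" "\<And>a. f a a = 0"
  shows "alternating_form 2 (\<lambda>vs. case vs of [a, b] \<Rightarrow> f a b | _ \<Rightarrow> 0)"
proof (rule alternating_formI)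
  show "linear (\<lambda>v. case xs @ v # ys of [a, b] \<Rightarrow> f a b | _ \<Rightarrow> 0)" for xs ys
  proof (cases "length xs + length ys = 1")
    case True
    then have "length xs = 0 \<and> length ys = 1 \<or> length xs = 1 \<and> length ys = 0" by arith
    then show ?thesis by (auto simp: length_Suc_conv assms)
  next
    case False
    have "(case l of [a, b] \<Rightarrow> f a b | _ \<Rightarrow> 0) = 0" if "length l \<noteq> 2" for l
      using that by (auto split: list.splits)
    then have "(\<lambda>v. case xs @ v # ys of [a, b] \<Rightarrow> f a b | _ \<Rightarrow> 0) = (\<lambda>_. 0)"
      using False by (intro ext) simp
    then show ?thesis by (simp add: linear_zero)
  qed
qed (auto simp: assms(3) append_eq_Cons_conv Cons_eq_append_conv split: list.splits)

lemma alternating_form_4I: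
  fixes f :: "'v::real_vector \<Rightarrow> 'v \<Rightarrow> 'v \<Rightarrow> 'v \<Rightarrow> real"
  assumes lin: "\<And>b c d. linear (\<lambda>a. f a b c d)" "\<And>a c d. linear (\<lambda>b. f a b c d)" "\<And>a b d. linear (\<lambda>c. f a b c d)"
      "\<And>a b c. linear (f a b c)"
    and adj: "\<And>a b c. f a a b c = 0" "\<And>a b c. f a b b c = 0" "\<And>a b c. f a b c c = 0"
  shows "alternating_form 4 (\<lambda>vs. case vs of [a, b, c, d] \<Rightarrow> f a b c d | _ \<Rightarrow> 0)"
proof (rule alternating_formI)
  show "linear (\<lambda>v. case xs @ v # ys of [a, b, c, d] \<Rightarrow> f a b c d | _ \<Rightarrow> 0)" for xs ys
  proof (cases "length xs + length ys = 3")
    case True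
    then have "length xs = 0 \<and> length ys = 3 \<or> length xs = 1 \<and> length ys = 2 \<or> length xs = 2 \<and> length ys = 1
        \<or> length xs = 3 \<and> length ys = 0" by arith
    then show ?thesis by (auto simp: length_Suc_conv numeral_eq_Suc lin)
  next
    case False
    have "(case l of [a, b, c, d] \<Rightarrow> f a b c d | _ \<Rightarrow> 0) = 0" if "length l \<noteq> 4" for l
      using that by (auto split: list.splits)
    then have "(\<lambda>v. case xs @ v # ys of [a, b, c, d] \<Rightarrow> f a b c d | _ \<Rightarrow> 0) = (\<lambda>_. 0)"
      using False by (intro ext) simp
    then show ?thesis by (simp add: linear_zero)
  qed
next
  show "(case xs @ v # v # ys of [a, b, c, d] \<Rightarrow> f a b c d | _ \<Rightarrow> 0) = 0" for xs v ys
  proof (cases "length xs + length ys = 2")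
    case True
    then have "length xs = 0 \<and> length ys = 2 \<or> length xs = 1 \<and> length ys = 1 \<or> length xs = 2 \<and> length ys = 0" by arith
    then show ?thesis by (auto simp: length_Suc_conv numeral_eq_Suc adj)
  next
    case False
    have "(case l of [a, b, c, d] \<Rightarrow> f a b c d | _ \<Rightarrow> 0) = 0" if "length l \<noteq> 4" for l
      using that by (auto split: list.splits)
    then show ?thesis using False by simp
  qed
qed (auto split: list.splits)

lemma less_2_nat: "(i::nat) < 2 \<longleftrightarrow> i = 0 \<or> i = 1" by auto
lemma less_3_nat: "(i::nat) < 3 \<longleftrightarrow> i = 0 \<or> i = 1 \<or> i = 2" by auto
lemma length_3: "length vs = 3 \<longleftrightarrow> (\<exists>a b c. vs = [a, b, c])"
  by (auto simp: numeral_3_eq_3 length_Suc_conv)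

lemma alternating_form_3I:
  fixes f :: "'v::real_vector \<Rightarrow> 'v \<Rightarrow> 'v \<Rightarrow> real"
  assumes "\<And>b c. linear (\<lambda>a. f a b c)" "\<And>a c. linear (\<lambda>b. f a b c)" "\<And>a b. linear (f a b)"
    and "\<And>a b. f a a b = 0" "\<And>a b. f a b a = 0" "\<And>a b. f a b b = 0"
  shows "alternating_form 3 (\<lambda>vs. case vs of [a, b, c] \<Rightarrow> f a b c | _ \<Rightarrow> 0)"
  unfolding alternating_form_def
proof (intro conjI allI impI)
  fix vs :: "'v list" assume "length vs \<noteq> 3"
  then show "(case vs of [a, b, c] \<Rightarrow> f a b c | _ \<Rightarrow> 0) = 0" by (auto split: list.splits)
next
  fix vs :: "'v list" and i :: nat assume "length vs = 3" "i < 3"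
  then show "linear (\<lambda>v. case vs[i := v] of [a, b, c] \<Rightarrow> f a b c | _ \<Rightarrow> 0)"
    using assms(1,2,3) by (auto simp: length_3 less_3_nat)
next
  fix vs :: "'v list" and i j :: nat assume "length vs = 3" "i < j" "j < 3" "vs ! i = vs ! j"
  then show "(case vs of [a, b, c] \<Rightarrow> f a b c | _ \<Rightarrow> 0) = 0"
    using assms(4,5,6) by (auto simp: length_3 less_3_nat less_2_nat)
qed

text \<open>Used to write out sums over the subsets of a small initial segment of the natural numbers.\<close>

lemma sum_Pow_lessThan_Suc:
  "(\<Sum>T\<in>Pow {..<Suc n}. f T) = (\<Sum>T\<in>Pow {..<n}. f T) + (\<Sum>T\<in>Pow {..<n}. f (insert n T))"
proof -
  have "Pow {..<Suc n} = Pow {..<n} \<union> insert n ` Pow {..<n}"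
    by (simp add: lessThan_Suc Pow_insert)
  moreover have "Pow {..<n} \<inter> insert n ` Pow {..<n} = {}" by auto
  moreover have "inj_on (insert n) (Pow {..<n})"
  proof (rule inj_onI)
    fix S T assume ST: "S \<in> Pow {..<n}" "T \<in> Pow {..<n}" "insert n S = insert n T"
    then have "n \<notin> S" "n \<notin> T" by auto
    then show "S = T" using ST(3) by (metis Diff_insert_absorb)
  qed
  ultimately show ?thesis by (simp add: sum.union_disjoint sum.reindex)
qed

text \<open>The component is evaluated on arguments \<open>a, b, c, J a\<close>. With the (1,0)- or (0,1)-parts of \<open>a\<close> and \<open>J a\<close> both in play, the
  choices of slots in which \<open>a\<close> and \<open>J a\<close> are projected to the same type contribute nothing, and the two remaining choices of the (0,1)-slot
  agree, each projecting \<open>b\<close> and \<open>c\<close> to type (1,0).\<close>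

lemma type_component_3_1:
  fixes J :: "'v::real_vector \<Rightarrow> 'v" and \<psi> :: "('v, complex) form"
  assumes JJ: "\<And>v. J (J v) = - v" and z: "\<And>y z. \<psi> [a, y, z, - a] = 0" "\<And>y z. \<psi> [J a, y, z, J a] = 0"
    "\<And>y z. \<psi> [J a, y, z, - a] = \<psi> [a, y, z, J a]"
  shows "type_component J 3 1 \<psi> [a, b, c, J a] =
    (\<psi> [a, b, c, J a] - \<i> * \<psi> [a, J b, c, J a] - \<i> * \<psi> [a, b, J c, J a] - \<psi> [a, J b, J c, J a]) / 4"
proof -
  have upt4: "[0..<4] = [0, 1, 2, 3::nat]" by (simp add: upt_rec)
  have four: "{..<4} = {..<Suc (Suc (Suc (Suc 0)))}" by (simp add: numeral_eq_Suc)
  have "{S. S \<subseteq> {..<4::nat} \<and> card S = 3} = {S \<in> Pow {..<4}. card S = 3}" by auto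
  then have S: "(\<Sum>S | S \<subseteq> {..<4::nat} \<and> card S = 3. f S) = (\<Sum>S\<in>Pow {..<4}. if card S = 3 then f S else 0)"
    for f :: "nat set \<Rightarrow> complex"
    by (simp only: sum.inter_filter[OF finite_Pow_iff[THEN iffD2, OF finite_lessThan]])
  show ?thesis
    unfolding type_component_def
    by (simp add: S upt4) (simp add: four sum_Pow_lessThan_Suc JJ z field_simps)
qed

section \<open>Linear algebra of a single SU(3)-structure\<close>

lemma exhaust_6: "(i::6) = 1 \<or> i = 2 \<or> i = 3 \<or> i = 4 \<or> i = 5 \<or> i = 6"
proof (induct i)
  case (of_int z)
  then have "0 \<le> z" and "z < 6" by simp_all
  then have "z = 0 \<or> z = 1 \<or> z = 2 \<or> z = 3 \<or> z = 4 \<or> z = 5" by arith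
  then show ?case by auto
qed

lemma UNIV_6: "(UNIV :: 6 set) = {1, 2, 3, 4, 5, 6}"
  using exhaust_6 by auto

lemma sum_6: "sum f (UNIV :: 6 set) = f 1 + f 2 + f 3 + f 4 + f 5 + f 6"
  unfolding UNIV_6 by (simp add: ac_simps)

lemma forall_6: "(\<forall>i::6. P i) \<longleftrightarrow> P 1 \<and> P 2 \<and> P 3 \<and> P 4 \<and> P 5 \<and> P 6"
  by (metis exhaust_6)

text \<open>If \<open>E\<close> and \<open>E'\<close> are dual with respect to a bilinear form, the inverse of its coordinate matrix is \<open>\<Sum> E'\<^sub>a \<otimes> E\<^sub>a\<close>. So
  coordinate contractions with this inverse are sums over the frame. It is applied to the metric with \<open>E' = E\<close> and to \<open>\<kappa>\<close> with
  \<open>E' = J E\<close>.\<close>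

lemma matrix_inv_dual_bases:
  fixes m :: "real ^ 'n \<Rightarrow> real ^ 'n \<Rightarrow> real" and E E' :: "'n \<Rightarrow> real ^ 'n"
  assumes lin: "\<And>w. linear (\<lambda>v. m v w)" "\<And>v. linear (m v)"
    and dual: "\<And>a b. m (E a) (E' b) = (if a = b then 1 else 0)"
  shows "invertible (\<chi> i j. m (axis i 1) (axis j 1))"
    and "matrix_inv (\<chi> i j. m (axis i 1) (axis j 1)) $ j $ k = (\<Sum>a\<in>UNIV. E' a $ j * E a $ k)"
proof -
  define M where "M = (\<chi> i j. m (axis i 1) (axis j 1))"
  define P :: "real ^ 'n ^ 'n" where "P = (\<chi> a j. E a $ j)"
  define Q :: "real ^ 'n ^ 'n" where "Q = (\<chi> j a. E' a $ j)"
  have "((P ** M) ** Q) $ a $ b = (\<Sum>k\<in>UNIV. \<Sum>j\<in>UNIV. E a $ j * E' b $ k * m (axis j 1) (axis k 1))" for a b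
    by (simp add: matrix_matrix_mult_def P_def Q_def M_def sum_distrib_right sum_distrib_left mult_ac)
  also have "\<dots> a b = m (E a) (E' b)" for a b
    by (subst sum.swap) (rule bilinear_axis_expansion[OF lin, symmetric])
  finally have "(P ** M) ** Q = mat 1"
    by (simp add: vec_eq_iff dual mat_def)
  then have QPM: "(Q ** P) ** M = mat 1" "M ** (Q ** P) = mat 1"
    by (metis matrix_left_right_inverse matrix_mul_assoc)+
  then have inv: "invertible M" using invertible_def by blast
  then have "matrix_inv M = Q ** P"
    by (metis QPM(1) matrix_inv_invertible(1) matrix_mul_assoc matrix_mul_lid matrix_mul_rid)
  then show "matrix_inv M $ j $ k = (\<Sum>a\<in>UNIV. E' a $ j * E a $ k)"
    by (simp add: matrix_matrix_mult_def P_def Q_def)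
  show "invertible M" by (rule inv)
qed

lemma dual_bases_contraction:
  fixes b :: "real ^ 'n \<Rightarrow> real ^ 'n \<Rightarrow> real"
  assumes lin: "\<And>w. linear (\<lambda>v. b v w)" "\<And>v. linear (b v)"
  shows "(\<Sum>j\<in>UNIV. \<Sum>k\<in>UNIV. (\<Sum>a\<in>UNIV. E' a $ j * E a $ k) * b (axis j 1) (axis k 1)) =
    (\<Sum>a\<in>UNIV. b (E' a) (E a))"
proof -
  have "(\<Sum>j\<in>UNIV. \<Sum>k\<in>UNIV. (\<Sum>a\<in>UNIV. E' a $ j * E a $ k) * b (axis j 1) (axis k 1)) =
    (\<Sum>j\<in>UNIV. \<Sum>k\<in>UNIV. \<Sum>a\<in>UNIV. E' a $ j * E a $ k * b (axis j 1) (axis k 1))"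
    by (simp add: sum_distrib_right)
  also have "\<dots> = (\<Sum>j\<in>UNIV. \<Sum>a\<in>UNIV. \<Sum>k\<in>UNIV. E' a $ j * E a $ k * b (axis j 1) (axis k 1))"
    by (intro sum.cong refl sum.swap)
  also have "\<dots> = (\<Sum>a\<in>UNIV. \<Sum>j\<in>UNIV. \<Sum>k\<in>UNIV. E' a $ j * E a $ k * b (axis j 1) (axis k 1))"
    by (rule sum.swap)
  finally show ?thesis by (simp add: bilinear_axis_expansion[OF lin, symmetric])
qed

text \<open>A single SU(3)-structure on \<open>\<real>\<^sup>6\<close> with a chosen adapted coframe \<open>u\<close> and its dual frame \<open>E\<close>. Identities between \<open>g\<close>, \<open>J\<close>, \<open>\<kappa>\<close>
  and \<open>\<Omega>\<close> are checked in the coordinates \<open>u\<close>.\<close>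

locale su3_point =
  fixes \<kappa> \<Omega> :: "(real ^ 6, real) form" and u :: "real ^ 6 \<Rightarrow> real ^ 6"
  assumes adapted: "adapted_coframe \<kappa> \<Omega> u"
begin

definition E :: "6 \<Rightarrow> real ^ 6" where "E i = inv u (axis i 1)"

definition J :: "real ^ 6 \<Rightarrow> real ^ 6" where
  "J v = (u v $ 1) *\<^sub>R E 2 - (u v $ 2) *\<^sub>R E 1 + (u v $ 3) *\<^sub>R E 4 - (u v $ 4) *\<^sub>R E 3
      + (u v $ 5) *\<^sub>R E 6 - (u v $ 6) *\<^sub>R E 5"

definition g :: "real ^ 6 \<Rightarrow> real ^ 6 \<Rightarrow> real" where
  "g v w = (\<Sum>i\<in>UNIV. u v $ i * u w $ i)"

lemma linear_u: "linear u" and bij_u: "bij u"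
  using adapted by (simp_all add: adapted_coframe_def coframe_def)

lemma u_lin [simp]: "u (v + w) = u v + u w" "u (v - w) = u v - u w" "u (- v) = - u v" "u (r *\<^sub>R v) = r *\<^sub>R u v" "u 0 = 0"
  using linear_u by (simp_all add: linear_add linear_diff linear_neg linear_scale linear_0)

lemma u_E [simp]: "u (E i) $ j = (if i = j then 1 else 0)"
  using bij_u by (simp add: E_def bij_is_surj surj_f_inv_f axis_def)

lemma eq_iff_u: "v = w \<longleftrightarrow> (\<forall>i. u v $ i = u w $ i)"
  using bij_u by (metis bij_is_inj injD vec_eq_iff)

lemma u_J [simp]: "u (J v) $ 1 = - u v $ 2" "u (J v) $ 2 = u v $ 1" "u (J v) $ 3 = - u v $ 4"
  "u (J v) $ 4 = u v $ 3" "u (J v) $ 5 = - u v $ 6" "u (J v) $ 6 = u v $ 5"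
  by (simp_all add: J_def)

lemma degree_covec: "degree_form (Suc 0) (covec u i)"
  by (auto simp: degree_form_def covec_def split: list.splits)

lemma kappa_def: "\<kappa> = (\<lambda>vs. (covec u 1 \<^bold>\<and> covec u 2) vs + (covec u 3 \<^bold>\<and> covec u 4) vs + (covec u 5 \<^bold>\<and> covec u 6) vs)"
  and Omega_def: "\<Omega> = (\<lambda>vs. (covec u 1 \<^bold>\<and> covec u 3 \<^bold>\<and> covec u 5) vs - (covec u 1 \<^bold>\<and> covec u 4 \<^bold>\<and> covec u 6) vs
                 - (covec u 2 \<^bold>\<and> covec u 4 \<^bold>\<and> covec u 5) vs - (covec u 2 \<^bold>\<and> covec u 3 \<^bold>\<and> covec u 6) vs)"
  using adapted unfolding adapted_coframe_def Let_def by blast+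

lemma kappa_eq: "\<kappa> [v, w] = u v $ 1 * u w $ 2 - u v $ 2 * u w $ 1 + (u v $ 3 * u w $ 4 - u v $ 4 * u w $ 3)
    + (u v $ 5 * u w $ 6 - u v $ 6 * u w $ 5)"
  by (simp add: kappa_def wedge_1_1 degree_covec) (simp add: covec_def)

lemma degree_covec2: "degree_form 2 (covec u i \<^bold>\<and> covec u j)"
  using degree_form_wedge[OF degree_covec degree_covec] by (simp add: numeral_2_eq_2)

lemma Omega_eq: "\<Omega> [a, b, c] =
    (let D = (\<lambda>i j k. u a $ i * (u b $ j * u c $ k - u c $ j * u b $ k) - u b $ i * (u a $ j * u c $ k - u c $ j * u a $ k)
      + u c $ i * (u a $ j * u b $ k - u b $ j * u a $ k))
     in D 1 3 5 - D 1 4 6 - D 2 4 5 - D 2 3 6)"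
  by (simp add: Omega_def wedge_1_2 wedge_1_1 degree_covec degree_covec2) (simp add: covec_def)

lemma degree_kappa: "degree_form 2 \<kappa>" and degree_Omega: "degree_form 3 \<Omega>"
proof -
  have "degree_form 2 (covec u i \<^bold>\<and> covec u j)" "degree_form 3 (covec u i \<^bold>\<and> covec u j \<^bold>\<and> covec u k)" for i j k
    using degree_covec2 degree_form_wedge[OF degree_covec degree_covec2] by (simp_all add: numeral_3_eq_3)
  then show "degree_form 2 \<kappa>" "degree_form 3 \<Omega>"
    by (subst kappa_def Omega_def, simp add: degree_form_def)+
qed

lemma J_lin [simp]: "J (v + w) = J v + J w" "J (v - w) = J v - J w" "J (- v) = - J v" "J (r *\<^sub>R v) = r *\<^sub>R J v" "J 0 = 0"
  by (simp_all add: J_def algebra_simps)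

lemma linear_J: "linear J" by (rule linearI) simp_all

lemma J_J [simp]: "J (J v) = - v"
  by (simp add: eq_iff_u forall_6)

lemma J_E: "J (E 1) = E 2" "J (E 2) = - E 1" "J (E 3) = E 4" "J (E 4) = - E 3" "J (E 5) = E 6" "J (E 6) = - E 5"
  by (simp_all add: J_def)

lemma linear_g: "linear (g v)" "linear (\<lambda>v. g v w)"
  by (auto intro!: linearI simp: g_def algebra_simps sum.distrib sum_distrib_left)

lemma g_sym: "g v w = g w v" by (simp add: g_def mult.commute)

lemma g_E [simp]: "g (E i) (E j) = (if i = j then 1 else 0)"
  by (simp add: g_def mult_delta_left)

lemma g_E_right: "g v (E i) = u v $ i"
  by (simp add: g_def if_distrib cong: if_cong)

lemma g_J_J [simp]: "g (J v) (J w) = g v w"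
  by (simp add: g_def sum_6)

lemma g_nondegenerate: "(\<And>w. g v w = g v' w) \<Longrightarrow> v = v'"
  by (simp add: eq_iff_u flip: g_E_right)

lemma kappa_g: "\<kappa> [v, w] = g (J v) w"
  by (simp add: kappa_eq g_def sum_6)

lemma frame_expansion: "v = (\<Sum>i\<in>UNIV. g v (E i) *\<^sub>R E i)"
proof -
  have "u (\<Sum>i\<in>UNIV. g v (E i) *\<^sub>R E i) $ j = g v (E j)" for j
    by (simp add: linear_sum[OF linear_u] if_distrib cong: if_cong)
  then show ?thesis by (simp add: eq_iff_u g_E_right)
qed

lemma Omega_J: "\<Omega> [J a, b, c] = \<Omega> [a, J b, c]" "\<Omega> [a, J b, c] = \<Omega> [a, b, J c]"
  unfolding Omega_eq Let_def by (simp_all add: algebra_simps)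

lemma kappa_nondegenerate_dual: "\<kappa> [E a, J (E b)] = (if a = b then 1 else 0)"
  by (simp add: kappa_g)

lemma linear_kappa: "linear (\<lambda>v. \<kappa> [v, w])" "linear (\<lambda>w. \<kappa> [v, w])"
  unfolding kappa_g by (auto intro!: linearI simp: linear_add[OF linear_g(1)] linear_add[OF linear_g(2)]
      linear_scale[OF linear_g(1)] linear_scale[OF linear_g(2)])

lemma linear_Omega: "linear (\<lambda>a. \<Omega> [a, b, c])" "linear (\<lambda>b. \<Omega> [a, b, c])" "linear (\<lambda>c. \<Omega> [a, b, c])"
  by (auto intro!: linearI simp: Omega_eq algebra_simps)

lemma kappa_matrix:
  shows "invertible (\<chi> i j. \<kappa> [axis i 1, axis j 1])"
    and "matrix_inv (\<chi> i j. \<kappa> [axis i 1, axis j 1]) $ j $ k = (\<Sum>a\<in>UNIV. J (E a) $ j * E a $ k)"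
  by (rule matrix_inv_dual_bases[OF linear_kappa kappa_nondegenerate_dual])+

lemma g_matrix:
  shows "invertible (\<chi> i j. g (axis i 1) (axis j 1))"
    and "matrix_inv (\<chi> i j. g (axis i 1) (axis j 1)) $ j $ k = (\<Sum>a\<in>UNIV. E a $ j * E a $ k)"
  by (rule matrix_inv_dual_bases[OF linear_g(2,1) g_E])+

text \<open>In the complex coordinates of the coframe \<open>\<Omega>\<close> is the real part of \<open>dz\<^sub>1 \<and> dz\<^sub>2 \<and> dz\<^sub>3\<close>, whose contraction with itself in two
  slots is a multiple of the metric.\<close>

lemma Omega_contraction: "(\<Sum>a\<in>UNIV. \<Sum>b\<in>UNIV. \<Omega> [v, E a, E b] * \<Omega> [w, E a, E b]) = 4 * g v w"
  unfolding sum_6 Omega_eq Let_def g_def by (simp add: algebra_simps)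

text \<open>A formula for the metric that involves no frame and is rational in the components of \<open>\<kappa>\<close> and \<open>\<Omega>\<close>. Raising an index with
  the inverse of \<open>\<kappa>\<close> is raising it with \<open>g\<close> followed by \<open>J\<close>, and two applications of \<open>J\<close> to \<open>\<Omega>\<close> give a sign.\<close>

lemma g_formula:
  defines "W \<equiv> matrix_inv (\<chi> i j. \<kappa> [axis i 1, axis j 1])"
  shows "g v w = - (1/4) * (\<Sum>i\<in>UNIV. \<Sum>k\<in>UNIV. W $ i $ k * (\<Sum>j\<in>UNIV. \<Sum>l\<in>UNIV. W $ j $ l *
     (\<Omega> [v, axis i 1, axis j 1] * \<Omega> [w, axis k 1, axis l 1])))"
proof -
  have "(\<Sum>j\<in>UNIV. \<Sum>l\<in>UNIV. W $ j $ l * (\<Omega> [v, x, axis j 1] * \<Omega> [w, y, axis l 1])) =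
      (\<Sum>b\<in>UNIV. \<Omega> [v, x, J (E b)] * \<Omega> [w, y, E b])" for x y
    unfolding W_def kappa_matrix(2)
    by (rule dual_bases_contraction) (auto intro!: linearI simp: linear_add[OF linear_Omega(3)] linear_scale[OF linear_Omega(3)] algebra_simps)
  moreover have "(\<Sum>i\<in>UNIV. \<Sum>k\<in>UNIV. W $ i $ k * (\<Sum>b\<in>UNIV. \<Omega> [v, axis i 1, J (E b)] * \<Omega> [w, axis k 1, E b])) =
      (\<Sum>a\<in>UNIV. (\<Sum>b\<in>UNIV. \<Omega> [v, J (E a), J (E b)] * \<Omega> [w, E a, E b]))"
    unfolding W_def kappa_matrix(2)
    by (rule dual_bases_contraction)
      (auto intro!: linearI simp: linear_add[OF linear_Omega(2)] linear_scale[OF linear_Omega(2)] algebra_simps sum.distrib sum_distrib_left)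
  moreover have "\<Omega> [v, J a, J b] = - \<Omega> [v, a, b]" for a b
    unfolding Omega_J(2) using linear_neg[OF linear_Omega(3)] by simp
  ultimately show ?thesis using Omega_contraction[of v w] by (simp add: sum_negf)
qed

lemma J_formula: "J v $ i = (\<Sum>k\<in>UNIV. matrix_inv (\<chi> i j. g (axis i 1) (axis j 1)) $ i $ k * \<kappa> [v, axis k 1])"
proof -
  have "J v $ i = (\<Sum>a\<in>UNIV. E a $ i * \<kappa> [v, E a])"
    by (subst frame_expansion) (simp add: kappa_g mult.commute)
  also have "\<dots> = (\<Sum>a\<in>UNIV. \<Sum>k\<in>UNIV. E a $ i * E a $ k * \<kappa> [v, axis k 1])"
    by (subst linear_axis_expansion[OF linear_kappa(2)]) (simp add: sum_distrib_left mult_ac)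
  also have "\<dots> = (\<Sum>k\<in>UNIV. \<Sum>a\<in>UNIV. E a $ i * E a $ k * \<kappa> [v, axis k 1])" by (rule sum.swap)
  finally show ?thesis by (simp add: g_matrix(2) sum_distrib_right)
qed

text \<open>The complex number \<open>\<epsilon>(a, b, c)\<close> is the determinant of the matrix of complex coordinates of \<open>a, b, c\<close>. Its squared absolute
  value is therefore the Gram determinant of the Hermitian form \<open>g - \<i> \<kappa>\<close>. The point of this normalisation of \<open>\<Omega>\<close> is that it
  can be differentiated with \<open>a, b, c\<close> kept constant.\<close>

lemma Omega_gram: "(\<Omega> [a, b, c])\<^sup>2 + (\<Omega> [J a, b, c])\<^sup>2 =
   g a a * g b b * g c c
   + 2 * (g a b * g b c * g c a - g a b * \<kappa> [b, c] * \<kappa> [c, a] - \<kappa> [a, b] * g b c * \<kappa> [c, a] - \<kappa> [a, b] * \<kappa> [b, c] * g c a)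
   - g a a * ((g b c)\<^sup>2 + (\<kappa> [b, c])\<^sup>2) - g b b * ((g c a)\<^sup>2 + (\<kappa> [c, a])\<^sup>2) - g c c * ((g a b)\<^sup>2 + (\<kappa> [a, b])\<^sup>2)"
proof -
  define z where "z v i = (if i = (1::3) then Complex (u v $ 1) (u v $ 2) else if i = 2 then Complex (u v $ 3) (u v $ 4) else Complex (u v $ 5) (u v $ 6))" for v i
  define vs where "vs i = (if i = (1::3) then a else if i = 2 then b else c)" for i
  define Z where "Z = (\<chi> i j. z (vs i) j)"
  define Z' where "Z' = (\<chi> i j. cnj (z (vs j) i))"
  have ZZ: "(Z ** Z') $ i $ j = Complex (g (vs i) (vs j)) (- \<kappa> [vs i, vs j])" for i j
    by (simp add: Z_def Z'_def matrix_matrix_mult_def sum_3 z_def complex_eq_iff g_def sum_6 kappa_eq)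
  have d1: "det Z = Complex (\<Omega> [a, b, c]) (- \<Omega> [J a, b, c])"
    unfolding det_3 Omega_eq Let_def by (simp add: Z_def z_def vs_def complex_eq_iff algebra_simps)
  have d2: "det Z' = Complex (\<Omega> [a, b, c]) (\<Omega> [J a, b, c])"
    unfolding det_3 Omega_eq Let_def by (simp add: Z'_def z_def vs_def complex_eq_iff algebra_simps)
  have k: "\<kappa> [x, y] = - \<kappa> [y, x]" "\<kappa> [x, x] = 0" for x y by (simp_all add: kappa_eq)
  have herm: "Re (Complex p 0 * Complex q 0 * Complex r 0 + Complex x x' * Complex y y' * Complex z z'
      + Complex z (- z') * Complex x (- x') * Complex y (- y') - Complex p 0 * Complex y y' * Complex y (- y')
      - Complex x x' * Complex x (- x') * Complex r 0 - Complex z (- z') * Complex q 0 * Complex z z') =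
      p * q * r + 2 * (x * y * z - x * y' * z' - x' * y * z' - x' * y' * z)
      - p * (y\<^sup>2 + y'\<^sup>2) - q * (z\<^sup>2 + z'\<^sup>2) - r * (x\<^sup>2 + x'\<^sup>2)" for p q r x x' y y' z z'
    by (simp add: power2_eq_square algebra_simps)
  have "det (Z ** Z') = Complex (g a a) 0 * Complex (g b b) 0 * Complex (g c c) 0
      + Complex (g a b) (- \<kappa> [a, b]) * Complex (g b c) (- \<kappa> [b, c]) * Complex (g c a) (- \<kappa> [c, a])
      + Complex (g c a) (- (- \<kappa> [c, a])) * Complex (g a b) (- (- \<kappa> [a, b])) * Complex (g b c) (- (- \<kappa> [b, c]))
      - Complex (g a a) 0 * Complex (g b c) (- \<kappa> [b, c]) * Complex (g b c) (- (- \<kappa> [b, c]))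
      - Complex (g a b) (- \<kappa> [a, b]) * Complex (g a b) (- (- \<kappa> [a, b])) * Complex (g c c) 0
      - Complex (g c a) (- (- \<kappa> [c, a])) * Complex (g b b) 0 * Complex (g c a) (- \<kappa> [c, a])"
    unfolding det_3 ZZ using k(1)[of b a] k(1)[of c b] k(1)[of a c] g_sym[of b a] g_sym[of c b] g_sym[of a c]
    by (simp only: vs_def k(2)) simp
  then have "Re (det (Z ** Z')) = g a a * g b b * g c c
   + 2 * (g a b * g b c * g c a - g a b * \<kappa> [b, c] * \<kappa> [c, a] - \<kappa> [a, b] * g b c * \<kappa> [c, a] - \<kappa> [a, b] * \<kappa> [b, c] * g c a)
   - g a a * ((g b c)\<^sup>2 + (\<kappa> [b, c])\<^sup>2) - g b b * ((g c a)\<^sup>2 + (\<kappa> [c, a])\<^sup>2) - g c c * ((g a b)\<^sup>2 + (\<kappa> [a, b])\<^sup>2)"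
    by (simp only: herm) simp
  moreover have "Re (det (Z ** Z')) = (\<Omega> [a, b, c])\<^sup>2 + (\<Omega> [J a, b, c])\<^sup>2"
    by (simp add: det_mul d1 d2 power2_eq_square)
  ultimately show ?thesis by simp
qed

text \<open>The vectors \<open>J E\<^sub>b\<close> are the frame vectors again, up to order and signs.\<close>

lemma trace_J:
  fixes f :: "real ^ 6 \<Rightarrow> real ^ 6 \<Rightarrow> real"
  assumes "\<And>w. linear (\<lambda>v. f v w)" "\<And>v. linear (f v)"
  shows "(\<Sum>b\<in>UNIV. f (J (E b)) (J (E b))) = (\<Sum>b\<in>UNIV. f (E b) (E b))"
  unfolding sum_6 J_E by (simp add: linear_neg[OF assms(1)] linear_neg[OF assms(2)])

lemma trace_J_eq_0:
  fixes f :: "real ^ 6 \<Rightarrow> real ^ 6 \<Rightarrow> real"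
  assumes "\<And>w. linear (\<lambda>v. f v w)" "\<And>v. linear (f v)" "\<And>v. f (J v) (J v) = - f v v"
  shows "(\<Sum>b\<in>UNIV. f (E b) (E b)) = 0"
  using trace_J[OF assms(1,2)] by (simp add: assms(3) sum_negf)

lemma g_lin [simp]: "g (v + v') w = g v w + g v' w" "g (v - v') w = g v w - g v' w" "g (- v) w = - g v w" "g (r *\<^sub>R v) w = r * g v w" "g 0 w = 0"
  "g w (v + v') = g w v + g w v'" "g w (v - v') = g w v - g w v'" "g w (- v) = - g w v" "g w (r *\<^sub>R v) = r * g w v" "g w 0 = 0"
  using linear_add[OF linear_g(2)] linear_diff[OF linear_g(2)] linear_neg[OF linear_g(2)] linear_scale[OF linear_g(2)]
    linear_0[OF linear_g(2)] by (simp_all add: linear_add[OF linear_g(1)] linear_diff[OF linear_g(1)]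
      linear_neg[OF linear_g(1)] linear_scale[OF linear_g(1)] linear_0[OF linear_g(1)])

lemma g_J_left: "g (J v) w = - g v (J w)"
  using g_J_J[of v "J w"] by simp

lemma metric_dual: "v $ i = (\<Sum>k\<in>UNIV. matrix_inv (\<chi> i j. g (axis i 1) (axis j 1)) $ i $ k * g v (axis k 1))"
proof -
  have "v $ i = (\<Sum>a\<in>UNIV. E a $ i * g v (E a))"
    by (subst frame_expansion) (simp add: mult.commute)
  also have "\<dots> = (\<Sum>a\<in>UNIV. \<Sum>k\<in>UNIV. E a $ i * E a $ k * g v (axis k 1))"
    by (subst linear_axis_expansion[OF linear_g(1)]) (simp add: sum_distrib_left mult_ac)
  also have "\<dots> = (\<Sum>k\<in>UNIV. \<Sum>a\<in>UNIV. E a $ i * E a $ k * g v (axis k 1))" by (rule sum.swap)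
  finally show ?thesis by (simp add: g_matrix(2) sum_distrib_right)
qed

lemma metric_riesz:
  assumes "linear \<phi>" shows "\<exists>w. \<forall>Z. g w Z = \<phi> Z"
proof (intro exI[of _ "\<Sum>a\<in>UNIV. \<phi> (E a) *\<^sub>R E a"] allI)
  fix Z
  have "\<phi> Z = \<phi> (\<Sum>a\<in>UNIV. g Z (E a) *\<^sub>R E a)" using frame_expansion[of Z] by simp
  also have "\<dots> = (\<Sum>a\<in>UNIV. g Z (E a) * \<phi> (E a))" by (simp add: linear_sum[OF assms] linear_scale[OF assms])
  also have "\<dots> = g (\<Sum>a\<in>UNIV. \<phi> (E a) *\<^sub>R E a) Z"
    by (simp add: linear_sum[OF linear_g(2)] g_sym[of Z] mult.commute)
  finally show "g (\<Sum>a\<in>UNIV. \<phi> (E a) *\<^sub>R E a) Z = \<phi> Z" by simp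
qed

lemma distinct_frame: "distinct [E 1, E 2, E 3, E 4, E 5, E 6]"
proof -
  have "E i = E j \<Longrightarrow> i = j" for i j using g_E[of i j] g_E[of i i] by (metis zero_neq_one)
  then have "i \<noteq> j \<Longrightarrow> E i \<noteq> E j" for i j by blast
  then show ?thesis by simp
qed

lemma span_frame: "span (set [E 1, E 2, E 3, E 4, E 5, E 6]) = UNIV"
proof -
  have "range E = set [E 1, E 2, E 3, E 4, E 5, E 6]" unfolding UNIV_6 by simp
  moreover have "v \<in> span (range E)" for v
    by (subst frame_expansion) (intro span_sum span_scale span_base, simp)
  ultimately show ?thesis by auto
qed

text \<open>A 3-form in which \<open>J\<close> can be moved from one argument to another is the real part of a complex 3-form of type (3,0), and those form
  a complex line.\<close>

lemma J_linear_3form_eq_0: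
  fixes f :: "real ^ 6 \<Rightarrow> real ^ 6 \<Rightarrow> real ^ 6 \<Rightarrow> real"
  assumes lin: "\<And>b c. linear (\<lambda>a. f a b c)" "\<And>a c. linear (\<lambda>b. f a b c)" "\<And>a b. linear (f a b)"
    and alt: "\<And>a b. f a a b = 0" "\<And>a b. f a b a = 0" "\<And>a b. f a b b = 0"
    and Jl: "\<And>a b c. f (J a) b c = f a (J b) c" "\<And>a b c. f a (J b) c = f a b (J c)"
    and zero: "f (E 1) (E 3) (E 5) = 0" "f (E 2) (E 3) (E 5) = 0"
  shows "f a b c = 0"
proof -
  have neg: "f a b (- c) = - f a b c" "f a (- b) c = - f a b c" "f (- a) b c = - f a b c" for a b c
    using lin by (simp_all add: linear_neg[OF lin(1)] linear_neg[OF lin(2)] linear_neg[OF lin(3)])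
  have sw: "f a b c = - f b a c" "f a b c = - f a c b" for a b c
    using alt(1)[of "a + b" c] linear_add[OF lin(1)[of "a + b" c], of a b] linear_add[OF lin(2)[of a c], of a b]
      linear_add[OF lin(2)[of b c], of a b] alt(1)[of a c] alt(1)[of b c]
      alt(3)[of a "b + c"] linear_add[OF lin(2)[of a "b + c"], of b c] linear_add[OF lin(3)[of a b], of b c]
      linear_add[OF lin(3)[of a c], of b c] alt(3)[of a b] alt(3)[of a c] by linarith+
  have p1: "f a (J a) c = 0" for a c using Jl(1)[of a a c] sw(1)[of a "J a" c] by simp
  have p2: "f a c (J a) = 0" for a c using sw(2)[of a c "J a"] p1[of a c] by simp
  have p3: "f c a (J a) = 0" for c a using sw(1)[of c a "J a"] p2[where a = a and c = c] by simp
  note JE = J_E(1,3,5)[symmetric]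
  have 2: "f (E 1) (E 3) (J (E 5)) = 0"
    using zero(2) unfolding JE Jl .
  have van: "f (E 1) (E 3) (E 5) = 0" "f (E 1) (E 3) (E 6) = 0" "f (E 1) (E 4) (E 5) = 0" "f (E 1) (E 4) (E 6) = 0"
    "f (E 2) (E 3) (E 5) = 0" "f (E 2) (E 3) (E 6) = 0" "f (E 2) (E 4) (E 5) = 0" "f (E 2) (E 4) (E 6) = 0"
    unfolding JE using zero(1) 2 by (simp_all add: Jl J_J neg)
  define F where "F vs = (case vs of [a, b, c] \<Rightarrow> f a b c | _ \<Rightarrow> 0)" for vs
  have "alternating_form 3 F" unfolding F_def by (rule alternating_form_3I) (rule lin alt)+
  then have "F = (\<lambda>_. 0)"
  proof (rule alternating_form_eq_0[OF _ distinct_frame span_frame])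
    fix xs assume "xs \<in> set (subseqs [E 1, E 2, E 3, E 4, E 5, E 6])" "length xs = 3"
    then show "F xs = 0"
      using p1[of "E 1"] p1[of "E 3"] p1[of "E 5"] p3[where a = "E 3"] p3[where a = "E 5"] van
      unfolding J_E F_def by (auto simp: Let_def simp del: in_set_subseqs)
  qed
  then have "F [a, b, c] = 0" by simp
  then show ?thesis by (simp add: F_def)
qed

lemma Omega_alt: "\<Omega> [a, a, b] = 0" "\<Omega> [a, b, a] = 0" "\<Omega> [a, b, b] = 0"
  by (simp_all add: Omega_eq Let_def algebra_simps)
lemma Omega_E: "\<Omega> [E 1, E 3, E 5] = 1" "\<Omega> [E 2, E 3, E 5] = 0"
  by (simp_all add: Omega_eq)
lemma Omega_slots: "\<Omega> [v, E 3, E 5] = u v $ 1" "\<Omega> [E 1, v, E 5] = u v $ 3" "\<Omega> [E 1, E 3, v] = u v $ 5"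
  by (simp_all add: Omega_eq)

lemma trace_basis_change:
  fixes f :: "real ^ 6 \<Rightarrow> real ^ 6"
  assumes f: "linear f"
  shows "(\<Sum>i\<in>UNIV. f (axis i 1) $ i) = (\<Sum>a\<in>UNIV. g (f (E a)) (E a))"
proof -
  have "(\<Sum>i\<in>UNIV. f (axis i 1) $ i) = (\<Sum>i\<in>UNIV. \<Sum>k\<in>UNIV. (\<Sum>a\<in>UNIV. E a $ i * E a $ k) * g (f (axis i 1)) (axis k 1))"
    by (subst metric_dual) (simp add: g_matrix(2))
  also have "\<dots> = (\<Sum>a\<in>UNIV. g (f (E a)) (E a))"
    by (rule dual_bases_contraction) (auto intro!: linearI simp: linear_add[OF f] linear_scale[OF f])
  finally show ?thesis .
qed

lemma metric_contraction:
  fixes b :: "real ^ 6 \<Rightarrow> real ^ 6 \<Rightarrow> real"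
  assumes "\<And>w. linear (\<lambda>v. b v w)" "\<And>v. linear (b v)"
  shows "(\<Sum>j\<in>UNIV. \<Sum>k\<in>UNIV. matrix_inv (\<chi> i j. g (axis i 1) (axis j 1)) $ j $ k * b (axis j 1) (axis k 1)) = (\<Sum>a\<in>UNIV. b (E a) (E a))"
  unfolding g_matrix(2) by (rule dual_bases_contraction[OF assms])

text \<open>An endomorphism that annihilates \<open>\<Omega>\<close> has no trace against \<open>J\<close>. The four evaluations are chosen such
  that all entries other than those of this trace cancel in their combination, for an arbitrary endomorphism.\<close>

lemma Omega_annihilator_trace:
  assumes "\<And>a b c. \<Omega> [f a, b, c] + \<Omega> [a, f b, c] + \<Omega> [a, b, f c] = 0"
  shows "(\<Sum>b\<in>UNIV. g (f (E b)) (J (E b))) = 0"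
proof -
  have "\<Omega> [f (E 2), E 3, E 5] + \<Omega> [E 2, f (E 3), E 5] + \<Omega> [E 2, E 3, f (E 5)] = 0"
    "\<Omega> [f (E 1), E 4, E 5] + \<Omega> [E 1, f (E 4), E 5] + \<Omega> [E 1, E 4, f (E 5)] = 0"
    "\<Omega> [f (E 1), E 3, E 6] + \<Omega> [E 1, f (E 3), E 6] + \<Omega> [E 1, E 3, f (E 6)] = 0"
    "\<Omega> [f (E 2), E 4, E 6] + \<Omega> [E 2, f (E 4), E 6] + \<Omega> [E 2, E 4, f (E 6)] = 0"
    by (rule assms)+
  then show ?thesis unfolding sum_6 J_E by (simp add: Omega_eq g_E_right)
qed

end

section \<open>The algebraic curvature identity\<close>

lemma sum3_swap12: "(\<Sum>a\<in>A. \<Sum>b\<in>A. \<Sum>c\<in>A. f b a c) = (\<Sum>a\<in>A. \<Sum>b\<in>A. \<Sum>c\<in>A. f a b c)"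
  by (rule sum.swap)

lemma sum3_swap23: "(\<Sum>a\<in>A. \<Sum>b\<in>A. \<Sum>c\<in>A. f a c b) = (\<Sum>a\<in>A. \<Sum>b\<in>A. \<Sum>c\<in>A. f a b c)"
  by (intro sum.cong refl sum.swap)

text \<open>The quadratic contractions of a tensor that is skew in the last two indices and has vanishing cyclic sum. Up to permutations
  of indices only two occur, and the cyclic identity relates them.\<close>

lemma mixed_tensor_quadratic:
  fixes n :: "'i::finite \<Rightarrow> 'i \<Rightarrow> 'i \<Rightarrow> real"
  assumes skew: "\<And>a b c. n a b c = - n a c b" and cyc: "\<And>a b c. n a b c + n b c a + n c a b = 0"
  defines "S \<equiv> \<lambda>f. \<Sum>a\<in>UNIV. \<Sum>b\<in>UNIV. \<Sum>c\<in>UNIV. f a b c :: real"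
  shows "S (\<lambda>a b c. n a b c * n c a b) = - S (\<lambda>a b c. n b a c * n a b c)"
    and "S (\<lambda>a b c. n b a c * n c a b) = S (\<lambda>a b c. n b a c * n a b c)"
    and "S (\<lambda>a b c. (n a b c)\<^sup>2) = 2 * S (\<lambda>a b c. n b a c * n a b c)"
proof -
  have s12: "S (\<lambda>a b c. f b a c) = S f" and s23: "S (\<lambda>a b c. f a c b) = S f" for f
    unfolding S_def by (rule sum3_swap12 sum3_swap23)+
  have Sneg: "S (\<lambda>a b c. - f a b c) = - S f" for f by (simp add: S_def sum_negf)
  have Sadd: "S (\<lambda>a b c. f a b c + h a b c) = S f + S h" for f h by (simp add: S_def sum.distrib)
  show 1: "S (\<lambda>a b c. n a b c * n c a b) = - S (\<lambda>a b c. n b a c * n a b c)"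
  proof -
    have "n a b c * n c a b = - (n c a b * n a c b)" for a b c using skew[of a b c] by simp
    then have "S (\<lambda>a b c. n a b c * n c a b) = - S (\<lambda>a b c. n c a b * n a c b)" by (simp add: Sneg)
    then show ?thesis using s23[of "\<lambda>a b c. n b a c * n a b c"] by simp
  qed
  show 2: "S (\<lambda>a b c. n b a c * n c a b) = S (\<lambda>a b c. n b a c * n a b c)"
  proof -
    have "n b a c * n c a b = n b c a * n c b a" for a b c using skew[of b a c] skew[of c a b] by simp
    then have "(\<lambda>a b c. n b a c * n c a b) = (\<lambda>a b c. n b c a * n c b a)" by (intro ext)
    then have "S (\<lambda>a b c. n b a c * n c a b) = S (\<lambda>a b c. n b c a * n c b a)" by (rule arg_cong)
    also have "\<dots> = S (\<lambda>a b c. n a c b * n c a b)" by (rule s12)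
    also have "\<dots> = S (\<lambda>a b c. n a b c * n b a c)" by (rule s23)
    finally show ?thesis by (simp add: mult.commute)
  qed
  have "(n a b c)\<^sup>2 = n b a c * n a b c + - (n a b c * n c a b)" for a b c
  proof -
    have "n a b c = n b a c - n c a b" using cyc[of a b c] skew[of b a c] by simp
    then show ?thesis by (metis (no_types, opaque_lifting) add_uminus_conv_diff left_diff_distrib mult.commute power2_eq_square)
  qed
  then have "S (\<lambda>a b c. (n a b c)\<^sup>2) = S (\<lambda>a b c. n b a c * n a b c) - S (\<lambda>a b c. n a b c * n c a b)"
    by (simp only: Sadd Sneg)
  then show "S (\<lambda>a b c. (n a b c)\<^sup>2) = 2 * S (\<lambda>a b c. n b a c * n a b c)" using 1 by simp
qed

context su3_point
begin

text \<open>The curvature identity at one point. \<open>R\<close> is the curvature of a torsion-free connection, \<open>F\<close> that of the connection shifted by \<open>A\<close>, and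
  \<open>DA W\<close> the covariant derivative of \<open>A\<close> in the direction \<open>W\<close>. The Bianchi identity, evaluated on \<open>e\<^sub>a, J e\<^sub>a, e\<^sub>b\<close> and
  paired with \<open>J e\<^sub>b\<close>, expresses the scalar trace \<open>sF\<close> of \<open>F\<close> by the quadratic contractions \<open>N\<close> and \<open>q\<close> of \<open>A\<close>: of its three
  \<open>F\<close>-terms one is the trace of \<open>F\<close> against \<open>J\<close>, and the other two both equal \<open>sF\<close>.\<close>

lemma scalar_curvature_algebra:
  fixes A :: "real ^ 6 \<Rightarrow> real ^ 6 \<Rightarrow> real ^ 6" and DA F R :: "real ^ 6 \<Rightarrow> real ^ 6 \<Rightarrow> real ^ 6 \<Rightarrow> real ^ 6"
  assumes linA: "\<And>Y. linear (\<lambda>X. A X Y)" "\<And>X. linear (A X)"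
    and linDA: "\<And>Z Y. linear (\<lambda>X. DA Z X Y)" "\<And>Z X. linear (DA Z X)" 
    and linF: "\<And>Y Z. linear (\<lambda>X. F X Y Z)" "\<And>X Y. linear (F X Y)" and F_alt: "\<And>X Y Z. F X Y Z = - F Y X Z"
    and R: "\<And>X Y Z. R X Y Z = F X Y Z - DA X Y Z + DA Y X Z - A (A X Y) Z + A (A Y X) Z + A X (A Y Z) - A Y (A X Z)"
    and bianchi: "\<And>X Y Z. R X Y Z + R Y Z X + R Z X Y = 0"
    and F_J: "\<And>X Y Z. F X Y (J Z) = J (F X Y Z)"
    and F_trace: "\<And>X Y. (\<Sum>b\<in>UNIV. g (F X Y (E b)) (J (E b))) = 0"
    and A_skew: "\<And>X Y Z. g (A X Y) Z = - g Y (A X Z)" and A_J: "\<And>X Y. A (J X) Y = - J (A X Y)" "\<And>X Y. A X (J Y) = - J (A X Y)"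
    and A_cyclic: "\<And>X Y Z. g (A X Y) Z + g (A Y Z) X + g (A Z X) Y = 0"
    and DA_skew: "\<And>W X Y Z. g (DA W X Y) Z = - g Y (DA W X Z)"
    and DA_J: "\<And>W X Y. DA W (J X) Y = - J (DA W X Y)" "\<And>W X Y. DA W X (J Y) = - J (DA W X Y)"
  shows "(\<Sum>a\<in>UNIV. \<Sum>b\<in>UNIV. g (R (E b) (E a) (E a)) (E b)) = - (\<Sum>a\<in>UNIV. \<Sum>b\<in>UNIV. \<Sum>c\<in>UNIV. (g (A (E a) (E b)) (E c))\<^sup>2)"
proof -
  define S where "S f = (\<Sum>a\<in>UNIV. \<Sum>b\<in>UNIV. f (E a) (E b))" for f :: "real ^ 6 \<Rightarrow> real ^ 6 \<Rightarrow> real"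
  define n where "n a b c = g (A (E a) (E b)) (E c)" for a b c
  note lin = linear_add[OF linA(1)] linear_add[OF linA(2)] linear_scale[OF linA(1)] linear_scale[OF linA(2)]
    linear_add[OF linDA(1)] linear_add[OF linDA(2)] linear_scale[OF linDA(1)] linear_scale[OF linDA(2)]
    linear_add[OF linF(1)] linear_add[OF linF(2)] linear_scale[OF linF(1)] linear_scale[OF linF(2)]
    linear_neg[OF linA(1)] linear_neg[OF linA(2)] linear_neg[OF linDA(1)] linear_neg[OF linDA(2)]
    linear_neg[OF linF(1)] linear_neg[OF linF(2)]
  have S_add: "S (\<lambda>a b. f a b + h a b) = S f + S h" and S_diff: "S (\<lambda>a b. f a b - h a b) = S f - S h"
 for f h
    by (simp_all add: S_def sum.distrib sum_subtractf)
  have S_mult: "S (\<lambda>a b. r * f a b) = r * S f" for r f by (simp add: S_def sum_distrib_left)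
  have A_exp: "A X Y = (\<Sum>c\<in>UNIV. g (A X Y) (E c) *\<^sub>R E c)" for X Y by (rule frame_expansion)
  have g_exp: "g v w = (\<Sum>c\<in>UNIV. g v (E c) * g w (E c))" for v w
    by (simp add: g_E_right) (simp add: g_def)
  \<comment> \<open>Replacing \<open>e\<^sub>a\<close> by \<open>J e\<^sub>a\<close> in a trace of \<open>A\<close> or \<open>DA\<close> changes its sign, by anti-linearity.\<close>
  have z1: "S (\<lambda>a b. g (DA b a a) b) = 0"
  proof -
    have "(\<Sum>a\<in>UNIV. g (DA b (E a) (E a)) b) = 0" for b
      by (rule trace_J_eq_0[of "\<lambda>v w. g (DA b v w) b"]) (auto intro!: linearI simp: lin DA_J)
    then show ?thesis unfolding S_def by (subst sum.swap) simp
  qed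
  have z2: "S (\<lambda>a b. g (DA a b a) b) = 0"
  proof -
    have "(\<Sum>b\<in>UNIV. g (DA a (E b) a) (E b)) = 0" for a
      by (rule trace_J_eq_0[of "\<lambda>v w. g (DA a v a) w"]) (auto intro!: linearI simp: lin DA_J)
    then show ?thesis unfolding S_def by simp
  qed
  have z3: "S (\<lambda>a b. g (A b (A a a)) b) = 0"
  proof -
    have "(\<Sum>a\<in>UNIV. g (A b (A (E a) (E a))) b) = 0" for b
      by (rule trace_J_eq_0[of "\<lambda>v w. g (A b (A v w)) b"]) (auto intro!: linearI simp: lin A_J)
    then show ?thesis unfolding S_def by (subst sum.swap) simp
  qed
  have z4: "S (\<lambda>a b. g (DA (J a) b a) (J b)) = 0"
  proof -
    have "(\<Sum>b\<in>UNIV. g (DA (J a) (E b) a) (J (E b))) = 0" for a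
      by (rule trace_J_eq_0[of "\<lambda>v w. g (DA (J a) v a) (J w)"]) (auto intro!: linearI simp: lin DA_J g_J_left)
    then show ?thesis unfolding S_def by simp
  qed
  have DA0: "g (DA W X Y) (J Y) = 0" "g (DA W X Y) Y = 0" for W X Y
  proof -
    show "g (DA W X Y) Y = 0" using DA_skew[of W X Y Y] g_sym[of Y "DA W X Y"] by linarith
    have "g (DA W X Y) (J Y) = g Y (J (DA W X Y))" by (subst DA_skew) (simp add: DA_J)
    also have "\<dots> = - g (DA W X Y) (J Y)" by (subst g_sym) (rule g_J_left)
    finally show "g (DA W X Y) (J Y) = 0" by simp
  qed
  \<comment> \<open>The three \<open>F\<close>-terms of the Bianchi identity on \<open>e\<^sub>a, J e\<^sub>a, e\<^sub>b\<close>, paired with \<open>J e\<^sub>b\<close>.\<close>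
  define sF where "sF = S (\<lambda>a b. g (F b a a) b)"
  have f0: "S (\<lambda>a b. g (F a (J a) b) (J b)) = 0" by (simp add: S_def F_trace)
  have f1: "S (\<lambda>a b. g (F (J a) b a) (J b)) = sF"
  proof -
    have "(\<Sum>a\<in>UNIV. g (F (J (E a)) b (E a)) (J b)) = (\<Sum>a\<in>UNIV. g (F b (E a) (E a)) b)" for b
    proof -
      have "(\<Sum>a\<in>UNIV. g (F (J (E a)) b (E a)) (J b)) = (\<Sum>a\<in>UNIV. g (F (J (J (E a))) b (J (E a))) (J b))"
        by (rule trace_J[of "\<lambda>v w. g (F (J v) b w) (J b)", symmetric]) (auto intro!: linearI simp: lin)
      also have "\<dots> = (\<Sum>a\<in>UNIV. g (F b (E a) (E a)) b)"
      proof (intro sum.cong refl)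
        fix a
        show "g (F (J (J (E a))) b (J (E a))) (J b) = g (F b (E a) (E a)) b"
          using F_alt[of "E a" b] by (simp add: F_J lin)
      qed
      finally show ?thesis .
    qed
    then show ?thesis unfolding S_def sF_def by (subst sum.swap, subst (2) sum.swap) simp
  qed
  have f2: "S (\<lambda>a b. g (F b a (J a)) (J b)) = sF" by (simp add: sF_def F_J)
  define q where "q = (\<Sum>a\<in>UNIV. \<Sum>b\<in>UNIV. \<Sum>c\<in>UNIV. n b a c * n a b c)"
  define N where "N = (\<Sum>a\<in>UNIV. \<Sum>b\<in>UNIV. \<Sum>c\<in>UNIV. (n a b c)\<^sup>2)"
  have quad: "(\<Sum>a\<in>UNIV. \<Sum>b\<in>UNIV. \<Sum>c\<in>UNIV. n a b c * n c a b) = - q"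
    "(\<Sum>a\<in>UNIV. \<Sum>b\<in>UNIV. \<Sum>c\<in>UNIV. n b a c * n c a b) = q" "N = 2 * q"
  proof -
    have sk: "n a b c = - n a c b" for a b c using A_skew[of "E a" "E b" "E c"] g_sym[of "E b" "A (E a) (E c)"] unfolding n_def by linarith
    have cy: "n a b c + n b c a + n c a b = 0" for a b c using A_cyclic[of "E a" "E b" "E c"] unfolding n_def .
    show "(\<Sum>a\<in>UNIV. \<Sum>b\<in>UNIV. \<Sum>c\<in>UNIV. n a b c * n c a b) = - q"
      "(\<Sum>a\<in>UNIV. \<Sum>b\<in>UNIV. \<Sum>c\<in>UNIV. n b a c * n c a b) = q" "N = 2 * q"
      using mixed_tensor_quadratic[of n, OF sk cy] by (simp_all add: q_def N_def)
  qed
  have a1: "S (\<lambda>a b. g (A (A a b) a) b) = - q"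
  proof -
    have "g (A (A a b) a) b = (\<Sum>c\<in>UNIV. g (A a b) (E c) * g (A (E c) a) b)" for a b
      by (subst A_exp[of a b]) (simp add: linear_sum[OF linA(1)] linear_scale[OF linA(1)] linear_sum[OF linear_g(2)])
    then show ?thesis using quad(1) by (simp add: S_def n_def)
  qed
  have a2: "S (\<lambda>a b. g (A (A b a) a) b) = q"
  proof -
    have "g (A (A b a) a) b = (\<Sum>c\<in>UNIV. g (A b a) (E c) * g (A (E c) a) b)" for a b
      by (subst A_exp[of b a]) (simp add: linear_sum[OF linA(1)] linear_scale[OF linA(1)] linear_sum[OF linear_g(2)])
    then show ?thesis using quad(2) by (simp add: S_def n_def)
  qed
  have a3: "S (\<lambda>a b. g (A a (A b a)) b) = - q"
  proof -
    have "g (A a (A b a)) b = - (\<Sum>c\<in>UNIV. g (A b a) (E c) * g (A a b) (E c))" for a b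
      by (subst A_skew, subst g_exp) simp
    then show ?thesis by (simp add: S_def n_def q_def sum_negf)
  qed
  have a4: "S (\<lambda>a b. g (A a (A a b)) b) = - N"
  proof -
    have "g (A a (A a b)) b = - (\<Sum>c\<in>UNIV. (g (A a b) (E c))\<^sup>2)" for a b
      by (subst A_skew, subst g_exp) (simp add: power2_eq_square)
    then show ?thesis by (simp add: S_def n_def N_def sum_negf)
  qed
  have sF: "2 * sF = 2 * (N - q - q - q)"
  proof -
    have "g (F a (J a) b) (J b) + g (F (J a) b a) (J b) + g (F b a (J a)) (J b) =
        - 2 * g (A a (A a b)) b + 2 * g (A (A a b) a) b - 2 * g (A (A b a) a) b + 2 * g (A a (A b a)) b
        + g (DA (J a) b a) (J b) + g (DA a b a) b" for a b
    proof -
      have "g (R a (J a) b) (J b) + g (R (J a) b a) (J b) + g (R b a (J a)) (J b) = 0"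
      proof -
        have "g (R a (J a) b + R (J a) b a + R b a (J a)) (J b) = 0" by (simp only: bianchi g_lin(5))
        then show ?thesis by (simp only: g_lin(1))
      qed
      moreover have "g (2 * v) w = 2 * g v w" for v w unfolding mult_2 g_lin(1) ..
      ultimately show ?thesis by (simp add: R A_J DA_J lin DA0)
    qed
    then have "(\<lambda>a b. g (F a (J a) b) (J b) + g (F (J a) b a) (J b) + g (F b a (J a)) (J b)) =
       (\<lambda>a b. - 2 * g (A a (A a b)) b + 2 * g (A (A a b) a) b - 2 * g (A (A b a) a) b + 2 * g (A a (A b a)) b
        + g (DA (J a) b a) (J b) + g (DA a b a) b)" by (intro ext)
    then have "S (\<lambda>a b. g (F a (J a) b) (J b) + g (F (J a) b a) (J b) + g (F b a (J a)) (J b)) =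
       S (\<lambda>a b. - 2 * g (A a (A a b)) b + 2 * g (A (A a b) a) b - 2 * g (A (A b a) a) b + 2 * g (A a (A b a)) b
        + g (DA (J a) b a) (J b) + g (DA a b a) b)" by (rule arg_cong)
    also have "\<dots> = - 2 * S (\<lambda>a b. g (A a (A a b)) b) + 2 * S (\<lambda>a b. g (A (A a b) a) b) - 2 * S (\<lambda>a b. g (A (A b a) a) b)
        + 2 * S (\<lambda>a b. g (A a (A b a)) b) + S (\<lambda>a b. g (DA (J a) b a) (J b)) + S (\<lambda>a b. g (DA a b a) b)"
      unfolding S_add S_diff S_mult ..
    also have "\<dots> = 2 * (N - q - q - q)" unfolding a1 a2 a3 a4 z2 z4 by simp
    finally show ?thesis unfolding S_add f0 f1 f2 by simp
  qed
  have "S (\<lambda>a b. g (R b a a) b) = sF - S (\<lambda>a b. g (DA b a a) b) + S (\<lambda>a b. g (DA a b a) b)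
      - S (\<lambda>a b. g (A (A b a) a) b) + S (\<lambda>a b. g (A (A a b) a) b) + S (\<lambda>a b. g (A b (A a a)) b) - S (\<lambda>a b. g (A a (A b a)) b)"
    unfolding sF_def R g_lin(1,2) S_add S_diff ..
  then have "S (\<lambda>a b. g (R b a a) b) = sF - q - q + q"
    by (simp add: z1 z2 z3 a1 a2 a3)
  then show ?thesis using sF quad(3) by (simp add: S_def N_def n_def)
qed

end

section \<open>SU(3)-structures on coordinate domains\<close>

text \<open>The coordinate expressions of \<open>\<kappa>\<close> and \<open>\<Omega>\<close> in one chart. Derivatives are taken of components on constant vectors; linearity in
  those vectors then permits non-constant ones through the product rule \<open>dd_apply\<close>.\<close>

locale su3_chart =
  fixes S :: "(real ^ 6) set" and \<kappa> \<Omega> :: "real ^ 6 \<Rightarrow> (real ^ 6, real) form"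
  assumes open_S: "open S"
    and alternating_kappa: "x \<in> S \<Longrightarrow> alternating_form 2 (\<kappa> x)" and alternating_Omega: "x \<in> S \<Longrightarrow> alternating_form 3 (\<Omega> x)"
    and smooth_kappa: "smooth_on S (\<lambda>x. \<kappa> x vs)" and smooth_Omega: "smooth_on S (\<lambda>x. \<Omega> x vs)"
    and ex_adapted: "x \<in> S \<Longrightarrow> \<exists>u. adapted_coframe (\<kappa> x) (\<Omega> x) u"
begin

abbreviation coframe_at :: "real ^ 6 \<Rightarrow> real ^ 6 \<Rightarrow> real ^ 6" where
  "coframe_at x \<equiv> su3_coframe (\<kappa> x) (\<Omega> x)"

abbreviation J :: "real ^ 6 \<Rightarrow> real ^ 6 \<Rightarrow> real ^ 6" where "J x \<equiv> su3_J (\<kappa> x) (\<Omega> x)"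
abbreviation g :: "real ^ 6 \<Rightarrow> real ^ 6 \<Rightarrow> real ^ 6 \<Rightarrow> real" where "g x \<equiv> su3_metric (\<kappa> x) (\<Omega> x)"

lemma point: "x \<in> S \<Longrightarrow> su3_point (\<kappa> x) (\<Omega> x) (coframe_at x)"
  unfolding su3_coframe_def su3_point_def by (rule someI_ex[OF ex_adapted])

lemma J_eq: "x \<in> S \<Longrightarrow> su3_point.J (coframe_at x) = J x"
  by (intro ext) (simp add: su3_J_def Let_def su3_point.J_def[OF point] su3_point.E_def[OF point])

lemma g_eq: "x \<in> S \<Longrightarrow> su3_point.g (coframe_at x) = g x"
  by (intro ext) (simp add: su3_metric_def Let_def su3_point.g_def[OF point])

lemma linear_J: "x \<in> S \<Longrightarrow> linear (J x)"
  using su3_point.linear_J[OF point] by (simp add: J_eq)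
lemma J_J: "x \<in> S \<Longrightarrow> J x (J x v) = - v"
  using su3_point.J_J[OF point] by (simp add: J_eq)
lemma linear_g: "x \<in> S \<Longrightarrow> linear (g x v)" "x \<in> S \<Longrightarrow> linear (\<lambda>v. g x v w)"
  using su3_point.linear_g[OF point] by (simp_all add: g_eq)
lemma g_sym: "x \<in> S \<Longrightarrow> g x v w = g x w v"
  using su3_point.g_sym[OF point] by (simp add: g_eq)
lemma g_J_J: "x \<in> S \<Longrightarrow> g x (J x v) (J x w) = g x v w"
  using su3_point.g_J_J[OF point] by (simp add: g_eq J_eq)
lemma g_J_left: "x \<in> S \<Longrightarrow> g x (J x v) w = - g x v (J x w)"
  using su3_point.g_J_left[OF point] by (simp add: g_eq J_eq)
lemma g_nondegenerate: "x \<in> S \<Longrightarrow> (\<And>w. g x v w = g x v' w) \<Longrightarrow> v = v'"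
  using su3_point.g_nondegenerate[OF point] by (simp add: g_eq)
lemma kappa_g: "x \<in> S \<Longrightarrow> \<kappa> x [v, w] = g x (J x v) w"
  using su3_point.kappa_g[OF point] by (simp add: g_eq J_eq)
lemma linear_kappa: "x \<in> S \<Longrightarrow> linear (\<lambda>v. \<kappa> x [v, w])" "x \<in> S \<Longrightarrow> linear (\<lambda>w. \<kappa> x [v, w])"
  using su3_point.linear_kappa[OF point] by simp_all
lemma linear_Omega: "x \<in> S \<Longrightarrow> linear (\<lambda>a. \<Omega> x [a, b, c])" "x \<in> S \<Longrightarrow> linear (\<lambda>b. \<Omega> x [a, b, c])"
    "x \<in> S \<Longrightarrow> linear (\<lambda>c. \<Omega> x [a, b, c])"
  using su3_point.linear_Omega[OF point] by simp_all
lemma Omega_J: "x \<in> S \<Longrightarrow> \<Omega> x [J x a, b, c] = \<Omega> x [a, J x b, c]" "x \<in> S \<Longrightarrow> \<Omega> x [a, J x b, c] = \<Omega> x [a, b, J x c]"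
  using su3_point.Omega_J[OF point] by (simp_all add: J_eq)

lemma J_lin: "x \<in> S \<Longrightarrow> J x (v + w) = J x v + J x w" "x \<in> S \<Longrightarrow> J x (v - w) = J x v - J x w"
    "x \<in> S \<Longrightarrow> J x (- v) = - J x v" "x \<in> S \<Longrightarrow> J x (r *\<^sub>R v) = r *\<^sub>R J x v" "x \<in> S \<Longrightarrow> J x 0 = 0"
  using linear_J by (simp_all add: linear_add linear_diff linear_neg linear_scale linear_0)

lemma g_lin: "x \<in> S \<Longrightarrow> g x (v + v') w = g x v w + g x v' w" "x \<in> S \<Longrightarrow> g x (v - v') w = g x v w - g x v' w"
    "x \<in> S \<Longrightarrow> g x (- v) w = - g x v w" "x \<in> S \<Longrightarrow> g x (r *\<^sub>R v) w = r * g x v w" "x \<in> S \<Longrightarrow> g x 0 w = 0"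
    "x \<in> S \<Longrightarrow> g x w (v + v') = g x w v + g x w v'" "x \<in> S \<Longrightarrow> g x w (v - v') = g x w v - g x w v'"
    "x \<in> S \<Longrightarrow> g x w (- v) = - g x w v" "x \<in> S \<Longrightarrow> g x w (r *\<^sub>R v) = r * g x w v" "x \<in> S \<Longrightarrow> g x w 0 = 0"
  using su3_point.g_lin[OF point, of x] by (simp_all add: g_eq)

lemma smooth_g: "smooth_on S (\<lambda>x. g x v w)"
proof -
  have W: "smooth_on S (\<lambda>x. matrix_inv (\<chi> i j. \<kappa> x [axis i 1, axis j 1]) $ i $ j)" for i j
    by (rule smooth_on_matrix_inv[OF open_S]) (simp_all add: smooth_kappa su3_point.kappa_matrix[OF point])
  have "smooth_on S (\<lambda>x. - (1/4) * (\<Sum>i\<in>UNIV. \<Sum>k\<in>UNIV. matrix_inv (\<chi> i j. \<kappa> x [axis i 1, axis j 1]) $ i $ k *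
     (\<Sum>j\<in>UNIV. \<Sum>l\<in>UNIV. matrix_inv (\<chi> i j. \<kappa> x [axis i 1, axis j 1]) $ j $ l *
     (\<Omega> x [v, axis i 1, axis j 1] * \<Omega> x [w, axis k 1, axis l 1]))))"
    by (intro smooth_on_mult smooth_on_const smooth_on_sum open_S W smooth_Omega)
  then show ?thesis
  proof (rule smooth_on_transform[OF open_S])
    fix x assume "x \<in> S"
    then show "g x v w = - (1/4) * (\<Sum>i\<in>UNIV. \<Sum>k\<in>UNIV. matrix_inv (\<chi> i j. \<kappa> x [axis i 1, axis j 1]) $ i $ k *
     (\<Sum>j\<in>UNIV. \<Sum>l\<in>UNIV. matrix_inv (\<chi> i j. \<kappa> x [axis i 1, axis j 1]) $ j $ l *
     (\<Omega> x [v, axis i 1, axis j 1] * \<Omega> x [w, axis k 1, axis l 1])))"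
      using su3_point.g_formula[OF point, of x v w] by (simp add: g_eq)
  qed
qed

definition metric_matrix :: "real ^ 6 \<Rightarrow> real ^ 6 ^ 6" where
  "metric_matrix x = (\<chi> i j. g x (axis i 1) (axis j 1))"

lemma smooth_metric_inv: "smooth_on S (\<lambda>x. matrix_inv (metric_matrix x) $ i $ j)"
  by (rule smooth_on_matrix_inv[OF open_S])
    (use su3_point.g_matrix(1)[OF point] in \<open>simp_all add: metric_matrix_def smooth_g g_eq\<close>)

lemma smooth_J: "smooth_on S (\<lambda>x. J x v)"
proof (rule smooth_on_vec[OF open_S])
  fix i
  have "smooth_on S (\<lambda>x. \<Sum>k\<in>UNIV. matrix_inv (metric_matrix x) $ i $ k * \<kappa> x [v, axis k 1])"
    by (intro smooth_on_sum smooth_on_mult open_S smooth_metric_inv smooth_kappa)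
  then show "smooth_on S (\<lambda>x. J x v $ i)"
  proof (rule smooth_on_transform[OF open_S])
    fix x assume "x \<in> S"
    then show "J x v $ i = (\<Sum>k\<in>UNIV. matrix_inv (metric_matrix x) $ i $ k * \<kappa> x [v, axis k 1])"
      using su3_point.J_formula[OF point, of x v i] by (simp add: J_eq g_eq metric_matrix_def)
  qed
qed

end

context su3_chart
begin

lemma differentiable_g: "x \<in> S \<Longrightarrow> (\<lambda>y. g y v w) differentiable (at x)"
  by (rule smooth_on_differentiable[OF smooth_g])
lemma differentiable_J: "x \<in> S \<Longrightarrow> (\<lambda>y. J y v) differentiable (at x)"
  by (rule smooth_on_differentiable[OF smooth_J])
lemma differentiable_kappa: "x \<in> S \<Longrightarrow> (\<lambda>y. \<kappa> y vs) differentiable (at x)"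
  by (rule smooth_on_differentiable[OF smooth_kappa])
lemma differentiable_Omega: "x \<in> S \<Longrightarrow> (\<lambda>y. \<Omega> y vs) differentiable (at x)"
  by (rule smooth_on_differentiable[OF smooth_Omega])

lemma dg_linear: "x \<in> S \<Longrightarrow> linear (\<lambda>h. dd (\<lambda>y. g y v w) x h)" "x \<in> S \<Longrightarrow> linear (\<lambda>v. dd (\<lambda>y. g y v w) x h)"
   "x \<in> S \<Longrightarrow> linear (\<lambda>w. dd (\<lambda>y. g y v w) x h)"
  by (rule dd_linear dd_linear_family[OF open_S _ linear_g(1)] dd_linear_family[OF open_S _ linear_g(2)],
      (assumption | rule differentiable_g)+)+

text \<open>The Christoffel symbols as a bilinear map \<open>(X, Y) \<mapsto> \<nabla>\<^sub>X Y\<close> on constant vector fields.\<close>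

definition Gam :: "real ^ 6 \<Rightarrow> real ^ 6 \<Rightarrow> real ^ 6 \<Rightarrow> real ^ 6" where
  "Gam x X Y = (\<chi> k. \<Sum>i\<in>UNIV. \<Sum>j\<in>UNIV. X $ i * Y $ j * christoffel metric_matrix k i j x)"

text \<open>Both sides are trilinear. The vector that the Koszul formula determines by duality has the Christoffel symbols as coordinates, because
  the inverse metric matrix computes coordinates from inner products with the standard basis.\<close>

lemma koszul:
  assumes x: "x \<in> S"
  shows "2 * g x (Gam x X Y) Z = dd (\<lambda>y. g y Y Z) x X + dd (\<lambda>y. g y X Z) x Y - dd (\<lambda>y. g y X Y) x Z"
proof -
  define c where "c X Y Z = dd (\<lambda>y. g y Y Z) x X + dd (\<lambda>y. g y X Z) x Y - dd (\<lambda>y. g y X Y) x Z" for X Y Z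
  note lins = linear_compose_sub[OF linear_compose_add]
  have c1: "linear (\<lambda>X. c X Y Z)" and c2: "linear (\<lambda>Y. c X Y Z)" and c3: "linear (\<lambda>Z. c X Y Z)" for X Y Z
    unfolding c_def by (intro lins dg_linear x)+
  have "linear (\<lambda>Z. (1/2) * c X Y Z)" using c3 linear_compose_scale_right[of "c X Y" "1/2"] by simp
  then obtain w where w: "\<And>Z. g x w Z = (1/2) * c X Y Z"
    using su3_point.metric_riesz[OF point[OF x], of "\<lambda>Z. (1/2) * c X Y Z"] unfolding g_eq[OF x] by blast
  have "Gam x X Y $ k = w $ k" for k
  proof -
    have ch: "christoffel metric_matrix k i j x =
        (\<Sum>l\<in>UNIV. matrix_inv (metric_matrix x) $ k $ l * c (axis i 1) (axis j 1) (axis l 1)) / 2" for i j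
      by (simp add: christoffel_def pd_def c_def metric_matrix_def)
    have "w $ k = (\<Sum>l\<in>UNIV. matrix_inv (metric_matrix x) $ k $ l * ((1/2) * c X Y (axis l 1)))"
      using su3_point.metric_dual[OF point[OF x], of w k] by (simp add: g_eq[OF x] w metric_matrix_def)
    also have "\<dots> = (\<Sum>l\<in>UNIV. \<Sum>i\<in>UNIV. \<Sum>j\<in>UNIV. X $ i * Y $ j * (matrix_inv (metric_matrix x) $ k $ l * c (axis i 1) (axis j 1) (axis l 1) / 2))"
      by (subst bilinear_axis_expansion[OF c1 c2]) (simp add: sum_distrib_left mult_ac)
    also have "\<dots> = (\<Sum>i\<in>UNIV. \<Sum>l\<in>UNIV. \<Sum>j\<in>UNIV. X $ i * Y $ j * (matrix_inv (metric_matrix x) $ k $ l * c (axis i 1) (axis j 1) (axis l 1) / 2))"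
      by (rule sum.swap)
    also have "\<dots> = (\<Sum>i\<in>UNIV. \<Sum>j\<in>UNIV. \<Sum>l\<in>UNIV. X $ i * Y $ j * (matrix_inv (metric_matrix x) $ k $ l * c (axis i 1) (axis j 1) (axis l 1) / 2))"
      by (intro sum.cong refl sum.swap)
    also have "\<dots> = Gam x X Y $ k"
      by (simp add: Gam_def ch sum_distrib_left sum_divide_distrib)
    finally show ?thesis by simp
  qed
  then have "Gam x X Y = w" by (simp add: vec_eq_iff)
  then show ?thesis using w[of Z] by (simp add: c_def)
qed

lemma linear_Gam: "linear (\<lambda>X. Gam x X Y)" "linear (Gam x X)"
  by (auto intro!: linearI simp: Gam_def vec_eq_iff algebra_simps sum.distrib sum_distrib_left)

lemma Gam_sym: "x \<in> S \<Longrightarrow> Gam x X Y = Gam x Y X"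
proof (rule g_nondegenerate)
  fix Z assume x: "x \<in> S"
  have "dd (\<lambda>y. g y X Y) x Z = dd (\<lambda>y. g y Y X) x Z" by (rule dd_cong[OF open_S x]) (rule g_sym)
  then show "g x (Gam x X Y) Z = g x (Gam x Y X) Z" using koszul[OF x, of X Y Z] koszul[OF x, of Y X Z] by simp
qed

lemma Gam_metric: 
  assumes x: "x \<in> S" shows "dd (\<lambda>y. g y Y Z) x X = g x (Gam x X Y) Z + g x Y (Gam x X Z)"
proof -
  have s: "dd (\<lambda>y. g y X Y) x Z = dd (\<lambda>y. g y Y X) x Z" for X Y Z by (rule dd_cong[OF open_S x]) (rule g_sym)
  have "2 * (g x (Gam x X Y) Z + g x Y (Gam x X Z)) = 2 * dd (\<lambda>y. g y Y Z) x X"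
    using koszul[OF x, of X Y Z] koszul[OF x, of X Z Y] g_sym[OF x, of Y "Gam x X Z"] s[of X Y Z] s[of X Z Y] s[of Y Z X] by simp
  then show ?thesis by simp
qed

lemma smooth_Gam: "smooth_on S (\<lambda>x. Gam x X Y)"
proof (rule smooth_on_vec[OF open_S])
  fix k
  have "smooth_on S (christoffel metric_matrix k i j)" for i j
  proof -
    have "smooth_on S (\<lambda>x. (\<Sum>l\<in>UNIV. matrix_inv (metric_matrix x) $ k $ l *
        (pd i (\<lambda>y. metric_matrix y $ j $ l) x + pd j (\<lambda>y. metric_matrix y $ i $ l) x - pd l (\<lambda>y. metric_matrix y $ i $ j) x)) / 2)"
      unfolding pd_def
      by (intro smooth_on_divide smooth_on_sum smooth_on_mult smooth_on_diff smooth_on_add smooth_on_derivative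
          smooth_on_const smooth_metric_inv open_S) (simp_all add: metric_matrix_def smooth_g)
    then show ?thesis by (simp add: christoffel_def[abs_def])
  qed
  then show "smooth_on S (\<lambda>x. Gam x X Y $ k)"
    unfolding Gam_def by (simp, intro smooth_on_sum smooth_on_mult smooth_on_const open_S)
qed

lemma differentiable_Gam: "x \<in> S \<Longrightarrow> (\<lambda>y. Gam y X Y) differentiable (at x)"
  by (rule smooth_on_differentiable[OF smooth_Gam])

abbreviation dJ :: "real ^ 6 \<Rightarrow> real ^ 6 \<Rightarrow> real ^ 6 \<Rightarrow> real ^ 6" where "dJ x X Y \<equiv> dd (\<lambda>y. J y Y) x X"

lemma linear_dJ: "x \<in> S \<Longrightarrow> linear (\<lambda>X. dJ x X Y)" "x \<in> S \<Longrightarrow> linear (dJ x X)"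
  by (rule dd_linear dd_linear_family[OF open_S _ linear_J], (assumption | rule differentiable_J)+)+

lemma dJ_J: assumes x: "x \<in> S" shows "dJ x X (J x Y) = - J x (dJ x X Y)"
proof -
  have "0 = dd (\<lambda>y. - Y) x X" by (simp add: frechet_derivative_const)
  also have "\<dots> = dd (\<lambda>y. J y (J y Y)) x X" by (rule dd_cong[OF open_S x]) (simp add: J_J)
  also have "\<dots> = dJ x X (J x Y) + J x (dJ x X Y)"
    by (rule dd_apply(1)[OF open_S x linear_J]) (auto intro: differentiable_J x)
  finally show ?thesis by (simp add: eq_neg_iff_add_eq_0)
qed

text \<open>This is \<open>- 1/2 J (\<nabla>\<^sub>X J) Y\<close> with the covariant derivative written out as \<open>\<nabla>\<^sub>X J = D\<^sub>X J + [\<Gamma>\<^sub>X, J]\<close>.\<close>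

definition A :: "real ^ 6 \<Rightarrow> real ^ 6 \<Rightarrow> real ^ 6 \<Rightarrow> real ^ 6" where
  "A x X Y = - (1/2) *\<^sub>R (J x (dJ x X Y) + J x (Gam x X (J x Y)) + Gam x X Y)"

text \<open>On an almost Hermitian manifold this is the first canonical Hermitian connection. Together with \<open>\<partial>\<^sub>X\<close> it acts on
  constant vector fields, so a tensor is parallel when its component derivatives are the sum of insertions of \<open>B\<^sub>X\<close>.\<close>

definition B :: "real ^ 6 \<Rightarrow> real ^ 6 \<Rightarrow> real ^ 6 \<Rightarrow> real ^ 6" where
  "B x X Y = Gam x X Y + A x X Y"

lemma linear_A: "x \<in> S \<Longrightarrow> linear (\<lambda>X. A x X Y)" "x \<in> S \<Longrightarrow> linear (A x X)"
  by (auto intro!: linearI simp: A_def J_lin linear_add[OF linear_dJ(1)] linear_add[OF linear_dJ(2)] linear_add[OF linear_Gam(1)]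
     linear_add[OF linear_Gam(2)] linear_scale[OF linear_dJ(1)] linear_scale[OF linear_dJ(2)] linear_scale[OF linear_Gam(1)]
     linear_scale[OF linear_Gam(2)] algebra_simps)

lemma linear_B: "x \<in> S \<Longrightarrow> linear (\<lambda>X. B x X Y)" "x \<in> S \<Longrightarrow> linear (B x X)"
  unfolding B_def by (intro linear_compose_add linear_A linear_Gam, assumption)+

lemma smooth_A: "smooth_on S (\<lambda>x. A x X Y)"
  unfolding A_def
  by (intro smooth_on_scaleR smooth_on_const smooth_on_add smooth_on_apply[OF open_S linear_J smooth_J]
      smooth_on_apply[OF open_S linear_Gam(2) smooth_Gam] smooth_on_derivative smooth_J smooth_Gam open_S)

lemma smooth_B: "smooth_on S (\<lambda>x. B x X Y)"
  unfolding B_def by (intro smooth_on_add smooth_A smooth_Gam open_S)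

lemma differentiable_A: "x \<in> S \<Longrightarrow> (\<lambda>y. A y X Y) differentiable (at x)"
  and differentiable_B: "x \<in> S \<Longrightarrow> (\<lambda>y. B y X Y) differentiable (at x)"
  by (rule smooth_on_differentiable[OF smooth_A] smooth_on_differentiable[OF smooth_B], assumption)+

lemma A_J_right: assumes x: "x \<in> S" shows "A x X (J x Y) = - J x (A x X Y)"
  by (simp add: A_def dJ_J J_J J_lin linear_neg[OF linear_Gam(2)] x algebra_simps)

lemma dkappa: assumes x: "x \<in> S" shows "dd (\<lambda>y. \<kappa> y [Y, Z]) x X = dd (\<lambda>y. g y (J x Y) Z) x X + g x (dJ x X Y) Z"
proof -
  have "dd (\<lambda>y. \<kappa> y [Y, Z]) x X = dd (\<lambda>y. g y (J y Y) Z) x X"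
    by (rule dd_cong[OF open_S x]) (rule kappa_g)
  also have "\<dots> = dd (\<lambda>y. g y (J x Y) Z) x X + g x (dJ x X Y) Z"
    by (rule dd_apply(1)[OF open_S x linear_g(2)]) (auto intro: differentiable_J differentiable_g x)
  finally show ?thesis .
qed

text \<open>The right-hand side is the covariant derivative of \<open>\<kappa>\<close>, through which the exterior derivative of \<open>\<kappa>\<close> enters.\<close>

lemma A_nabla_kappa:
  assumes x: "x \<in> S"
  shows "2 * g x (A x X Y) Z = dd (\<lambda>y. \<kappa> y [Y, J x Z]) x X - \<kappa> x [Gam x X Y, J x Z] - \<kappa> x [Y, Gam x X (J x Z)]"
  unfolding dkappa[OF x] Gam_metric[OF x] kappa_g[OF x] A_def
  by (simp add: g_lin[OF x] J_lin[OF x] g_J_J[OF x] g_J_left[OF x] J_J[OF x] field_simps)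

lemma kappa_skew: "x \<in> S \<Longrightarrow> \<kappa> x [v, w] = - \<kappa> x [w, v]"
  using g_sym[of x w "J x v"] g_J_left[of x v w] by (simp add: kappa_g g_J_left)

lemma dkappa_skew: assumes x: "x \<in> S" shows "dd (\<lambda>y. \<kappa> y [v, w]) x h = - dd (\<lambda>y. \<kappa> y [w, v]) x h"
proof -
  have "dd (\<lambda>y. \<kappa> y [v, w]) x h = dd (\<lambda>y. - \<kappa> y [w, v]) x h" by (rule dd_cong[OF open_S x]) (rule kappa_skew)
  then show ?thesis by (simp add: dd_minus differentiable_kappa x)
qed

lemma A_skew: assumes x: "x \<in> S" shows "g x (A x X Y) Z = - g x Y (A x X Z)"
proof -
  define n where "n Y Z = dd (\<lambda>y. \<kappa> y [Y, Z]) x X - \<kappa> x [Gam x X Y, Z] - \<kappa> x [Y, Gam x X Z]" for Y Z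
  have n_skew: "n Y Z = - n Z Y" for Y Z
    unfolding n_def using dkappa_skew[OF x, of Y Z X] kappa_skew[OF x, of "Gam x X Y" Z] kappa_skew[OF x, of Y "Gam x X Z"] by simp
  have A_n: "2 * g x (A x X Y) Z = n Y (J x Z)" for Y Z using A_nabla_kappa[OF x] by (simp add: n_def)
  have "2 * g x (A x X Y) Z = 2 * g x (A x X (J x Y)) (- J x Z)"
    by (simp add: A_J_right[OF x] g_lin[OF x] g_J_J[OF x])
  also have "\<dots> = n (J x Y) Z" unfolding A_n by (simp add: J_lin[OF x] J_J[OF x])
  also have "\<dots> = - (2 * g x (A x X Z) Y)" unfolding A_n by (rule n_skew)
  finally show ?thesis using g_sym[OF x, of "A x X Z" Y] by simp
qed

lemma parallel_g: "x \<in> S \<Longrightarrow> dd (\<lambda>y. g y Y Z) x X = g x (B x X Y) Z + g x Y (B x X Z)"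
  by (simp add: Gam_metric B_def g_lin A_skew[of x X Y Z])

lemma parallel_J: "x \<in> S \<Longrightarrow> dJ x X Y = J x (B x X Y) - B x X (J x Y)"
  by (simp add: B_def J_lin A_J_right) (simp add: A_def J_lin J_J algebra_simps flip: scaleR_add_left)

lemma parallel_kappa: "x \<in> S \<Longrightarrow> dd (\<lambda>y. \<kappa> y [Y, Z]) x X = \<kappa> x [B x X Y, Z] + \<kappa> x [Y, B x X Z]"
  by (simp add: dkappa parallel_g parallel_J kappa_g g_lin)

end

text \<open>Closedness of \<open>\<kappa>\<close> provides those symmetries of \<open>A\<close> that involve the direction of differentiation.\<close>

locale almost_kaehler_chart = su3_chart +
  assumes closed_kappa: "x \<in> S \<Longrightarrow> ext_deriv \<kappa> x = (\<lambda>_. 0)"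
begin

lemma dkappa_cyclic:
  assumes x: "x \<in> S"
  shows "dd (\<lambda>y. \<kappa> y [Y, Z]) x X + dd (\<lambda>y. \<kappa> y [Z, X]) x Y + dd (\<lambda>y. \<kappa> y [X, Y]) x Z = 0"
proof -
  have "ext_deriv \<kappa> x [X, Y, Z] = 0" by (simp add: closed_kappa x)
  then show ?thesis using dkappa_skew[OF x, of Z X Y] by (simp add: ext_deriv_def numeral_3_eq_3 lessThan_Suc)
qed

lemma A_cyclic_J:
  assumes x: "x \<in> S"
  shows "g x (A x X Y) (J x Z) + g x (A x Y Z) (J x X) + g x (A x Z X) (J x Y) = 0"
proof -
  define n where "n X Y Z = dd (\<lambda>y. \<kappa> y [Y, Z]) x X - \<kappa> x [Gam x X Y, Z] - \<kappa> x [Y, Gam x X Z]" for X Y Z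
  have A_n: "2 * g x (A x X Y) (J x Z) = - n X Y Z" for X Y Z
  proof -
    have "2 * g x (A x X Y) (- J x Z) = n X Y (J x (- J x Z))" using A_nabla_kappa[OF x] by (simp add: n_def)
    then show ?thesis by (simp add: J_lin[OF x] J_J[OF x] g_lin[OF x])
  qed
  have "n X Y Z + n Y Z X + n Z X Y = 0"
    unfolding n_def using dkappa_cyclic[OF x, of Y Z X] Gam_sym[OF x, of X Y] Gam_sym[OF x, of Y Z] Gam_sym[OF x, of Z X]
      kappa_skew[OF x, of "Gam x X Y" Z] kappa_skew[OF x, of "Gam x Y Z" X] kappa_skew[OF x, of "Gam x Z X" Y] by simp
  then show ?thesis using A_n[of X Y Z] A_n[of Y Z X] A_n[of Z X Y] by simp
qed

lemma A_J_middle: "x \<in> S \<Longrightarrow> g x (A x X (J x Y)) Z = g x (A x X Y) (J x Z)"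
  by (simp add: A_J_right g_lin g_J_left)

text \<open>Shifting \<open>J\<close> through the cyclic identity \<open>A_cyclic_J\<close> in each of its arguments gives a system of linear equations
  between the values of \<open>g(A\<^sub>X Y, Z)\<close> with \<open>J\<close> in various places; its solution is the plain cyclic identity together with
  anti-linearity in \<open>X\<close>.\<close>

lemma A_cyclic_aux:
  assumes x: "x \<in> S"
  shows "g x (A x X Y) Z + g x (A x Y Z) X + g x (A x Z X) Y = 0"
    and "g x (A x (J x X) Y) (J x Z) = - g x (A x X Y) Z"
proof -
  note s = A_J_middle[OF x] J_J[OF x] linear_neg[OF linear_A(1)[OF x]] linear_neg[OF linear_A(2)[OF x]] g_lin[OF x]
  have 1: "g x (A x (J x X) Y) (J x Z) = g x (A x Y Z) X + g x (A x Z X) Y" for X Y Z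
    using A_cyclic_J[OF x, of "J x X" Y Z] by (simp add: s)
  have 2: "g x (A x (J x X) Y) (J x Z) + g x (A x (J x Y) Z) (J x X) + g x (A x (J x Z) X) (J x Y) = 0"
    using A_cyclic_J[OF x, of "J x X" "J x Y" "J x Z"] by (simp add: s)
  show 3: "g x (A x X Y) Z + g x (A x Y Z) X + g x (A x Z X) Y = 0"
    using 1[of X Y Z] 1[of Y Z X] 1[of Z X Y] 2 by simp
  show "g x (A x (J x X) Y) (J x Z) = - g x (A x X Y) Z" using 1[of X Y Z] 3 by simp
qed

lemmas A_cyclic = A_cyclic_aux(1)

lemma A_J_left: assumes x: "x \<in> S" shows "A x (J x X) Y = - J x (A x X Y)"
proof (rule g_nondegenerate[OF x])
  fix W
  have "g x (A x (J x X) Y) (J x (- J x W)) = - g x (A x X Y) (- J x W)" by (rule A_cyclic_aux(2)[OF x])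
  then show "g x (A x (J x X) Y) W = g x (- J x (A x X Y)) W"
    by (simp add: g_lin[OF x] J_lin[OF x] J_J[OF x] g_J_left[OF x])
qed

end

section \<open>The Hermitian connection preserves the 3-form\<close>

context su3_chart
begin

abbreviation E :: "real ^ 6 \<Rightarrow> 6 \<Rightarrow> real ^ 6" where "E x \<equiv> su3_point.E (coframe_at x)"

lemma g_E: "x \<in> S \<Longrightarrow> g x (E x i) (E x j) = (if i = j then 1 else 0)"
  using su3_point.g_E[OF point, of x i j] by (simp add: g_eq)
lemma J_E: "x \<in> S \<Longrightarrow> J x (E x 1) = E x 2" "x \<in> S \<Longrightarrow> J x (E x 2) = - E x 1" "x \<in> S \<Longrightarrow> J x (E x 3) = E x 4"
  "x \<in> S \<Longrightarrow> J x (E x 4) = - E x 3" "x \<in> S \<Longrightarrow> J x (E x 5) = E x 6" "x \<in> S \<Longrightarrow> J x (E x 6) = - E x 5"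
  using su3_point.J_E[OF point, of x] by (simp_all add: J_eq)
lemma Omega_alt: "x \<in> S \<Longrightarrow> \<Omega> x [a, a, b] = 0" "x \<in> S \<Longrightarrow> \<Omega> x [a, b, a] = 0" "x \<in> S \<Longrightarrow> \<Omega> x [a, b, b] = 0"
  using su3_point.Omega_alt[OF point, of x] by simp_all
lemma Omega_E: "x \<in> S \<Longrightarrow> \<Omega> x [E x 1, E x 3, E x 5] = 1" "x \<in> S \<Longrightarrow> \<Omega> x [E x 2, E x 3, E x 5] = 0"
  using su3_point.Omega_E[OF point, of x] by simp_all
lemma Omega_slots: "x \<in> S \<Longrightarrow> \<Omega> x [v, E x 3, E x 5] = g x v (E x 1)" "x \<in> S \<Longrightarrow> \<Omega> x [E x 1, v, E x 5] = g x v (E x 3)"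
    "x \<in> S \<Longrightarrow> \<Omega> x [E x 1, E x 3, v] = g x v (E x 5)"
  using su3_point.Omega_slots[OF point, of x] su3_point.g_E_right[OF point, of x] by (simp_all add: g_eq)

lemma dOmega_linear: "x \<in> S \<Longrightarrow> linear (\<lambda>h. dd (\<lambda>y. \<Omega> y [a, b, c]) x h)" "x \<in> S \<Longrightarrow> linear (\<lambda>a. dd (\<lambda>y. \<Omega> y [a, b, c]) x h)"
   "x \<in> S \<Longrightarrow> linear (\<lambda>b. dd (\<lambda>y. \<Omega> y [a, b, c]) x h)" "x \<in> S \<Longrightarrow> linear (\<lambda>c. dd (\<lambda>y. \<Omega> y [a, b, c]) x h)"
  by (rule dd_linear dd_linear_family[OF open_S _ linear_Omega(1)] dd_linear_family[OF open_S _ linear_Omega(2)]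
      dd_linear_family[OF open_S _ linear_Omega(3)], (assumption | rule differentiable_Omega)+)+

lemma dOmega_alt: assumes x: "x \<in> S" shows "dd (\<lambda>y. \<Omega> y [a, a, b]) x h = 0" "dd (\<lambda>y. \<Omega> y [a, b, a]) x h = 0" "dd (\<lambda>y. \<Omega> y [a, b, b]) x h = 0"
proof -
  have "dd (\<lambda>y. \<Omega> y vs) x h = 0" if "\<And>y. y \<in> S \<Longrightarrow> \<Omega> y vs = 0" for vs
    using dd_cong[OF open_S x, of "\<lambda>y. \<Omega> y vs" "\<lambda>_. 0" h] that by (simp add: frechet_derivative_const)
  then show "dd (\<lambda>y. \<Omega> y [a, a, b]) x h = 0" "dd (\<lambda>y. \<Omega> y [a, b, a]) x h = 0" "dd (\<lambda>y. \<Omega> y [a, b, b]) x h = 0"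
    using Omega_alt by blast+
qed

lemma Omega_J_deriv:
  assumes x: "x \<in> S"
  shows "dd (\<lambda>y. \<Omega> y [J y a, b, c]) x h = dd (\<lambda>y. \<Omega> y [J x a, b, c]) x h + \<Omega> x [dJ x h a, b, c]"
    and "dd (\<lambda>y. \<Omega> y [a, J y b, c]) x h = dd (\<lambda>y. \<Omega> y [a, J x b, c]) x h + \<Omega> x [a, dJ x h b, c]"
    and "dd (\<lambda>y. \<Omega> y [a, b, J y c]) x h = dd (\<lambda>y. \<Omega> y [a, b, J x c]) x h + \<Omega> x [a, b, dJ x h c]"
    and "(\<lambda>y. \<Omega> y [J y a, b, c]) differentiable (at x)"
  by (rule dd_apply[OF open_S x linear_Omega(1)] dd_apply[OF open_S x linear_Omega(2)] dd_apply[OF open_S x linear_Omega(3)],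
      (assumption | rule differentiable_Omega differentiable_J x)+)+

text \<open>The covariant derivative of \<open>\<Omega>\<close> with respect to \<open>B\<close>, as a 3-form depending on the direction \<open>X\<close>.\<close>

definition H :: "real ^ 6 \<Rightarrow> real ^ 6 \<Rightarrow> real ^ 6 \<Rightarrow> real ^ 6 \<Rightarrow> real ^ 6 \<Rightarrow> real" where
  "H x X a b c = dd (\<lambda>y. \<Omega> y [a, b, c]) x X - (\<Omega> x [B x X a, b, c] + \<Omega> x [a, B x X b, c] + \<Omega> x [a, b, B x X c])"

lemma Omega_lin: "x \<in> S \<Longrightarrow> \<Omega> x [a + a', b, c] = \<Omega> x [a, b, c] + \<Omega> x [a', b, c]"
  "x \<in> S \<Longrightarrow> \<Omega> x [a, b + b', c] = \<Omega> x [a, b, c] + \<Omega> x [a, b', c]"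
  "x \<in> S \<Longrightarrow> \<Omega> x [a, b, c + c'] = \<Omega> x [a, b, c] + \<Omega> x [a, b, c']"
  "x \<in> S \<Longrightarrow> \<Omega> x [a - a', b, c] = \<Omega> x [a, b, c] - \<Omega> x [a', b, c]"
  "x \<in> S \<Longrightarrow> \<Omega> x [a, b - b', c] = \<Omega> x [a, b, c] - \<Omega> x [a, b', c]"
  "x \<in> S \<Longrightarrow> \<Omega> x [a, b, c - c'] = \<Omega> x [a, b, c] - \<Omega> x [a, b, c']"
  "x \<in> S \<Longrightarrow> \<Omega> x [- a, b, c] = - \<Omega> x [a, b, c]" "x \<in> S \<Longrightarrow> \<Omega> x [a, - b, c] = - \<Omega> x [a, b, c]"
  "x \<in> S \<Longrightarrow> \<Omega> x [a, b, - c] = - \<Omega> x [a, b, c]"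
  "x \<in> S \<Longrightarrow> \<Omega> x [r *\<^sub>R a, b, c] = r * \<Omega> x [a, b, c]" "x \<in> S \<Longrightarrow> \<Omega> x [a, r *\<^sub>R b, c] = r * \<Omega> x [a, b, c]"
  "x \<in> S \<Longrightarrow> \<Omega> x [a, b, r *\<^sub>R c] = r * \<Omega> x [a, b, c]"
  by (simp_all add: linear_add[OF linear_Omega(1)] linear_add[OF linear_Omega(2)] linear_add[OF linear_Omega(3)]
     linear_diff[OF linear_Omega(1)] linear_diff[OF linear_Omega(2)] linear_diff[OF linear_Omega(3)]
     linear_neg[OF linear_Omega(1)] linear_neg[OF linear_Omega(2)] linear_neg[OF linear_Omega(3)]
     linear_scale[OF linear_Omega(1)] linear_scale[OF linear_Omega(2)] linear_scale[OF linear_Omega(3)])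

lemma Omega_swap: assumes x: "x \<in> S" shows "\<Omega> x [a, b, c] = - \<Omega> x [b, a, c]" "\<Omega> x [a, b, c] = - \<Omega> x [a, c, b]"
  using Omega_alt(1)[OF x, of "a + b" c] Omega_alt(1)[OF x, of a c] Omega_alt(1)[OF x, of b c]
    Omega_alt(3)[OF x, of a "b + c"] Omega_alt(3)[OF x, of a b] Omega_alt(3)[OF x, of a c]
  unfolding Omega_lin[OF x] by linarith+

lemma H_J: assumes x: "x \<in> S" shows "H x X (J x a) b c = H x X a (J x b) c" "H x X a (J x b) c = H x X a b (J x c)"
proof -
  have 1: "dd (\<lambda>y. \<Omega> y [J y a, b, c]) x X = dd (\<lambda>y. \<Omega> y [a, J y b, c]) x X"
    and 2: "dd (\<lambda>y. \<Omega> y [a, J y b, c]) x X = dd (\<lambda>y. \<Omega> y [a, b, J y c]) x X"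
    by (rule dd_cong[OF open_S x], simp add: Omega_J)+
  show "H x X (J x a) b c = H x X a (J x b) c"
    using 1 by (simp add: H_def Omega_J_deriv[OF x] parallel_J[OF x] Omega_lin[OF x] Omega_J[OF x])
  show "H x X a (J x b) c = H x X a b (J x c)"
    using 2 by (simp add: H_def Omega_J_deriv[OF x] parallel_J[OF x] Omega_lin[OF x] Omega_J[OF x])
qed

text \<open>The Gram determinant identity is differentiated on the frame at \<open>x\<close>, held constant. There all off-diagonal terms vanish to first
  order, and what remains is the change of \<open>\<Omega>(E\<^sub>1, E\<^sub>3, E\<^sub>5)\<close> prescribed by the metric.\<close>

lemma H_normalized: assumes x: "x \<in> S" shows "H x X (E x 1) (E x 3) (E x 5) = 0"
proof -
  let ?a = "E x 1" and ?b = "E x 3" and ?c = "E x 5"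
  define P where "P y = (\<Omega> y [?a, ?b, ?c])\<^sup>2 + (\<Omega> y [J y ?a, ?b, ?c])\<^sup>2" for y
  have D: "((\<lambda>y. \<Omega> y vs) has_derivative dd (\<lambda>y. \<Omega> y vs) x) (at x)" "((\<lambda>y. \<kappa> y vs) has_derivative dd (\<lambda>y. \<kappa> y vs) x) (at x)"
    "((\<lambda>y. g y v w) has_derivative dd (\<lambda>y. g y v w) x) (at x)" 
    "((\<lambda>y. \<Omega> y [J y ?a, ?b, ?c]) has_derivative dd (\<lambda>y. \<Omega> y [J y ?a, ?b, ?c]) x) (at x)" for vs v w
    using differentiable_Omega[OF x] differentiable_kappa[OF x] differentiable_g[OF x] Omega_J_deriv(4)[OF x]
    by (simp_all add: frechet_derivative_works)
  have v: "g x ?a ?a = 1" "g x ?b ?b = 1" "g x ?c ?c = 1" "g x ?a ?b = 0" "g x ?b ?c = 0" "g x ?c ?a = 0"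
    "\<kappa> x [?a, ?b] = 0" "\<kappa> x [?b, ?c] = 0" "\<kappa> x [?c, ?a] = 0" "\<Omega> x [?a, ?b, ?c] = 1" "\<Omega> x [J x ?a, ?b, ?c] = 0"
    by (simp_all add: x g_E kappa_g J_E Omega_E)
  have 1: "(P has_derivative (\<lambda>h. 2 * dd (\<lambda>y. \<Omega> y [?a, ?b, ?c]) x h)) (at x)"
    unfolding P_def by (rule derivative_eq_intros D refl)+ (simp add: v fun_eq_iff)
  have 2: "(P has_derivative (\<lambda>h. dd (\<lambda>y. g y ?a ?a) x h + dd (\<lambda>y. g y ?b ?b) x h + dd (\<lambda>y. g y ?c ?c) x h)) (at x)"
  proof (rule has_derivative_transform_within_open[OF _ open_S x])
    define Q where "Q y = g y ?a ?a * g y ?b ?b * g y ?c ?c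
     + 2 * (g y ?a ?b * g y ?b ?c * g y ?c ?a - g y ?a ?b * \<kappa> y [?b, ?c] * \<kappa> y [?c, ?a]
         - \<kappa> y [?a, ?b] * g y ?b ?c * \<kappa> y [?c, ?a] - \<kappa> y [?a, ?b] * \<kappa> y [?b, ?c] * g y ?c ?a)
     - g y ?a ?a * ((g y ?b ?c)\<^sup>2 + (\<kappa> y [?b, ?c])\<^sup>2) - g y ?b ?b * ((g y ?c ?a)\<^sup>2 + (\<kappa> y [?c, ?a])\<^sup>2)
     - g y ?c ?c * ((g y ?a ?b)\<^sup>2 + (\<kappa> y [?a, ?b])\<^sup>2)" for y
    show "Q y = P y" if "y \<in> S" for y
      using su3_point.Omega_gram[OF point[OF that], of ?a ?b ?c] that by (simp add: Q_def P_def J_eq g_eq)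
    show "(Q has_derivative (\<lambda>h. dd (\<lambda>y. g y ?a ?a) x h + dd (\<lambda>y. g y ?b ?b) x h + dd (\<lambda>y. g y ?c ?c) x h)) (at x)"
      unfolding Q_def by (rule derivative_eq_intros D refl)+ (simp add: v fun_eq_iff)
  qed
  have "2 * dd (\<lambda>y. \<Omega> y [?a, ?b, ?c]) x X = dd (\<lambda>y. g y ?a ?a) x X + dd (\<lambda>y. g y ?b ?b) x X + dd (\<lambda>y. g y ?c ?c) x X"
    using fun_cong[OF has_derivative_unique[OF 1 2], of X] .
  then show ?thesis
    using g_sym[OF x] by (simp add: H_def parallel_g[OF x] Omega_slots[OF x])
qed

text \<open>The infinitesimal phase by which \<open>B\<close> fails to preserve the complex volume form.\<close>

definition mu :: "real ^ 6 \<Rightarrow> real ^ 6 \<Rightarrow> real" where "mu x X = H x X (E x 2) (E x 3) (E x 5)"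

text \<open>The derivative of \<open>\<Omega>\<close> is again compatible with \<open>J\<close>, hence a combination of \<open>\<Omega>\<close> and \<open>J\<Omega>\<close>; the coefficient of \<open>\<Omega>\<close> vanishes by
  \<open>H_normalized\<close>.\<close>

lemma H_mu: assumes x: "x \<in> S" shows "H x X a b c = - mu x X * \<Omega> x [J x a, b, c]"
proof -
  define f where "f a b c = H x X a b c + mu x X * \<Omega> x [J x a, b, c]" for a b c
  have "f a b c = 0"
  proof (rule su3_point.J_linear_3form_eq_0[OF point[OF x]], unfold J_eq[OF x])
    note l = linear_add[OF dOmega_linear(2)[OF x]] linear_add[OF dOmega_linear(3)[OF x]] linear_add[OF dOmega_linear(4)[OF x]]
       linear_scale[OF dOmega_linear(2)[OF x]] linear_scale[OF dOmega_linear(3)[OF x]] linear_scale[OF dOmega_linear(4)[OF x]]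
       linear_add[OF linear_B(2)[OF x]] linear_scale[OF linear_B(2)[OF x]] Omega_lin[OF x] J_lin[OF x]
    show "linear (\<lambda>a. f a b c)" "linear (\<lambda>b. f a b c)" "linear (f a b)" for a b c
      by (auto intro!: linearI simp: f_def H_def l algebra_simps)
    have o: "\<Omega> x [J x a, a, b] = 0" "\<Omega> x [J x a, b, a] = 0" for a b
    proof -
      show *: "\<Omega> x [J x a, a, b] = 0" for a b using Omega_J(1)[OF x, of a a b] Omega_swap(1)[OF x, of a "J x a" b] by simp
      show "\<Omega> x [J x a, b, a] = 0" using *[of a b] Omega_swap(2)[OF x, of "J x a" a b] by simp
    qed
    show "f a a b = 0" for a b
      using Omega_swap(1)[OF x, of a "B x X a" b] by (simp add: f_def H_def dOmega_alt[OF x] Omega_alt[OF x] o)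
    show "f a b a = 0" for a b
      using Omega_swap(1)[OF x, of a b "B x X a"] Omega_swap(2)[OF x, of b a "B x X a"] Omega_swap(1)[OF x, of b "B x X a" a]
      by (simp add: f_def H_def dOmega_alt[OF x] Omega_alt[OF x] o)
    show "f a b b = 0" for a b
      using Omega_swap(2)[OF x, of a b "B x X b"] by (simp add: f_def H_def dOmega_alt[OF x] Omega_alt[OF x])
    show "f (J x a) b c = f a (J x b) c" "f a (J x b) c = f a b (J x c)" for a b c
      by (simp_all add: f_def H_J[OF x] Omega_J[OF x])
    show "f (E x 1) (E x 3) (E x 5) = 0"
      by (simp add: f_def H_normalized[OF x] J_E[OF x] Omega_E[OF x])
    show "f (E x 2) (E x 3) (E x 5) = 0"
      by (simp add: f_def mu_def J_E[OF x] Omega_E[OF x] Omega_lin[OF x])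
  qed
  then show ?thesis by (simp add: f_def)
qed

end

context su3_chart
begin

abbreviation eps :: "real ^ 6 \<Rightarrow> real ^ 6 \<Rightarrow> real ^ 6 \<Rightarrow> real ^ 6 \<Rightarrow> complex" where
  "eps x a b c \<equiv> su3_eps (\<kappa> x) (\<Omega> x) [a, b, c]"

lemma J_Omega_eq: "x \<in> S \<Longrightarrow> J_Omega (\<kappa> x) (\<Omega> x) [a, b, c] = - \<Omega> x [J x a, b, c]"
  by (simp add: J_Omega_def endo_act_def Omega_J J_J Omega_lin)

lemma eps_eq: "x \<in> S \<Longrightarrow> eps x a b c = Complex (\<Omega> x [a, b, c]) (- \<Omega> x [J x a, b, c])"
  by (simp add: su3_eps_def J_Omega_eq complex_eq_iff)

lemma eps_J: "x \<in> S \<Longrightarrow> eps x (J x a) b c = \<i> * eps x a b c" "x \<in> S \<Longrightarrow> eps x a (J x b) c = \<i> * eps x a b c"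
  "x \<in> S \<Longrightarrow> eps x a b (J x c) = \<i> * eps x a b c"
  by (simp_all add: eps_eq complex_eq_iff J_J Omega_lin Omega_J)

lemma eps_lin:
  assumes x: "x \<in> S"
  shows "eps x (a + a') b c = eps x a b c + eps x a' b c" "eps x a (b + b') c = eps x a b c + eps x a b' c"
    "eps x a b (c + c') = eps x a b c + eps x a b c'" "eps x (a - a') b c = eps x a b c - eps x a' b c"
    "eps x a (b - b') c = eps x a b c - eps x a b' c" "eps x a b (c - c') = eps x a b c - eps x a b c'"
    "eps x 0 b c = 0" "eps x a 0 c = 0" "eps x a b 0 = 0"
    "eps x (- a) b c = - eps x a b c" "eps x a (- b) c = - eps x a b c" "eps x a b (- c) = - eps x a b c"
  using linear_0[OF linear_Omega(1)[OF x]] linear_0[OF linear_Omega(2)[OF x]] linear_0[OF linear_Omega(3)[OF x]]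
  by (simp_all add: eps_eq[OF x] complex_eq_iff Omega_lin[OF x] J_lin[OF x])

lemma eps_alt: assumes x: "x \<in> S" shows "eps x a a b = 0" "eps x a b a = 0" "eps x a b b = 0"
proof -
  have *: "\<Omega> x [J x a, a, b] = 0" for a b using Omega_J(1)[OF x, of a a b] Omega_swap(1)[OF x, of a "J x a" b] by simp
  have "\<Omega> x [J x a, b, a] = 0" using *[of a b] Omega_swap(2)[OF x, of "J x a" a b] by simp
  then show "eps x a a b = 0" "eps x a b a = 0" "eps x a b b = 0"
    by (simp_all add: eps_eq[OF x] complex_eq_iff Omega_alt[OF x] *)
qed

lemma eps_swap: assumes x: "x \<in> S" shows "eps x a b c = - eps x b a c" "eps x a b c = - eps x a c b"
  using eps_alt(1)[OF x, of "a + b" c] eps_alt(3)[OF x, of a "b + c"]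
  unfolding eps_lin[OF x] by (simp_all add: eps_alt[OF x] eq_neg_iff_add_eq_0 add.commute)

lemma deriv_Omega: "x \<in> S \<Longrightarrow> dd (\<lambda>y. \<Omega> y [a, b, c]) x X =
    \<Omega> x [B x X a, b, c] + \<Omega> x [a, B x X b, c] + \<Omega> x [a, b, B x X c] - mu x X * \<Omega> x [J x a, b, c]"
  using H_mu[of x X a b c] by (simp add: H_def)

lemma deriv_J_Omega:
  assumes x: "x \<in> S"
  shows "dd (\<lambda>y. J_Omega (\<kappa> y) (\<Omega> y) [a, b, c]) x X =
    - \<Omega> x [J x (B x X a), b, c] - \<Omega> x [J x a, B x X b, c] - \<Omega> x [J x a, b, B x X c] - mu x X * \<Omega> x [a, b, c]"
proof -
  have "dd (\<lambda>y. J_Omega (\<kappa> y) (\<Omega> y) [a, b, c]) x X = dd (\<lambda>y. - \<Omega> y [J y a, b, c]) x X"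
    by (rule dd_cong[OF open_S x]) (rule J_Omega_eq)
  also have "\<dots> = - (dd (\<lambda>y. \<Omega> y [J x a, b, c]) x X + \<Omega> x [dJ x X a, b, c])"
    by (simp add: dd_minus Omega_J_deriv[OF x])
  finally show ?thesis by (simp add: deriv_Omega[OF x] parallel_J[OF x] Omega_lin[OF x] J_J[OF x])
qed

lemma smooth_J_Omega: "smooth_on S (\<lambda>y. J_Omega (\<kappa> y) (\<Omega> y) [a, b, c])"
proof (rule smooth_on_transform[OF open_S _ J_Omega_eq])
  show "smooth_on S (\<lambda>y. - \<Omega> y [J y a, b, c])"
    by (rule smooth_on_minus[OF open_S smooth_on_apply[OF open_S linear_Omega(1) smooth_Omega smooth_J]])
qed

lemma dd_eps:
  assumes x: "x \<in> S"
  shows "dd (\<lambda>y. eps y a b c) x X = complex_of_real (dd (\<lambda>y. \<Omega> y [a, b, c]) x X)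
      + \<i> * complex_of_real (dd (\<lambda>y. J_Omega (\<kappa> y) (\<Omega> y) [a, b, c]) x X)"
proof -
  have "((\<lambda>y. eps y a b c) has_derivative (\<lambda>h. complex_of_real (dd (\<lambda>y. \<Omega> y [a, b, c]) x h)
      + \<i> * complex_of_real (dd (\<lambda>y. J_Omega (\<kappa> y) (\<Omega> y) [a, b, c]) x h))) (at x)"
    unfolding su3_eps_def
    using differentiable_Omega[OF x] smooth_on_differentiable[OF smooth_J_Omega x]
    by (auto simp: frechet_derivative_works intro!: derivative_eq_intros)
  then show ?thesis by (rule frechet_eqI)
qed

lemma deriv_eps:
  assumes x: "x \<in> S"
  shows "dd (\<lambda>y. eps y a b c) x X =
    eps x (B x X a) b c + eps x a (B x X b) c + eps x a b (B x X c) - \<i> * mu x X * eps x a b c"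
  by (simp add: dd_eps[OF x] deriv_Omega[OF x] deriv_J_Omega[OF x] eps_eq[OF x] complex_eq_iff Omega_J[OF x])

text \<open>The torsion of the connection \<open>B\<close>.\<close>

definition T :: "real ^ 6 \<Rightarrow> real ^ 6 \<Rightarrow> real ^ 6 \<Rightarrow> real ^ 6" where "T x X Y = A x X Y - A x Y X"

lemma B_torsion: "x \<in> S \<Longrightarrow> B x X Y - B x Y X = T x X Y"
  by (simp add: B_def T_def Gam_sym[of x X Y])

lemma ext_deriv_4: "ext_deriv f x [a, b, c, d] = dd (\<lambda>y. f y [b, c, d]) x a - dd (\<lambda>y. f y [a, c, d]) x b
    + dd (\<lambda>y. f y [a, b, d]) x c - dd (\<lambda>y. f y [a, b, c]) x d"
  by (simp add: ext_deriv_def lessThan_Suc numeral_eq_Suc)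

text \<open>The exterior derivative of a form is the antisymmetrised covariant derivative plus an insertion of the torsion of the connection.\<close>

lemma ext_deriv_eps:
  assumes x: "x \<in> S"
  shows "ext_deriv (\<lambda>y. su3_eps (\<kappa> y) (\<Omega> y)) x [a, b, c, d] =
    eps x (T x a b) c d - eps x (T x a c) b d + eps x (T x a d) b c + eps x (T x b c) a d - eps x (T x b d) a c + eps x (T x c d) a b
    - \<i> * (mu x a * eps x b c d - mu x b * eps x a c d + mu x c * eps x a b d - mu x d * eps x a b c)"
  unfolding ext_deriv_4 deriv_eps[OF x] B_torsion[OF x, symmetric] eps_lin[OF x]
  using eps_swap(1)[OF x, of b "B x a c" d] eps_swap(2)[OF x, of b c "B x a d"] eps_swap(1)[OF x, of b "B x a d" c]
    eps_swap(1)[OF x, of a "B x b c" d] eps_swap(2)[OF x, of a c "B x b d"] eps_swap(1)[OF x, of a "B x b d" c]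
    eps_swap(1)[OF x, of a "B x c b" d] eps_swap(2)[OF x, of a b "B x c d"] eps_swap(1)[OF x, of a "B x c d" b]
    eps_swap(1)[OF x, of a "B x d b" c] eps_swap(2)[OF x, of a b "B x d c"] eps_swap(1)[OF x, of a "B x d c" b]
  by (simp add: algebra_simps)

lemma mu_linear: "x \<in> S \<Longrightarrow> linear (mu x)"
  by (auto intro!: linearI simp: mu_def H_def Omega_lin linear_add[OF linear_B(1)] linear_scale[OF linear_B(1)]
     linear_add[OF dOmega_linear(1)] linear_scale[OF dOmega_linear(1)] algebra_simps)

end

context almost_kaehler_chart
begin

lemma T_J: "x \<in> S \<Longrightarrow> T x (J x X) Y = - J x (T x X Y)" "x \<in> S \<Longrightarrow> T x X (J x Y) = - J x (T x X Y)"
  by (simp_all add: T_def A_J_left A_J_right J_lin)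

lemma T_alt: "T x X X = 0" "T x X Y = - T x Y X"
  by (simp_all add: T_def)

lemma T_neg: assumes x: "x \<in> S" shows "T x (- X) Y = - T x X Y" "T x X (- Y) = - T x X Y"
  by (simp_all add: T_def linear_neg[OF linear_A(1)[OF x]] linear_neg[OF linear_A(2)[OF x]])

end

locale gcy_chart = almost_kaehler_chart +
  assumes type_31: "x \<in> S \<Longrightarrow> type_component (J x) 3 1 (ext_deriv (\<lambda>y. su3_eps (\<kappa> y) (\<Omega> y)) x) = (\<lambda>_. 0)"
begin

text \<open>Anti-linearity of \<open>T\<close> removes the torsion from the (3,1)-part of the exterior derivative of \<open>\<epsilon>\<close>, which leaves
  \<open>\<mu>(a) + \<i> \<mu>(J a)\<close> times \<open>\<epsilon>(a, b, c)\<close>. As \<open>\<mu>\<close> is real, both of its values vanish.\<close>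

lemma mu_eq_0_aux:
  assumes x: "x \<in> S" and e: "eps x a b c \<noteq> 0"
  shows "mu x a = 0" "mu x (J x a) = 0"
proof -
  let ?\<psi> = "ext_deriv (\<lambda>y. su3_eps (\<kappa> y) (\<Omega> y)) x"
  note rules = ext_deriv_eps[OF x] eps_lin[OF x] eps_J[OF x] eps_alt[OF x] T_J[OF x] T_alt(1) T_neg[OF x] J_J[OF x] J_lin[OF x]
    linear_neg[OF mu_linear[OF x]]
  have Tba: "T x y a = - T x a y" for y by (rule T_alt)
  have Tcb: "T x c b = - T x b c" by (rule T_alt)
  have swa: "eps x t y a = - eps x t a y" "eps x y a t = - eps x a y t" for t y by (rule eps_swap[OF x])+
  have swb: "eps x t c b = - eps x t b c" for t by (rule eps_swap[OF x])
  have "0 = type_component (J x) 3 1 ?\<psi> [a, b, c, J x a]" unfolding type_31[OF x] ..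
  also have "\<dots> = (?\<psi> [a, b, c, J x a] - \<i> * ?\<psi> [a, J x b, c, J x a] - \<i> * ?\<psi> [a, b, J x c, J x a] - ?\<psi> [a, J x b, J x c, J x a]) / 4"
  proof (rule type_component_3_1)
    show "J x (J x v) = - v" for v by (rule J_J[OF x])
    show "?\<psi> [a, y, z, - a] = 0" for y z
      by (simp add: rules) (simp add: Tba[of y] Tba[of z] eps_swap(1)[OF x, of y a z] eps_swap(2)[OF x, of y z a]
        eps_swap(2)[OF x, of "T x a z" y a] eps_swap(2)[OF x, of "T x a y" z a] rules)
    show "?\<psi> [J x a, y, z, J x a] = 0" for y z
      by (simp add: rules) (simp add: Tba[of y] Tba[of z] eps_swap(1)[OF x, of y a z] eps_swap(2)[OF x, of y z a]
        eps_swap(2)[OF x, of "T x a z" y a] eps_swap(2)[OF x, of "T x a y" z a] rules)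
    show "?\<psi> [J x a, y, z, - a] = ?\<psi> [a, y, z, J x a]" for y z
      by (simp add: rules) (simp add: Tba[of y] Tba[of z] eps_swap(1)[OF x, of y a z] eps_swap(2)[OF x, of y z a]
        eps_swap(2)[OF x, of "T x a z" y a] eps_swap(2)[OF x, of "T x a y" z a] rules algebra_simps)
  qed
  also have "\<dots> = (mu x a + \<i> * mu x (J x a)) * eps x a b c"
    by (simp add: rules) (simp add: Tba[of b] Tba[of c] Tcb swb eps_swap(1)[OF x, of b a c] eps_swap(2)[OF x, of b c a]
        eps_swap(2)[OF x, of _ b a] eps_swap(2)[OF x, of _ c a] rules field_simps)
  finally have "complex_of_real (mu x a) + \<i> * complex_of_real (mu x (J x a)) = 0" using e by simp
  then show "mu x a = 0" "mu x (J x a) = 0" by (simp_all add: complex_eq_iff)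
qed

lemma mu_eq_0: assumes x: "x \<in> S" shows "mu x X = 0"
proof -
  have e: "eps x (E x 1) (E x 3) (E x 5) = 1" by (simp add: eps_eq[OF x] J_E[OF x] Omega_E[OF x] complex_eq_iff)
  have e3: "eps x (E x 3) (E x 5) (E x 1) = 1"
    using e eps_swap(1)[OF x, of "E x 1" "E x 3" "E x 5"] eps_swap(2)[OF x, of "E x 3" "E x 1" "E x 5"] by simp
  have e5: "eps x (E x 5) (E x 1) (E x 3) = 1"
    using e eps_swap(2)[OF x, of "E x 1" "E x 3" "E x 5"] eps_swap(1)[OF x, of "E x 1" "E x 5" "E x 3"] by simp
  \<comment> \<open>The three cyclic permutations of \<open>E\<^sub>1, E\<^sub>3, E\<^sub>5\<close>, each giving the values on one vector and its image under \<open>J\<close>, cover the frame.\<close>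
  have "mu x (E x i) = 0" for i
    using mu_eq_0_aux[OF x, of "E x 1" "E x 3" "E x 5"] mu_eq_0_aux[OF x, of "E x 3" "E x 5" "E x 1"]
      mu_eq_0_aux[OF x, of "E x 5" "E x 1" "E x 3"] e e3 e5 exhaust_6[of i] by (auto simp: J_E[OF x])
  moreover have "mu x X = (\<Sum>i\<in>UNIV. g x X (E x i) *\<^sub>R mu x (E x i))"
    by (subst su3_point.frame_expansion[OF point[OF x], of X])
      (simp only: linear_sum[OF mu_linear[OF x]] linear_scale[OF mu_linear[OF x]] g_eq[OF x])
  ultimately show ?thesis by simp
qed

lemma parallel_Omega: "x \<in> S \<Longrightarrow> dd (\<lambda>y. \<Omega> y [a, b, c]) x X = \<Omega> x [B x X a, b, c] + \<Omega> x [a, B x X b, c] + \<Omega> x [a, b, B x X c]"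
  by (simp add: deriv_Omega mu_eq_0)

end

section \<open>Curvature of the two connections\<close>

context almost_kaehler_chart
begin

abbreviation dB :: "real ^ 6 \<Rightarrow> real ^ 6 \<Rightarrow> real ^ 6 \<Rightarrow> real ^ 6 \<Rightarrow> real ^ 6" where "dB x X Y Z \<equiv> dd (\<lambda>y. B y Y Z) x X"
abbreviation dA :: "real ^ 6 \<Rightarrow> real ^ 6 \<Rightarrow> real ^ 6 \<Rightarrow> real ^ 6 \<Rightarrow> real ^ 6" where "dA x X Y Z \<equiv> dd (\<lambda>y. A y Y Z) x X"
abbreviation dGam :: "real ^ 6 \<Rightarrow> real ^ 6 \<Rightarrow> real ^ 6 \<Rightarrow> real ^ 6 \<Rightarrow> real ^ 6" where "dGam x X Y Z \<equiv> dd (\<lambda>y. Gam y Y Z) x X"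

text \<open>The curvature of \<open>B\<close>.\<close>

definition F :: "real ^ 6 \<Rightarrow> real ^ 6 \<Rightarrow> real ^ 6 \<Rightarrow> real ^ 6 \<Rightarrow> real ^ 6" where
  "F x X Y Z = dB x X Y Z - dB x Y X Z + B x X (B x Y Z) - B x Y (B x X Z)"

text \<open>The Riemann tensor, as an operator on constant vectors.\<close>

definition R :: "real ^ 6 \<Rightarrow> real ^ 6 \<Rightarrow> real ^ 6 \<Rightarrow> real ^ 6 \<Rightarrow> real ^ 6" where
  "R x X Y Z = dGam x X Y Z - dGam x Y X Z + Gam x X (Gam x Y Z) - Gam x Y (Gam x X Z)"

text \<open>The derivative of \<open>A\<close> that is covariant for \<open>B\<close> in all arguments. As \<open>B\<close> preserves \<open>g\<close> and \<open>J\<close>, it inherits every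
  algebraic identity of \<open>A\<close> that is expressed by them.\<close>

definition DA :: "real ^ 6 \<Rightarrow> real ^ 6 \<Rightarrow> real ^ 6 \<Rightarrow> real ^ 6 \<Rightarrow> real ^ 6" where
  "DA x W X Y = dA x W X Y + B x W (A x X Y) - A x X (B x W Y) - A x (B x W X) Y"

lemma linear_dGam: assumes x: "x \<in> S" 
  shows "linear (\<lambda>X. dGam x X Y Z)" "linear (\<lambda>Y. dGam x X Y Z)" "linear (\<lambda>Z. dGam x X Y Z)"
  by (rule dd_linear dd_linear_family[OF open_S x linear_Gam(1)] dd_linear_family[OF open_S x linear_Gam(2)], rule differentiable_Gam[OF x])+

lemma linear_dA: assumes x: "x \<in> S" 
  shows "linear (\<lambda>X. dA x X Y Z)" "linear (\<lambda>Y. dA x X Y Z)" "linear (\<lambda>Z. dA x X Y Z)"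
  by (rule dd_linear dd_linear_family[OF open_S x linear_A(1)] dd_linear_family[OF open_S x linear_A(2)], (assumption | rule differentiable_A[OF x])+)+

lemma linear_dB: assumes x: "x \<in> S" 
  shows "linear (\<lambda>X. dB x X Y Z)" "linear (\<lambda>Y. dB x X Y Z)" "linear (\<lambda>Z. dB x X Y Z)"
  by (rule dd_linear dd_linear_family[OF open_S x linear_B(1)] dd_linear_family[OF open_S x linear_B(2)], (assumption | rule differentiable_B[OF x])+)+

lemma linear_R: assumes x: "x \<in> S" shows "linear (\<lambda>X. R x X Y Z)" "linear (\<lambda>Y. R x X Y Z)" "linear (\<lambda>Z. R x X Y Z)"
proof -
  note l = linear_add[OF linear_dGam(1)[OF x]] linear_add[OF linear_dGam(2)[OF x]] linear_add[OF linear_dGam(3)[OF x]]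
    linear_scale[OF linear_dGam(1)[OF x]] linear_scale[OF linear_dGam(2)[OF x]] linear_scale[OF linear_dGam(3)[OF x]]
    linear_add[OF linear_Gam(1)] linear_add[OF linear_Gam(2)] linear_scale[OF linear_Gam(1)] linear_scale[OF linear_Gam(2)]
  show "linear (\<lambda>X. R x X Y Z)" "linear (\<lambda>Y. R x X Y Z)" "linear (\<lambda>Z. R x X Y Z)"
    by (auto intro!: linearI simp: R_def l dd_add dd_scaleR differentiable_Gam[OF x] algebra_simps)
qed

lemma linear_F: assumes x: "x \<in> S" shows "linear (\<lambda>X. F x X Y Z)" "linear (F x X Y)"
proof -
  note l = linear_add[OF linear_dB(1)[OF x]] linear_add[OF linear_dB(2)[OF x]] linear_add[OF linear_dB(3)[OF x]]
    linear_scale[OF linear_dB(1)[OF x]] linear_scale[OF linear_dB(2)[OF x]] linear_scale[OF linear_dB(3)[OF x]]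
    linear_add[OF linear_B(1)[OF x]] linear_add[OF linear_B(2)[OF x]] linear_scale[OF linear_B(1)[OF x]] linear_scale[OF linear_B(2)[OF x]]
  show "linear (\<lambda>X. F x X Y Z)" "linear (F x X Y)"
    by (auto intro!: linearI simp: F_def l algebra_simps)
qed

lemma linear_DA: assumes x: "x \<in> S" shows "linear (\<lambda>X. DA x W X Y)" "linear (DA x W X)"
proof -
  note l = linear_add[OF linear_dA(2)[OF x]] linear_add[OF linear_dA(3)[OF x]] linear_scale[OF linear_dA(2)[OF x]] linear_scale[OF linear_dA(3)[OF x]]
    linear_add[OF linear_B(2)[OF x]] linear_scale[OF linear_B(2)[OF x]]
    linear_add[OF linear_A(1)[OF x]] linear_add[OF linear_A(2)[OF x]] linear_scale[OF linear_A(1)[OF x]] linear_scale[OF linear_A(2)[OF x]]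
  show "linear (\<lambda>X. DA x W X Y)" "linear (DA x W X)"
    by (auto intro!: linearI simp: DA_def l algebra_simps)
qed

lemma R_first_bianchi: assumes x: "x \<in> S" shows "R x X Y Z + R x Y Z X + R x Z X Y = 0"
proof -
  have "dGam x X Y Z = dGam x X Z Y" for X Y Z by (rule dd_cong[OF open_S x]) (rule Gam_sym)
  then show ?thesis
    using Gam_sym[OF x, of Y Z] Gam_sym[OF x, of X Z] Gam_sym[OF x, of X Y] by (simp add: R_def)
qed

text \<open>Shifting a connection by a tensor changes the curvature by the exterior covariant derivative and the square of the tensor.
  Writing the former with \<open>DA\<close>, which also differentiates the direction argument, produces the terms with the torsion
  \<open>A\<^sub>X Y - A\<^sub>Y X\<close>.\<close>

lemma R_decomposition:
  assumes x: "x \<in> S"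
  shows "R x X Y Z = F x X Y Z - DA x X Y Z + DA x Y X Z - A x (A x X Y) Z + A x (A x Y X) Z + A x X (A x Y Z) - A x Y (A x X Z)"
proof -
  have G: "Gam x X Y = B x X Y - A x X Y" for x X Y by (simp add: B_def)
  have dG: "dGam x X Y Z = dB x X Y Z - dA x X Y Z" for X Y Z
    unfolding G by (rule dd_diff[OF differentiable_B[OF x] differentiable_A[OF x]])
  have "A x (B x X Y) Z - A x (B x Y X) Z = A x (A x X Y) Z - A x (A x Y X) Z"
    using B_torsion[OF x, of X Y] linear_diff[OF linear_A(1)[OF x]] by (metis T_def)
  then show ?thesis
    unfolding R_def dG unfolding F_def DA_def G linear_diff[OF linear_B(2)[OF x]] linear_diff[OF linear_A(2)[OF x]]
    by (simp add: algebra_simps)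
qed

text \<open>A parallel tensor is annihilated by the curvature, as its second derivatives commute. The terms with one derivative on each
  slot are symmetric in the two directions and drop out.\<close>

lemma curvature_annihilates_2:
  assumes x: "x \<in> S" and smooth: "\<And>v w. smooth_on S (\<lambda>y. t y v w)"
    and lin: "\<And>y w. y \<in> S \<Longrightarrow> linear (\<lambda>v. t y v w)" "\<And>y v. y \<in> S \<Longrightarrow> linear (t y v)"
    and par: "\<And>y X v w. y \<in> S \<Longrightarrow> dd (\<lambda>y. t y v w) y X = t y (B y X v) w + t y v (B y X w)"
  shows "t x (F x X Y v) w + t x v (F x X Y w) = (0 :: real)"
proof -
  have "dd (\<lambda>y. dd (\<lambda>y. t y v w) y Y) x X =
     t x (B x X (B x Y v)) w + t x (B x Y v) (B x X w) + t x (dB x X Y v) w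
     + (t x (B x X v) (B x Y w) + t x v (B x X (B x Y w)) + t x v (dB x X Y w))" for X Y
  proof -
    note d = smooth_on_differentiable[OF smooth x]
    have 1: "dd (\<lambda>y. t y (B y Y v) w) x X = t x (B x X (B x Y v)) w + t x (B x Y v) (B x X w) + t x (dB x X Y v) w"
      "(\<lambda>y. t y (B y Y v) w) differentiable (at x)"
      using dd_apply[OF open_S x lin(1) d differentiable_B[OF x]] by (simp_all add: par[OF x])
    have 2: "dd (\<lambda>y. t y v (B y Y w)) x X = t x (B x X v) (B x Y w) + t x v (B x X (B x Y w)) + t x v (dB x X Y w)"
      "(\<lambda>y. t y v (B y Y w)) differentiable (at x)"
      using dd_apply[OF open_S x lin(2) d differentiable_B[OF x]] by (simp_all add: par[OF x])
    have "dd (\<lambda>y. dd (\<lambda>y. t y v w) y Y) x X = dd (\<lambda>y. t y (B y Y v) w + t y v (B y Y w)) x X"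
      by (rule dd_cong[OF open_S x]) (rule par)
    then show ?thesis by (simp add: dd_add 1 2)
  qed
  from this[of X Y] this[of Y X]
  show ?thesis
    using second_derivative_symmetric[OF smooth open_S x, of v w X Y]
    by (simp add: F_def linear_add[OF lin(1)[OF x]] linear_diff[OF lin(1)[OF x]] linear_add[OF lin(2)[OF x]] linear_diff[OF lin(2)[OF x]])
qed

lemma F_skew: assumes x: "x \<in> S" shows "g x (F x X Y Z) W = - g x Z (F x X Y W)"
proof -
  have "g x (F x X Y Z) W + g x Z (F x X Y W) = 0"
    by (rule curvature_annihilates_2[OF x]) (rule smooth_g linear_g parallel_g, assumption?)+
  then show ?thesis by simp
qed

lemma F_J: assumes x: "x \<in> S" shows "F x X Y (J x Z) = J x (F x X Y Z)"
proof (rule g_nondegenerate[OF x])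
  fix W
  have "\<kappa> x [F x X Y Z, W] + \<kappa> x [Z, F x X Y W] = 0"
    by (rule curvature_annihilates_2[OF x, of "\<lambda>y v w. \<kappa> y [v, w]"]) (rule smooth_kappa linear_kappa parallel_kappa, assumption?)+
  then show "g x (F x X Y (J x Z)) W = g x (J x (F x X Y Z)) W"
    unfolding kappa_g[OF x] using F_skew[OF x, of X Y "J x Z" W] by simp
qed

lemma DA_skew: assumes x: "x \<in> S" shows "g x (DA x W X Y) Z = - g x Y (DA x W X Z)"
proof -
  have "dd (\<lambda>y. g y (A y X Y) Z) x W = dd (\<lambda>y. - g y Y (A y X Z)) x W"
    by (rule dd_cong[OF open_S x]) (rule A_skew)
  moreover have "dd (\<lambda>y. g y (A y X Y) Z) x W = g x (B x W (A x X Y)) Z + g x (A x X Y) (B x W Z) + g x (dA x W X Y) Z"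
    using dd_apply(1)[OF open_S x linear_g(2) differentiable_g[OF x] differentiable_A[OF x]] by (simp add: parallel_g[OF x])
  moreover have "dd (\<lambda>y. g y Y (A y X Z)) x W = g x (B x W Y) (A x X Z) + g x Y (B x W (A x X Z)) + g x Y (dA x W X Z)"
    "(\<lambda>y. g y Y (A y X Z)) differentiable (at x)"
    using dd_apply[OF open_S x linear_g(1) differentiable_g[OF x] differentiable_A[OF x]] by (simp_all add: parallel_g[OF x])
  ultimately show ?thesis
    using A_skew[OF x, of X "B x W Y" Z] A_skew[OF x, of "B x W X" Y Z] A_skew[OF x, of X Y "B x W Z"]
    by (simp add: DA_def g_lin[OF x] dd_minus)
qed

lemma DA_J_right: assumes x: "x \<in> S" shows "DA x W X (J x Y) = - J x (DA x W X Y)"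
proof -
  have "dd (\<lambda>y. A y X (J y Y)) x W = dd (\<lambda>y. - J y (A y X Y)) x W"
    by (rule dd_cong[OF open_S x]) (rule A_J_right)
  moreover have "dd (\<lambda>y. A y X (J y Y)) x W = dA x W X (J x Y) + A x X (dJ x W Y)"
    using dd_apply(1)[OF open_S x linear_A(2) differentiable_A[OF x] differentiable_J[OF x]] by simp
  moreover have "dd (\<lambda>y. J y (A y X Y)) x W = dJ x W (A x X Y) + J x (dA x W X Y)" "(\<lambda>y. J y (A y X Y)) differentiable (at x)"
    using dd_apply[OF open_S x linear_J differentiable_J[OF x] differentiable_A[OF x]] by simp_all
  ultimately show ?thesis
    by (simp add: DA_def dd_minus parallel_J[OF x] J_lin[OF x] A_J_right[OF x] linear_diff[OF linear_A(2)[OF x]]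
        linear_neg[OF linear_B(2)[OF x]] algebra_simps)
qed

lemma DA_J_left: assumes x: "x \<in> S" shows "DA x W (J x X) Y = - J x (DA x W X Y)"
proof -
  have "dd (\<lambda>y. A y (J y X) Y) x W = dd (\<lambda>y. - J y (A y X Y)) x W"
    by (rule dd_cong[OF open_S x]) (rule A_J_left)
  moreover have "dd (\<lambda>y. A y (J y X) Y) x W = dA x W (J x X) Y + A x (dJ x W X) Y"
    using dd_apply(1)[OF open_S x linear_A(1) differentiable_A[OF x] differentiable_J[OF x]] by simp
  moreover have "dd (\<lambda>y. J y (A y X Y)) x W = dJ x W (A x X Y) + J x (dA x W X Y)" "(\<lambda>y. J y (A y X Y)) differentiable (at x)"
    using dd_apply[OF open_S x linear_J differentiable_J[OF x] differentiable_A[OF x]] by simp_all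
  ultimately show ?thesis
    by (simp add: DA_def dd_minus parallel_J[OF x] J_lin[OF x] A_J_left[OF x] linear_diff[OF linear_A(1)[OF x]]
        linear_neg[OF linear_B(2)[OF x]] algebra_simps)
qed

lemma riemann_R:
  assumes x: "x \<in> S" shows "riemann metric_matrix l k i j x = R x (axis i 1) (axis j 1) (axis k 1) $ l"
proof -
  have Gc: "Gam y (axis i 1) (axis j 1) $ k = christoffel metric_matrix k i j y" for y i j k
  proof -
    have "Gam y (axis i 1) (axis j 1) $ k =
        (\<Sum>i'\<in>UNIV. if i' = i then (\<Sum>j'\<in>UNIV. if j' = j then christoffel metric_matrix k i' j' y else 0) else 0)"
      unfolding Gam_def vec_lambda_beta by (intro sum.cong refl) (auto simp: axis_def mult_delta_left)
    then show ?thesis by simp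
  qed
  have "pd i (christoffel metric_matrix l j k) x = dGam x (axis i 1) (axis j 1) (axis k 1) $ l" for i j
  proof -
    have "((\<lambda>y. Gam y (axis j 1) (axis k 1) $ l) has_derivative (\<lambda>h. dGam x h (axis j 1) (axis k 1) $ l)) (at x)"
      using differentiable_Gam[OF x] by (intro bounded_linear.has_derivative[OF bounded_linear_vec_nth])
        (simp add: frechet_derivative_works)
    then show ?thesis unfolding pd_def Gc by (rule frechet_eqI)
  qed
  moreover have "Gam x (axis i 1) (Gam x (axis j 1) (axis k 1)) $ l =
      (\<Sum>m\<in>UNIV. christoffel metric_matrix l i m x * christoffel metric_matrix m j k x)" for i j
    by (subst linear_axis_expansion[OF linear_Gam(2)]) (simp add: Gc mult.commute)
  ultimately show ?thesis by (simp add: riemann_def R_def sum_subtractf)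
qed

text \<open>Both the trace defining the Ricci tensor and the contraction with the inverse metric are written in the frame at \<open>x\<close>.\<close>

lemma scalar_curvature_R:
  assumes x: "x \<in> S"
  shows "scalar_curvature metric_matrix x = (\<Sum>a\<in>UNIV. \<Sum>b\<in>UNIV. g x (R x (E x b) (E x a) (E x a)) (E x b))"
proof -
  have ric: "ricci metric_matrix j k x = (\<Sum>b\<in>UNIV. g x (R x (E x b) (axis j 1) (axis k 1)) (E x b))" for j k
    unfolding ricci_def riemann_R[OF x]
    using su3_point.trace_basis_change[OF point[OF x] linear_R(1)[OF x]] by (simp add: g_eq[OF x])
  have "linear (\<lambda>Y. \<Sum>b\<in>UNIV. g x (R x (E x b) Y Z) (E x b))" "linear (\<lambda>Z. \<Sum>b\<in>UNIV. g x (R x (E x b) Y Z) (E x b))" for Y Z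
    by (auto intro!: linearI simp: g_lin[OF x] linear_add[OF linear_R(2)[OF x]] linear_add[OF linear_R(3)[OF x]]
       linear_scale[OF linear_R(2)[OF x]] linear_scale[OF linear_R(3)[OF x]] sum.distrib sum_distrib_left)
  from su3_point.metric_contraction[OF point[OF x] this]
  show ?thesis unfolding scalar_curvature_def ric by (simp add: g_eq[OF x] metric_matrix_def)
qed

end

context gcy_chart
begin

text \<open>The argument of \<open>curvature_annihilates_2\<close>, for three slots.\<close>

lemma F_annihilates_Omega:
  assumes x: "x \<in> S"
  shows "\<Omega> x [F x X Y a, b, c] + \<Omega> x [a, F x X Y b, c] + \<Omega> x [a, b, F x X Y c] = 0"
proof -
  have "dd (\<lambda>y. dd (\<lambda>y. \<Omega> y [a, b, c]) y Y) x X =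
     \<Omega> x [B x X (B x Y a), b, c] + \<Omega> x [B x Y a, B x X b, c] + \<Omega> x [B x Y a, b, B x X c] + \<Omega> x [dB x X Y a, b, c]
   + (\<Omega> x [B x X a, B x Y b, c] + \<Omega> x [a, B x X (B x Y b), c] + \<Omega> x [a, B x Y b, B x X c] + \<Omega> x [a, dB x X Y b, c])
   + (\<Omega> x [B x X a, b, B x Y c] + \<Omega> x [a, B x X b, B x Y c] + \<Omega> x [a, b, B x X (B x Y c)] + \<Omega> x [a, b, dB x X Y c])" for X Y
  proof -
    note d = differentiable_Omega[OF x]
    have 1: "dd (\<lambda>y. \<Omega> y [B y Y a, b, c]) x X = \<Omega> x [B x X (B x Y a), b, c] + \<Omega> x [B x Y a, B x X b, c] + \<Omega> x [B x Y a, b, B x X c] + \<Omega> x [dB x X Y a, b, c]"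
      "(\<lambda>y. \<Omega> y [B y Y a, b, c]) differentiable (at x)"
      using dd_apply[OF open_S x linear_Omega(1) d differentiable_B[OF x]] by (simp_all add: parallel_Omega[OF x])
    have 2: "dd (\<lambda>y. \<Omega> y [a, B y Y b, c]) x X = \<Omega> x [B x X a, B x Y b, c] + \<Omega> x [a, B x X (B x Y b), c] + \<Omega> x [a, B x Y b, B x X c] + \<Omega> x [a, dB x X Y b, c]"
      "(\<lambda>y. \<Omega> y [a, B y Y b, c]) differentiable (at x)"
      using dd_apply[OF open_S x linear_Omega(2) d differentiable_B[OF x]] by (simp_all add: parallel_Omega[OF x])
    have 3: "dd (\<lambda>y. \<Omega> y [a, b, B y Y c]) x X = \<Omega> x [B x X a, b, B x Y c] + \<Omega> x [a, B x X b, B x Y c] + \<Omega> x [a, b, B x X (B x Y c)] + \<Omega> x [a, b, dB x X Y c]"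
      "(\<lambda>y. \<Omega> y [a, b, B y Y c]) differentiable (at x)"
      using dd_apply[OF open_S x linear_Omega(3) d differentiable_B[OF x]] by (simp_all add: parallel_Omega[OF x])
    have "dd (\<lambda>y. dd (\<lambda>y. \<Omega> y [a, b, c]) y Y) x X = dd (\<lambda>y. \<Omega> y [B y Y a, b, c] + \<Omega> y [a, B y Y b, c] + \<Omega> y [a, b, B y Y c]) x X"
      by (rule dd_cong[OF open_S x]) (rule parallel_Omega)
    also have "\<dots> = dd (\<lambda>y. \<Omega> y [B y Y a, b, c]) x X + dd (\<lambda>y. \<Omega> y [a, B y Y b, c]) x X + dd (\<lambda>y. \<Omega> y [a, b, B y Y c]) x X"
      using dd_add[OF differentiable_add[OF 1(2) 2(2)] 3(2)] dd_add[OF 1(2) 2(2)] by simp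
    finally show ?thesis unfolding 1 2 3 .
  qed
  from this[of X Y] this[of Y X]
  show ?thesis
    using second_derivative_symmetric[OF smooth_Omega open_S x, of "[a, b, c]" X Y]
    by (simp add: F_def Omega_lin[OF x])
qed

theorem scalar_curvature_eq:
  assumes x: "x \<in> S"
  shows "scalar_curvature metric_matrix x = - (\<Sum>a\<in>UNIV. \<Sum>b\<in>UNIV. \<Sum>c\<in>UNIV. (g x (A x (E x a) (E x b)) (E x c))\<^sup>2)"
  unfolding scalar_curvature_R[OF x]
proof (rule su3_point.scalar_curvature_algebra[OF point[OF x], where A = "A x" and R = "R x" and F = "F x" and DA = "DA x", unfolded g_eq[OF x] J_eq[OF x]])
  show "(\<Sum>b\<in>UNIV. g x (F x X Y (E x b)) (J x (E x b))) = 0" for X Y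
    using su3_point.Omega_annihilator_trace[OF point[OF x] F_annihilates_Omega[OF x]] by (simp add: g_eq[OF x] J_eq[OF x])
  show "F x X Y Z = - F x Y X Z" for X Y Z by (simp add: F_def)
qed (fact linear_A[OF x] linear_DA[OF x] linear_F[OF x] R_decomposition[OF x] R_first_bianchi[OF x] F_J[OF x]
    A_skew[OF x] A_J_left[OF x] A_J_right[OF x] A_cyclic[OF x] DA_skew[OF x] DA_J_left[OF x] DA_J_right[OF x])+

end

section \<open>Torsion forms\<close>

context su3_point
begin

lemma kappa_E: "\<kappa> [E 1, E 2] = 1" "\<kappa> [E 3, E 4] = 1" "\<kappa> [E 5, E 6] = 1"
  "\<kappa> [E 1, E 3] = 0" "\<kappa> [E 1, E 4] = 0" "\<kappa> [E 1, E 5] = 0" "\<kappa> [E 1, E 6] = 0" "\<kappa> [E 2, E 3] = 0" "\<kappa> [E 2, E 4] = 0"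
  "\<kappa> [E 2, E 5] = 0" "\<kappa> [E 2, E 6] = 0" "\<kappa> [E 3, E 5] = 0" "\<kappa> [E 3, E 6] = 0" "\<kappa> [E 4, E 5] = 0" "\<kappa> [E 4, E 6] = 0"
  by (simp_all add: kappa_eq)

lemma alternating_kappa: "alternating_form 2 \<kappa>"
proof -
  have "\<kappa> = (\<lambda>vs. case vs of [a, b] \<Rightarrow> \<kappa> [a, b] | _ \<Rightarrow> 0)"
    using degree_kappa by (auto simp: fun_eq_iff degree_form_def split: list.split)
  moreover have "alternating_form 2 (\<lambda>vs. case vs of [a, b] \<Rightarrow> \<kappa> [a, b] | _ \<Rightarrow> 0)"
    by (rule alternating_form_2I) (rule linear_kappa, rule linear_kappa, simp add: kappa_eq)
  ultimately show ?thesis by simp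
qed

lemma degree_kappa_kappa: "degree_form 4 (\<kappa> \<^bold>\<and> \<kappa>)"
  using degree_form_wedge[OF degree_kappa degree_kappa] by simp

lemma wedge_kappa_kappa_frame:
  assumes "degree_form 2 \<psi>"
  shows "(\<psi> \<^bold>\<and> \<kappa> \<^bold>\<and> \<kappa>) [E 1, E 2, E 3, E 4, E 5, E 6] = 2 * (\<psi> [E 1, E 2] + \<psi> [E 3, E 4] + \<psi> [E 5, E 6])"
  by (simp add: wedge_2_4[OF assms degree_kappa_kappa] wedge_2_2[OF degree_kappa degree_kappa] kappa_E)

text \<open>In components: invariance under \<open>J\<close> identifies the entries off the diagonal blocks in pairs, and the wedge product with \<open>\<kappa>\<^sup>2\<close> is the
  trace of the three diagonal blocks.\<close>

lemma Lambda2_8_frame: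
  assumes J: "su3_J \<kappa> \<Omega> = J" and \<psi>: "\<psi> \<in> Lambda2_8 \<kappa> \<Omega>"
  shows "alternating_form 2 \<psi>" "\<psi> [E 1, E 2] + \<psi> [E 3, E 4] + \<psi> [E 5, E 6] = 0"
    "\<psi> [E 2, E 4] = \<psi> [E 1, E 3]" "\<psi> [E 2, E 3] = - \<psi> [E 1, E 4]" "\<psi> [E 2, E 6] = \<psi> [E 1, E 5]" "\<psi> [E 2, E 5] = - \<psi> [E 1, E 6]"
    "\<psi> [E 4, E 6] = \<psi> [E 3, E 5]" "\<psi> [E 4, E 5] = - \<psi> [E 3, E 6]"
proof -
  show alt: "alternating_form 2 \<psi>" using \<psi> by (simp add: Lambda2_8_def)
  have "(\<psi> \<^bold>\<and> \<kappa> \<^bold>\<and> \<kappa>) [E 1, E 2, E 3, E 4, E 5, E 6] = 0" using \<psi> by (simp add: Lambda2_8_def)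
  then show "\<psi> [E 1, E 2] + \<psi> [E 3, E 4] + \<psi> [E 5, E 6] = 0"
    by (simp add: wedge_kappa_kappa_frame[OF alternating_degree[OF alt]])
  have "\<psi> [J X, J Y] = \<psi> [X, Y]" for X Y
  proof -
    have "endo_act J \<psi> = \<psi>" using \<psi> by (simp add: Lambda2_8_def J)
    from fun_cong[OF this, of "[X, Y]"] show ?thesis by (simp add: endo_act_def)
  qed
  from this[of "E 1" "E 3"] this[of "E 1" "E 4"] this[of "E 1" "E 5"] this[of "E 1" "E 6"] this[of "E 3" "E 5"] this[of "E 3" "E 6"]
  show "\<psi> [E 2, E 4] = \<psi> [E 1, E 3]" "\<psi> [E 2, E 3] = - \<psi> [E 1, E 4]" "\<psi> [E 2, E 6] = \<psi> [E 1, E 5]" "\<psi> [E 2, E 5] = - \<psi> [E 1, E 6]"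
    "\<psi> [E 4, E 6] = \<psi> [E 3, E 5]" "\<psi> [E 4, E 5] = - \<psi> [E 3, E 6]"
    using linear_neg[OF alternating_form_linear[OF alt, of "[v]" "[]" for v]] by (simp_all add: J_E)
qed

text \<open>A 4-form splits in at most one way into a multiple of \<open>\<kappa>\<^sup>2\<close>, a part \<open>\<pi> \<and> \<Omega>\<close> and a part from \<open>\<Lambda>\<^sup>2\<^sub>8\<close>. The diagonal components determine the
  multiple of \<open>\<kappa>\<^sup>2\<close>. The others come in pairs exchanged by \<open>J\<close>, in which \<open>\<psi> \<and> \<kappa>\<close> and \<open>\<pi> \<and> \<Omega>\<close> enter with opposite relative
  signs.\<close>

lemma four_form_decomposition_unique:
  assumes J: "su3_J \<kappa> \<Omega> = J" and \<psi>: "\<psi> \<in> Lambda2_8 \<kappa> \<Omega>" and \<psi>': "\<psi>' \<in> Lambda2_8 \<kappa> \<Omega>" and \<pi>: "alternating_form 1 \<pi>"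
    and eq: "\<And>vs. p * (\<kappa> \<^bold>\<and> \<kappa>) vs + (\<pi> \<^bold>\<and> \<Omega>) vs - (\<psi> \<^bold>\<and> \<kappa>) vs = - (\<psi>' \<^bold>\<and> \<kappa>) vs"
  shows "p = 0" "\<pi> = (\<lambda>_. 0)" "\<psi> = \<psi>'"
proof -
  note f = Lambda2_8_frame[OF J \<psi>] and f' = Lambda2_8_frame[OF J \<psi>']
  note d = alternating_degree[OF f(1)] alternating_degree[OF f'(1)] alternating_degree[OF \<pi>, unfolded One_nat_def]
  have e: "p * (\<kappa> \<^bold>\<and> \<kappa>) [a,b,c,d] + (\<pi> [a]*\<Omega> [b,c,d] - \<pi> [b]*\<Omega> [a,c,d] + \<pi> [c]*\<Omega> [a,b,d] - \<pi> [d]*\<Omega> [a,b,c])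
     - (\<psi> [a,b]*\<kappa> [c,d] - \<psi> [a,c]*\<kappa> [b,d] + \<psi> [a,d]*\<kappa> [b,c] + \<psi> [b,c]*\<kappa> [a,d] - \<psi> [b,d]*\<kappa> [a,c] + \<psi> [c,d]*\<kappa> [a,b])
     = - (\<psi>' [a,b]*\<kappa> [c,d] - \<psi>' [a,c]*\<kappa> [b,d] + \<psi>' [a,d]*\<kappa> [b,c] + \<psi>' [b,c]*\<kappa> [a,d] - \<psi>' [b,d]*\<kappa> [a,c] + \<psi>' [c,d]*\<kappa> [a,b])" for a b c d
    using eq[of "[a,b,c,d]"] unfolding wedge_1_3[OF d(3) degree_Omega] wedge_2_2[OF d(1) degree_kappa] wedge_2_2[OF d(2) degree_kappa] .
  note s = kappa_E Omega_eq wedge_2_2[OF degree_kappa degree_kappa]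
  have 1: "2 * p - \<psi> [E 1, E 2] - \<psi> [E 3, E 4] = - \<psi>' [E 1, E 2] - \<psi>' [E 3, E 4]"
    "2 * p - \<psi> [E 1, E 2] - \<psi> [E 5, E 6] = - \<psi>' [E 1, E 2] - \<psi>' [E 5, E 6]"
    "2 * p - \<psi> [E 3, E 4] - \<psi> [E 5, E 6] = - \<psi>' [E 3, E 4] - \<psi>' [E 5, E 6]"
    using e[of "E 1" "E 2" "E 3" "E 4"] e[of "E 1" "E 2" "E 5" "E 6"] e[of "E 3" "E 4" "E 5" "E 6"] by (simp_all add: s)
  show p: "p = 0" using 1 f(2) f'(2) by linarith
  have 2: "\<psi> [E 1, E 2] = \<psi>' [E 1, E 2]" "\<psi> [E 3, E 4] = \<psi>' [E 3, E 4]" "\<psi> [E 5, E 6] = \<psi>' [E 5, E 6]"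
    using 1 p f(2) f'(2) by linarith+
  have 3: "\<pi> [E 6] = 0 \<and> \<psi> [E 1, E 3] = \<psi>' [E 1, E 3]" "\<pi> [E 5] = 0 \<and> \<psi> [E 1, E 4] = \<psi>' [E 1, E 4]"
    using e[of "E 1" "E 3" "E 5" "E 6"] e[of "E 2" "E 4" "E 5" "E 6"] e[of "E 1" "E 4" "E 5" "E 6"] e[of "E 2" "E 3" "E 5" "E 6"] f f'
    by (simp_all add: s)
  have 4: "\<pi> [E 4] = 0 \<and> \<psi> [E 1, E 5] = \<psi>' [E 1, E 5]" "\<pi> [E 3] = 0 \<and> \<psi> [E 1, E 6] = \<psi>' [E 1, E 6]"
    using e[of "E 1" "E 3" "E 4" "E 5"] e[of "E 2" "E 3" "E 4" "E 6"] e[of "E 1" "E 3" "E 4" "E 6"] e[of "E 2" "E 3" "E 4" "E 5"] f f'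
    by (simp_all add: s)
  have 5: "\<pi> [E 2] = 0 \<and> \<psi> [E 3, E 5] = \<psi>' [E 3, E 5]" "\<pi> [E 1] = 0 \<and> \<psi> [E 3, E 6] = \<psi>' [E 3, E 6]"
    using e[of "E 1" "E 2" "E 3" "E 5"] e[of "E 1" "E 2" "E 4" "E 6"] e[of "E 1" "E 2" "E 3" "E 6"] e[of "E 1" "E 2" "E 4" "E 5"] f f'
    by (simp_all add: s)
  show "\<pi> = (\<lambda>_. 0)"
    by (rule alternating_form_eq_0[OF \<pi> distinct_frame span_frame])
      (use 3 4 5 in \<open>auto simp: Let_def simp del: in_set_subseqs\<close>)
  have "(\<lambda>vs. \<psi> vs + - \<psi>' vs) = (\<lambda>_. 0)"
    by (rule alternating_form_eq_0[OF alternating_form_add[OF f(1) alternating_form_minus[OF f'(1)]] distinct_frame span_frame])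
      (use 2 3 4 5 f f' in \<open>auto simp: Let_def simp del: in_set_subseqs\<close>)
  then show "\<psi> = \<psi>'" by (auto simp: fun_eq_iff add_eq_0_iff)
qed

lemma bilinear_eq_0_on_frame:
  fixes b :: "real ^ 6 \<Rightarrow> real ^ 6 \<Rightarrow> real ^ 6"
  assumes l: "\<And>w. linear (\<lambda>v. b v w)" "\<And>v. linear (b v)" and z: "\<And>i j. b (E i) (E j) = 0"
  shows "b X Y = 0"
proof -
  have "b (E i) Y = 0" for i
    by (subst frame_expansion[of Y]) (simp add: linear_sum[OF l(2)] linear_scale[OF l(2)] z)
  then show ?thesis
    by (subst frame_expansion[of X]) (simp add: linear_sum[OF l(1)] linear_scale[OF l(1)])
qed

text \<open>Once \<open>d\<Omega>\<close> and \<open>d(J\<Omega>)\<close> have been decomposed, \<open>d\<kappa> = 0\<close> reads \<open>\<nu>\<^sub>1 \<and> \<kappa> + \<nu>\<^sub>3 = 0\<close>, and \<open>\<nu>\<^sub>3 \<and> \<kappa> = 0\<close> forces \<open>\<nu>\<^sub>1 \<and> \<kappa>\<^sup>2 = 0\<close>, hence \<open>\<nu>\<^sub>1 = 0\<close>.\<close>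

lemma torsion_unique:
  assumes J: "su3_J \<kappa> \<Omega> = J" and \<psi>: "\<psi> \<in> Lambda2_8 \<kappa> \<Omega>" and \<psi>': "\<psi>' \<in> Lambda2_8 \<kappa> \<Omega>"
  shows "is_torsion \<kappa> \<Omega> (\<lambda>_. 0) (\<lambda>vs. - (\<psi> \<^bold>\<and> \<kappa>) vs) (\<lambda>vs. - (\<psi>' \<^bold>\<and> \<kappa>) vs) t \<longleftrightarrow>
    t = \<lparr>pi0 = 0, sigma0 = 0, pi1 = (\<lambda>_. 0), nu1 = (\<lambda>_. 0), pi2 = \<psi>, sigma2 = \<psi>', nu3 = (\<lambda>_. 0)\<rparr>"
    (is "?T t \<longleftrightarrow> t = ?t")
proof
  have w0: "((\<lambda>_. 0) \<^bold>\<and> \<beta>) = (\<lambda>_. 0)" for \<beta> :: "(real ^ 6, real) form" by (simp add: wedge_def fun_eq_iff)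
  have a0: "alternating_form k (\<lambda>_. 0 :: real)" for k :: nat by (simp add: alternating_form_def linear_zero)
  show "?T t" if "t = ?t"
    using \<psi> \<psi>' by (simp add: that is_torsion_def w0 a0 Lambda3_12_def endo_act_def)
  assume t: "?T t"
  have pi: "pi0 t = 0" "pi1 t = (\<lambda>_. 0)" "pi2 t = \<psi>"
    using t four_form_decomposition_unique[OF J _ \<psi>, of "pi2 t" "pi1 t" "pi0 t"] unfolding is_torsion_def fun_eq_iff by auto
  have "endo_act (su3_J \<kappa> \<Omega>) (pi1 t) = (\<lambda>_. 0)" by (simp add: pi endo_act_def)
  then have "alternating_form 1 (endo_act (su3_J \<kappa> \<Omega>) (pi1 t))" by (simp add: a0)
  then have sigma: "sigma0 t = 0" "sigma2 t = \<psi>'"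
    using t four_form_decomposition_unique[OF J _ \<psi>', of "sigma2 t" "endo_act (su3_J \<kappa> \<Omega>) (pi1 t)" "sigma0 t"]
    unfolding is_torsion_def fun_eq_iff by auto
  have dk: "(\<lambda>_. 0) = (\<lambda>vs. - (3/2) * sigma0 t * \<Omega> vs + (3/2) * pi0 t * J_Omega \<kappa> \<Omega> vs + (nu1 t \<^bold>\<and> \<kappa>) vs + nu3 t vs)"
    using t unfolding is_torsion_def by (elim conjE)
  have nu: "nu3 t vs = - (nu1 t \<^bold>\<and> \<kappa>) vs" for vs
    using fun_cong[OF dk, of vs] by (simp add: pi sigma)
  have alt: "alternating_form 1 (nu1 t)" "alternating_form 3 (nu3 t)" using t by (simp_all add: is_torsion_def Lambda3_12_def)
  have prim: "(nu3 t \<^bold>\<and> \<kappa>) vs = 0" for vs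
  proof -
    have "nu3 t \<^bold>\<and> \<kappa> = (\<lambda>_. 0)" using t unfolding is_torsion_def Lambda3_12_def by blast
    then show ?thesis by (simp only:)
  qed
  note s = wedge_3_2[OF alternating_degree[OF alt(2)] degree_kappa] nu wedge_1_2[OF alternating_degree[OF alt(1), unfolded One_nat_def] degree_kappa] kappa_E
  have "nu1 t [E 1] = 0" "nu1 t [E 2] = 0" "nu1 t [E 3] = 0" "nu1 t [E 4] = 0" "nu1 t [E 5] = 0" "nu1 t [E 6] = 0"
    using prim[of "[E 1, E 3, E 4, E 5, E 6]"] prim[of "[E 2, E 3, E 4, E 5, E 6]"] prim[of "[E 1, E 2, E 3, E 5, E 6]"]
      prim[of "[E 1, E 2, E 4, E 5, E 6]"] prim[of "[E 1, E 2, E 3, E 4, E 5]"] prim[of "[E 1, E 2, E 3, E 4, E 6]"]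
    by (simp_all add: s)
  then have nu1: "nu1 t = (\<lambda>_. 0)"
    by (intro alternating_form_eq_0[OF alt(1) distinct_frame span_frame]) (auto simp: Let_def simp del: in_set_subseqs)
  then have "nu3 t = (\<lambda>_. 0)" by (intro ext) (simp add: nu w0)
  then show "t = ?t" using pi sigma nu1 by (cases t) simp
qed

end

text \<open>A tensor with the symmetries of the torsion \<open>T\<close> of \<open>B\<close>. They also hold for \<open>- J T\<close>, which takes the place of \<open>T\<close> in \<open>d(J\<Omega>)\<close>. By \<open>J\<close> the
  tensor is determined by its values on the three pairs of the vectors \<open>E\<^sub>1, E\<^sub>3, E\<^sub>5\<close>.\<close>

locale su3_torsion_tensor = su3_point +
  fixes \<tau> :: "real ^ 6 \<Rightarrow> real ^ 6 \<Rightarrow> real ^ 6"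
  assumes lin: "\<And>Y. linear (\<lambda>X. \<tau> X Y)" "\<And>X. linear (\<tau> X)"
    and skew: "\<And>X Y. \<tau> X Y = - \<tau> Y X" and J_left: "\<And>X Y. \<tau> (J X) Y = - J (\<tau> X Y)"
    and cyclic: "\<And>X Y Z. g (\<tau> X Y) Z + g (\<tau> Y Z) X + g (\<tau> Z X) Y = 0"
begin

lemma J_right: "\<tau> X (J Y) = - J (\<tau> X Y)"
  using skew[of X "J Y"] skew[of X Y] by (simp add: J_left)

lemma alt: "\<tau> X X = 0"
  using skew[of X X] by (simp add: vec_eq_iff)

text \<open>The insertion of \<open>\<tau>\<close> into \<open>\<Omega>\<close>, antisymmetrised: the torsion term in the exterior derivative of \<open>\<Omega>\<close>.\<close>

definition W :: "real ^ 6 \<Rightarrow> real ^ 6 \<Rightarrow> real ^ 6 \<Rightarrow> real ^ 6 \<Rightarrow> real" where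
  "W a b c d = \<Omega> [\<tau> a b, c, d] - \<Omega> [\<tau> a c, b, d] + \<Omega> [\<tau> a d, b, c] + \<Omega> [\<tau> b c, a, d] - \<Omega> [\<tau> b d, a, c] + \<Omega> [\<tau> c d, a, b]"

text \<open>Minus the contraction of \<open>W\<close> with \<open>\<kappa>\<close>, that is \<open>- \<Sum> W(E\<^sub>i, J E\<^sub>i, X, Y)\<close> over \<open>i = 1, 3, 5\<close>, with the symmetries of \<open>\<tau>\<close> used
  to merge equal terms. The same contraction applied to \<open>\<psi> \<and> \<kappa>\<close> with \<open>\<psi>\<close> in
  \<open>\<Lambda>\<^sup>2\<^sub>8\<close> returns \<open>\<psi>\<close>, so no other 2-form could satisfy \<open>W_eq_phi_kappa\<close>.\<close>

definition \<phi> :: "(real ^ 6, real) form" where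
  "\<phi> = (\<lambda>vs. case vs of [X, Y] \<Rightarrow>
      2 * (\<Omega> [\<tau> (E 1) X, E 2, Y] - \<Omega> [\<tau> (E 1) Y, E 2, X] + \<Omega> [\<tau> (E 3) X, E 4, Y] - \<Omega> [\<tau> (E 3) Y, E 4, X]
         + \<Omega> [\<tau> (E 5) X, E 6, Y] - \<Omega> [\<tau> (E 5) Y, E 6, X]) | _ \<Rightarrow> 0)"

lemmas tau_lin = linear_add[OF lin(1)] linear_add[OF lin(2)] linear_scale[OF lin(1)] linear_scale[OF lin(2)]
   linear_neg[OF lin(1)] linear_neg[OF lin(2)]
lemmas Omega_lin = linear_add[OF linear_Omega(1)] linear_add[OF linear_Omega(2)] linear_add[OF linear_Omega(3)]
   linear_scale[OF linear_Omega(1)] linear_scale[OF linear_Omega(2)] linear_scale[OF linear_Omega(3)]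
   linear_neg[OF linear_Omega(1)] linear_neg[OF linear_Omega(2)] linear_neg[OF linear_Omega(3)]

lemma alternating_phi: "alternating_form 2 \<phi>"
  unfolding \<phi>_def by (rule alternating_form_2I) (auto intro!: linearI simp: tau_lin Omega_lin algebra_simps)

lemma alternating_W: "alternating_form 4 (\<lambda>vs. case vs of [a, b, c, d] \<Rightarrow> W a b c d | _ \<Rightarrow> 0)"
  unfolding W_def
proof (rule alternating_form_4I)
  show "\<Omega> [\<tau> a a, b, c] - \<Omega> [\<tau> a b, a, c] + \<Omega> [\<tau> a c, a, b] + \<Omega> [\<tau> a b, a, c] - \<Omega> [\<tau> a c, a, b] + \<Omega> [\<tau> b c, a, a] = 0" for a b c
    by (simp add: alt Omega_alt linear_0[OF linear_Omega(1)])
  show "\<Omega> [\<tau> a b, b, c] - \<Omega> [\<tau> a b, b, c] + \<Omega> [\<tau> a c, b, b] + \<Omega> [\<tau> b b, a, c] - \<Omega> [\<tau> b c, a, b] + \<Omega> [\<tau> b c, a, b] = 0" for a b c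
    by (simp add: alt Omega_alt linear_0[OF linear_Omega(1)])
  show "\<Omega> [\<tau> a b, c, c] - \<Omega> [\<tau> a c, b, c] + \<Omega> [\<tau> a c, b, c] + \<Omega> [\<tau> b c, a, c] - \<Omega> [\<tau> b c, a, c] + \<Omega> [\<tau> c c, a, b] = 0" for a b c
    by (simp add: alt Omega_alt linear_0[OF linear_Omega(1)])
qed (auto intro!: linearI simp: tau_lin Omega_lin algebra_simps)

lemma tau_frame: "\<tau> (E 3) (E 1) = - \<tau> (E 1) (E 3)" "\<tau> (E 5) (E 3) = - \<tau> (E 3) (E 5)" "\<tau> (E 1) (E 5) = - \<tau> (E 5) (E 1)"
  by (rule skew)+

lemma cyclic_frame:
  "u (\<tau> (E 1) (E 3)) $ 5 = - u (\<tau> (E 3) (E 5)) $ 1 - u (\<tau> (E 5) (E 1)) $ 3"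
  "u (\<tau> (E 1) (E 3)) $ 6 = - u (\<tau> (E 3) (E 5)) $ 2 - u (\<tau> (E 5) (E 1)) $ 4"
proof -
  show "u (\<tau> (E 1) (E 3)) $ 5 = - u (\<tau> (E 3) (E 5)) $ 1 - u (\<tau> (E 5) (E 1)) $ 3"
    using cyclic[of "E 1" "E 3" "E 5"] by (simp add: g_E_right)
  show "u (\<tau> (E 1) (E 3)) $ 6 = - u (\<tau> (E 3) (E 5)) $ 2 - u (\<tau> (E 5) (E 1)) $ 4"
    using cyclic[of "E 1" "E 3" "E 6"] unfolding J_E(5)[symmetric]
    by (simp add: J_left J_right) (simp add: g_E_right J_E)
qed

lemmas frame_J = J_E(1,3,5)[symmetric]

lemma phi_eq: "\<phi> [X, Y] = 2 * (\<Omega> [\<tau> (E 1) X, E 2, Y] - \<Omega> [\<tau> (E 1) Y, E 2, X] + \<Omega> [\<tau> (E 3) X, E 4, Y] - \<Omega> [\<tau> (E 3) Y, E 4, X]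
         + \<Omega> [\<tau> (E 5) X, E 6, Y] - \<Omega> [\<tau> (E 5) Y, E 6, X])"
  by (simp add: \<phi>_def)

lemma phi_J: "\<phi> [J X, J Y] = \<phi> [X, Y]"
  unfolding phi_eq J_right by (simp add: Omega_lin Omega_J)

lemma degree_phi: "degree_form 2 \<phi>" by (rule alternating_degree[OF alternating_phi])

text \<open>A comparison of the 15 components. Anti-linearity reduces them to the values of \<open>\<tau>\<close> on pairs from \<open>E\<^sub>1, E\<^sub>3, E\<^sub>5\<close>, and
  the cyclic identity eliminates two of these, namely those in \<open>cyclic_frame\<close>.\<close>

lemma W_eq_phi_kappa: "(case vs of [a, b, c, d] \<Rightarrow> W a b c d | _ \<Rightarrow> 0) = - (\<phi> \<^bold>\<and> \<kappa>) vs"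
proof -
  define K where "K vs = (case vs of [a, b, c, d] \<Rightarrow> W a b c d | _ \<Rightarrow> 0) + (\<phi> \<^bold>\<and> \<kappa>) vs" for vs
  have "alternating_form (2 + 2) (\<phi> \<^bold>\<and> \<kappa>)" by (rule alternating_form_wedge[OF alternating_phi alternating_kappa])
  then have "alternating_form 4 K" unfolding K_def by (intro alternating_form_add alternating_W) simp
  then have "K = (\<lambda>_. 0)"
  proof (rule alternating_form_eq_0[OF _ distinct_frame span_frame])
    have K: "K [a, b, c, d] = W a b c d + (\<phi> [a,b]*\<kappa> [c,d] - \<phi> [a,c]*\<kappa> [b,d] + \<phi> [a,d]*\<kappa> [b,c] + \<phi> [b,c]*\<kappa> [a,d]
        - \<phi> [b,d]*\<kappa> [a,c] + \<phi> [c,d]*\<kappa> [a,b])" for a b c d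
      by (simp add: K_def wedge_2_2[OF degree_phi degree_kappa])
    fix xs assume "xs \<in> set (subseqs [E 1, E 2, E 3, E 4, E 5, E 6])" "length xs = 4"
    then show "K xs = 0"
      by (auto simp: Let_def K W_def phi_eq kappa_E simp del: in_set_subseqs)
        (simp_all add: frame_J J_left J_right alt tau_frame, simp_all add: Omega_eq Let_def cyclic_frame)
  qed
  then have "K vs = 0" by simp
  then show ?thesis unfolding K_def by linarith
qed

lemma phi_frame_trace: "\<phi> [E 1, E 2] + \<phi> [E 3, E 4] + \<phi> [E 5, E 6] = 0"
  unfolding phi_eq by (simp add: frame_J J_left J_right alt tau_frame, simp add: Omega_eq Let_def cyclic_frame)

lemma phi_Lambda2_8:
  assumes J: "su3_J \<kappa> \<Omega> = J"
  shows "\<phi> \<in> Lambda2_8 \<kappa> \<Omega>"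
proof -
  have "endo_act J \<phi> vs = \<phi> vs" for vs
  proof (cases "length vs = 2")
    case True
    then obtain X Y where "vs = [X, Y]" by (auto simp: numeral_2_eq_2 length_Suc_conv)
    then show ?thesis by (simp add: endo_act_def phi_J)
  next
    case False
    then show ?thesis using degree_phi by (simp add: endo_act_def degree_form_def)
  qed
  moreover have "(\<phi> \<^bold>\<and> \<kappa> \<^bold>\<and> \<kappa>) = (\<lambda>_. 0)"
  proof (rule alternating_form_eq_0[OF alternating_form_wedge[OF alternating_phi alternating_form_wedge[OF alternating_kappa alternating_kappa]]
        distinct_frame span_frame])
    fix xs assume "xs \<in> set (subseqs [E 1, E 2, E 3, E 4, E 5, E 6])" "length xs = 2 + (2 + 2)"
    then have "xs = [E 1, E 2, E 3, E 4, E 5, E 6]" by (auto simp: Let_def simp del: in_set_subseqs)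
    then show "(\<phi> \<^bold>\<and> \<kappa> \<^bold>\<and> \<kappa>) xs = 0" by (simp add: wedge_kappa_kappa_frame[OF degree_phi] phi_frame_trace)
  qed
  ultimately show ?thesis using alternating_phi by (auto simp: Lambda2_8_def J)
qed

text \<open>The form \<open>W\<close> for \<open>\<tau>\<close> alone loses half of the information; together with the form for \<open>J \<tau>\<close> it gives enough linear equations for all
  components of \<open>\<tau>\<close>.\<close>

lemma frame_eq_0:
  assumes W: "\<And>a b c d. W a b c d = 0"
    and WJ: "\<And>a b c d. \<Omega> [J (\<tau> a b), c, d] - \<Omega> [J (\<tau> a c), b, d] + \<Omega> [J (\<tau> a d), b, c]
      + \<Omega> [J (\<tau> b c), a, d] - \<Omega> [J (\<tau> b d), a, c] + \<Omega> [J (\<tau> c d), a, b] = 0"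
  shows "\<tau> (E 1) (E 3) = 0" "\<tau> (E 3) (E 5) = 0" "\<tau> (E 5) (E 1) = 0"
proof -
  note [simp] = J_left J_right alt tau_frame Omega_eq
  note ev = W[unfolded W_def] WJ
  have 1: "u (\<tau> (E 1) (E 3)) $ 5 = 0 \<and> u (\<tau> (E 1) (E 3)) $ 6 = 0"
    using ev(1)[of "E 1" "E 2" "E 3" "E 4", unfolded frame_J, simplified] ev(2)[of "E 1" "E 2" "E 3" "E 4", unfolded frame_J, simplified] by (intro conjI; linarith)
  have 2: "u (\<tau> (E 3) (E 5)) $ 1 = 0 \<and> u (\<tau> (E 3) (E 5)) $ 2 = 0"
    using ev(1)[of "E 3" "E 4" "E 5" "E 6", unfolded frame_J, simplified] ev(2)[of "E 3" "E 4" "E 5" "E 6", unfolded frame_J, simplified] by (intro conjI; linarith)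
  have 3: "u (\<tau> (E 5) (E 1)) $ 3 = 0 \<and> u (\<tau> (E 5) (E 1)) $ 4 = 0"
    using ev(1)[of "E 1" "E 2" "E 5" "E 6", unfolded frame_J, simplified] ev(2)[of "E 1" "E 2" "E 5" "E 6", unfolded frame_J, simplified] by (intro conjI; linarith)
  have 4: "u (\<tau> (E 5) (E 1)) $ 1 = 0 \<and> u (\<tau> (E 3) (E 5)) $ 3 = 0 \<and> u (\<tau> (E 5) (E 1)) $ 2 = 0 \<and> u (\<tau> (E 3) (E 5)) $ 4 = 0"
    using ev(1)[of "E 1" "E 3" "E 5" "E 6", unfolded frame_J, simplified] ev(2)[of "E 1" "E 3" "E 5" "E 6", unfolded frame_J, simplified] ev(1)[of "E 1" "E 4" "E 5" "E 6", unfolded frame_J, simplified] ev(2)[of "E 1" "E 4" "E 5" "E 6", unfolded frame_J, simplified]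
    by (intro conjI; linarith)
  have 5: "u (\<tau> (E 1) (E 3)) $ 1 = 0 \<and> u (\<tau> (E 3) (E 5)) $ 5 = 0 \<and> u (\<tau> (E 1) (E 3)) $ 2 = 0 \<and> u (\<tau> (E 3) (E 5)) $ 6 = 0"
    using ev(1)[of "E 1" "E 3" "E 4" "E 5", unfolded frame_J, simplified] ev(2)[of "E 1" "E 3" "E 4" "E 5", unfolded frame_J, simplified] ev(1)[of "E 1" "E 3" "E 4" "E 6", unfolded frame_J, simplified] ev(2)[of "E 1" "E 3" "E 4" "E 6", unfolded frame_J, simplified]
    by (intro conjI; linarith)
  have 6: "u (\<tau> (E 1) (E 3)) $ 3 = 0 \<and> u (\<tau> (E 5) (E 1)) $ 5 = 0 \<and> u (\<tau> (E 1) (E 3)) $ 4 = 0 \<and> u (\<tau> (E 5) (E 1)) $ 6 = 0"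
    using ev(1)[of "E 1" "E 2" "E 3" "E 5", unfolded frame_J, simplified] ev(2)[of "E 1" "E 2" "E 3" "E 5", unfolded frame_J, simplified] ev(1)[of "E 1" "E 2" "E 3" "E 6", unfolded frame_J, simplified] ev(2)[of "E 1" "E 2" "E 3" "E 6", unfolded frame_J, simplified]
    by (intro conjI; linarith)
  show "\<tau> (E 1) (E 3) = 0" "\<tau> (E 3) (E 5) = 0" "\<tau> (E 5) (E 1) = 0"
    unfolding eq_iff_u forall_6 using 1 2 3 4 5 6 by simp_all
qed

lemma eq_0_from_frame:
  assumes "\<tau> (E 1) (E 3) = 0" "\<tau> (E 3) (E 5) = 0" "\<tau> (E 5) (E 1) = 0"
  shows "\<tau> X Y = 0"
proof (rule bilinear_eq_0_on_frame[OF lin])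
  fix i j :: 6
  have "\<tau> (E i) (E j) = 0"
    using exhaust_6[of i] exhaust_6[of j]
    by (elim disjE; simp add: frame_J J_left J_right alt tau_frame assms)
  then show "\<tau> (E i) (E j) = 0" .
qed

end

context gcy_chart
begin

lemma linear_T: "x \<in> S \<Longrightarrow> linear (\<lambda>X. T x X Y)" "x \<in> S \<Longrightarrow> linear (T x X)"
  by (auto intro!: linearI simp: T_def linear_add[OF linear_A(1)] linear_add[OF linear_A(2)]
      linear_scale[OF linear_A(1)] linear_scale[OF linear_A(2)] algebra_simps)

lemma T_tensor: assumes x: "x \<in> S" shows "su3_torsion_tensor (\<kappa> x) (\<Omega> x) (coframe_at x) (T x)"
proof (intro su3_torsion_tensor.intro[OF point[OF x]] su3_torsion_tensor_axioms.intro, unfold J_eq[OF x] g_eq[OF x])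
  show "g x (T x X Y) Z + g x (T x Y Z) X + g x (T x Z X) Y = 0" for X Y Z
    using A_cyclic[OF x, of X Y Z] A_cyclic[OF x, of Y X Z] by (simp add: T_def g_lin[OF x])
qed (rule linear_T[OF x] T_alt(2) T_J(1)[OF x])+

definition JT :: "real ^ 6 \<Rightarrow> real ^ 6 \<Rightarrow> real ^ 6 \<Rightarrow> real ^ 6" where "JT x X Y = - J x (T x X Y)"

lemma JT_tensor: assumes x: "x \<in> S" shows "su3_torsion_tensor (\<kappa> x) (\<Omega> x) (coframe_at x) (JT x)"
proof (intro su3_torsion_tensor.intro[OF point[OF x]] su3_torsion_tensor_axioms.intro, unfold J_eq[OF x] g_eq[OF x])
  show "linear (\<lambda>X. JT x X Y)" "linear (JT x X)" for X Y
    by (auto intro!: linearI simp: JT_def J_lin[OF x] linear_add[OF linear_T(1)[OF x]] linear_add[OF linear_T(2)[OF x]]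
        linear_scale[OF linear_T(1)[OF x]] linear_scale[OF linear_T(2)[OF x]])
  show "JT x X Y = - JT x Y X" for X Y using T_alt(2)[of x X Y] by (simp add: JT_def J_lin[OF x])
  show "JT x (J x X) Y = - J x (JT x X Y)" for X Y by (simp add: JT_def J_lin[OF x] T_J[OF x])
  show "g x (JT x X Y) Z + g x (JT x Y Z) X + g x (JT x Z X) Y = 0" for X Y Z
    using A_cyclic_J[OF x, of X Y Z] A_cyclic_J[OF x, of Y X Z]
    by (simp add: JT_def T_def g_lin[OF x] J_lin[OF x] g_J_left[OF x])
qed

abbreviation torsion_form :: "real ^ 6 \<Rightarrow> (real ^ 6 \<Rightarrow> real ^ 6 \<Rightarrow> real ^ 6) \<Rightarrow> (real ^ 6, real) form" where
  "torsion_form x \<tau> \<equiv> su3_torsion_tensor.\<phi> (\<Omega> x) (coframe_at x) \<tau>"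

lemma ext_deriv_degree:
  fixes \<omega> :: "real ^ 6 \<Rightarrow> (real ^ 6, real) form"
  assumes x: "x \<in> S" and \<omega>: "\<And>y vs. y \<in> S \<Longrightarrow> length vs \<noteq> k \<Longrightarrow> \<omega> y vs = 0" and vs: "length vs \<noteq> Suc k"
  shows "ext_deriv \<omega> x vs = 0"
proof -
  have "dd (\<lambda>y. \<omega> y (take i vs @ drop (Suc i) vs)) x h = 0" if "i < length vs" for i h
  proof -
    have "dd (\<lambda>y. \<omega> y (take i vs @ drop (Suc i) vs)) x h = dd (\<lambda>_. 0) x h"
      using that vs by (intro dd_cong[OF open_S x] \<omega>) auto
    then show ?thesis by (simp add: frechet_derivative_const)
  qed
  then show ?thesis by (simp add: ext_deriv_def)
qed

lemma ext_deriv_Omega_components: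
  assumes x: "x \<in> S"
  shows "ext_deriv \<Omega> x [a, b, c, d] = su3_torsion_tensor.W (\<Omega> x) (T x) a b c d"
    and "ext_deriv (\<lambda>y. J_Omega (\<kappa> y) (\<Omega> y)) x [a, b, c, d] = su3_torsion_tensor.W (\<Omega> x) (JT x) a b c d"
proof -
  have e: "ext_deriv (\<lambda>y. su3_eps (\<kappa> y) (\<Omega> y)) x [a, b, c, d] = Complex (ext_deriv \<Omega> x [a, b, c, d])
     (ext_deriv (\<lambda>y. J_Omega (\<kappa> y) (\<Omega> y)) x [a, b, c, d])"
    by (simp add: ext_deriv_4 dd_eps[OF x] complex_eq_iff)
  show "ext_deriv \<Omega> x [a, b, c, d] = su3_torsion_tensor.W (\<Omega> x) (T x) a b c d"
    "ext_deriv (\<lambda>y. J_Omega (\<kappa> y) (\<Omega> y)) x [a, b, c, d] = su3_torsion_tensor.W (\<Omega> x) (JT x) a b c d"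
    using arg_cong[OF e, of Re] arg_cong[OF e, of Im]
    by (simp_all add: ext_deriv_eps[OF x] eps_eq[OF x] mu_eq_0[OF x] su3_torsion_tensor.W_def[OF T_tensor[OF x]]
        su3_torsion_tensor.W_def[OF JT_tensor[OF x]] JT_def Omega_lin[OF x])
qed

lemma degree_Omega: "x \<in> S \<Longrightarrow> length vs \<noteq> 3 \<Longrightarrow> \<Omega> x vs = 0"
  using alternating_Omega by (simp add: alternating_form_def)

lemma ext_deriv_Omega:
  assumes x: "x \<in> S"
  shows "ext_deriv \<Omega> x = (\<lambda>vs. - (torsion_form x (T x) \<^bold>\<and> \<kappa> x) vs)"
    and "ext_deriv (\<lambda>y. J_Omega (\<kappa> y) (\<Omega> y)) x = (\<lambda>vs. - (torsion_form x (JT x) \<^bold>\<and> \<kappa> x) vs)"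
proof -
  have case4: "f vs = (case vs of [a, b, c, d] \<Rightarrow> f [a, b, c, d] | _ \<Rightarrow> 0)"
    if "\<And>vs. length vs \<noteq> 4 \<Longrightarrow> f vs = 0" for f :: "(real ^ 6, real) form" and vs
    using that by (auto split: list.split)
  show "ext_deriv \<Omega> x = (\<lambda>vs. - (torsion_form x (T x) \<^bold>\<and> \<kappa> x) vs)"
  proof
    fix vs
    have "ext_deriv \<Omega> x vs = (case vs of [a, b, c, d] \<Rightarrow> ext_deriv \<Omega> x [a, b, c, d] | _ \<Rightarrow> 0)"
      by (rule case4) (rule ext_deriv_degree[OF x degree_Omega], auto)
    then show "ext_deriv \<Omega> x vs = - (torsion_form x (T x) \<^bold>\<and> \<kappa> x) vs"
      by (simp only: ext_deriv_Omega_components[OF x] su3_torsion_tensor.W_eq_phi_kappa[OF T_tensor[OF x]])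
  qed
  show "ext_deriv (\<lambda>y. J_Omega (\<kappa> y) (\<Omega> y)) x = (\<lambda>vs. - (torsion_form x (JT x) \<^bold>\<and> \<kappa> x) vs)"
  proof
    fix vs
    have "ext_deriv (\<lambda>y. J_Omega (\<kappa> y) (\<Omega> y)) x vs =
        (case vs of [a, b, c, d] \<Rightarrow> ext_deriv (\<lambda>y. J_Omega (\<kappa> y) (\<Omega> y)) x [a, b, c, d] | _ \<Rightarrow> 0)"
      by (rule case4) (rule ext_deriv_degree[OF x, of 3], auto simp: J_Omega_def endo_act_def degree_Omega)
    then show "ext_deriv (\<lambda>y. J_Omega (\<kappa> y) (\<Omega> y)) x vs = - (torsion_form x (JT x) \<^bold>\<and> \<kappa> x) vs"
      by (simp only: ext_deriv_Omega_components[OF x] su3_torsion_tensor.W_eq_phi_kappa[OF JT_tensor[OF x]])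
  qed
qed

lemma torsion_eq:
  assumes x: "x \<in> S"
  shows "(THE \<tau>. is_torsion (\<kappa> x) (\<Omega> x) (ext_deriv \<kappa> x) (ext_deriv \<Omega> x) (ext_deriv (\<lambda>y. J_Omega (\<kappa> y) (\<Omega> y)) x) \<tau>) =
    \<lparr>pi0 = 0, sigma0 = 0, pi1 = (\<lambda>_. 0), nu1 = (\<lambda>_. 0), pi2 = torsion_form x (T x), sigma2 = torsion_form x (JT x), nu3 = (\<lambda>_. 0)\<rparr>"
  unfolding closed_kappa[OF x] ext_deriv_Omega[OF x]
    su3_point.torsion_unique[OF point[OF x] J_eq[OF x, symmetric]
      su3_torsion_tensor.phi_Lambda2_8[OF T_tensor[OF x] J_eq[OF x, symmetric]]
      su3_torsion_tensor.phi_Lambda2_8[OF JT_tensor[OF x] J_eq[OF x, symmetric]]]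
  by simp

text \<open>If both 2-forms vanish, so do \<open>d\<Omega>\<close> and \<open>d(J\<Omega>)\<close>, hence \<open>T\<close>. Then \<open>g(A\<^sub>X Y, Z)\<close> is symmetric in \<open>X, Y\<close> and
  skew in \<open>Y, Z\<close>, which forces it to be zero.\<close>

lemma torsion_form_eq_0_iff:
  assumes x: "x \<in> S"
  shows "torsion_form x (T x) = (\<lambda>_. 0) \<and> torsion_form x (JT x) = (\<lambda>_. 0) \<longleftrightarrow> (\<forall>X Y. A x X Y = 0)"
proof (intro iffI allI conjI)
  fix X Y
  assume z: "torsion_form x (T x) = (\<lambda>_. 0) \<and> torsion_form x (JT x) = (\<lambda>_. 0)"
  have w0: "((\<lambda>_. 0) \<^bold>\<and> \<kappa> x) = (\<lambda>_. 0)" by (simp add: wedge_def fun_eq_iff)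
  have W0: "su3_torsion_tensor.W (\<Omega> x) (T x) a b c d = 0" "su3_torsion_tensor.W (\<Omega> x) (JT x) a b c d = 0" for a b c d
    using z ext_deriv_Omega_components[OF x, of a b c d] ext_deriv_Omega[OF x] by (simp_all add: w0)
  have WJ: "\<Omega> x [J x (T x a b), c, d] - \<Omega> x [J x (T x a c), b, d] + \<Omega> x [J x (T x a d), b, c]
      + \<Omega> x [J x (T x b c), a, d] - \<Omega> x [J x (T x b d), a, c] + \<Omega> x [J x (T x c d), a, b] = 0" for a b c d
    using W0(2)[of a b c d] by (simp add: su3_torsion_tensor.W_def[OF JT_tensor[OF x]] JT_def Omega_lin[OF x])
  note fr = su3_torsion_tensor.frame_eq_0[OF T_tensor[OF x] W0(1), unfolded J_eq[OF x], OF WJ]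
  have T0: "T x X Y = 0" for X Y by (rule su3_torsion_tensor.eq_0_from_frame[OF T_tensor[OF x] fr])
  then have sym: "A x X Y = A x Y X" for X Y using T0[of X Y] by (simp add: T_def)
  have "g x (A x X Y) Z = 0" for Z
  proof -
    have sk: "g x (A x X Y) Z = - g x (A x X Z) Y" for X Y Z using A_skew[OF x, of X Y Z] g_sym[OF x] by simp
    have "g x (A x X Y) Z = - g x (A x X Y) Z"
      using sk[of X Y Z] sk[of Z X Y] sk[of Y Z X] sym[of X Y] sym[of Y Z] sym[of Z X] by simp
    then show ?thesis by simp
  qed
  then show "A x X Y = 0" by (intro g_nondegenerate[OF x]) (simp add: g_lin[OF x])
next
  assume "\<forall>X Y. A x X Y = 0"
  then have 0: "T x X Y = 0" "JT x X Y = 0" for X Y by (simp_all add: T_def JT_def J_lin[OF x])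
  have "\<Omega> x [0, a, b] = 0" for a b by (rule linear_0[OF linear_Omega(1)[OF x]])
  then show "torsion_form x (T x) = (\<lambda>_. 0)" "torsion_form x (JT x) = (\<lambda>_. 0)"
    by (auto simp: su3_torsion_tensor.\<phi>_def[OF T_tensor[OF x]] su3_torsion_tensor.\<phi>_def[OF JT_tensor[OF x]] 0 fun_eq_iff split: list.split)
qed

lemma scalar_curvature_nonpos: "x \<in> S \<Longrightarrow> scalar_curvature metric_matrix x \<le> 0"
  by (simp add: scalar_curvature_eq sum_nonneg)

lemma scalar_curvature_eq_0_iff:
  assumes x: "x \<in> S" shows "scalar_curvature metric_matrix x = 0 \<longleftrightarrow> (\<forall>X Y. A x X Y = 0)"
proof
  assume "scalar_curvature metric_matrix x = 0"
  then have "g x (A x (E x a) (E x b)) (E x c) = 0" for a b c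
    by (simp add: scalar_curvature_eq[OF x] sum_nonneg sum_nonneg_eq_0_iff)
  then have "A x (E x a) (E x b) = 0" for a b
    using su3_point.frame_expansion[OF point[OF x], of "A x (E x a) (E x b)"] by (simp add: g_eq[OF x])
  then show "\<forall>X Y. A x X Y = 0"
    using su3_point.bilinear_eq_0_on_frame[OF point[OF x] linear_A[OF x]] by blast
next
  assume "\<forall>X Y. A x X Y = 0"
  then show "scalar_curvature metric_matrix x = 0" by (simp add: scalar_curvature_eq[OF x] g_lin[OF x])
qed

end

theorem corollary3p5:
  fixes X :: "'m topology"
    and A :: "('m, 6) chart set"
    and \<kappa> \<Omega> :: "('m, 6) form_field"
  assumes "smooth_manifold X A"
    and "generalized_calabi_yau A \<kappa> \<Omega>"
  shows "(\<forall>c\<in>A. \<forall>p\<in>chart_dom c. su3_scalar_curvature \<kappa> \<Omega> c p \<le> 0) \<and>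
         ((\<forall>c\<in>A. \<forall>p\<in>chart_dom c. su3_scalar_curvature \<kappa> \<Omega> c p = 0) \<longleftrightarrow> torsion_free A \<kappa> \<Omega>)"
proof -
  have chart: "gcy_chart (chart_img c) (\<kappa> c) (\<Omega> c)" if c: "c \<in> A" for c
  proof unfold_locales
    show "open (chart_img c)" using assms(1) c by (simp add: smooth_manifold_def is_chart_def)
    have su3: "su3_structure A \<kappa> \<Omega>" using assms(2) by (simp add: generalized_calabi_yau_def)
    then show "alternating_form 2 (\<kappa> c x)" "alternating_form 3 (\<Omega> c x)" "\<exists>u. adapted_coframe (\<kappa> c x) (\<Omega> c x) u"
      if "x \<in> chart_img c" for x
      using c that unfolding su3_structure_def differential_form_def by blast+
    show "smooth_on (chart_img c) (\<lambda>x. \<kappa> c x vs)" "smooth_on (chart_img c) (\<lambda>x. \<Omega> c x vs)" for vs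
      using su3 c unfolding su3_structure_def differential_form_def by blast+
    show "ext_deriv (\<kappa> c) x = (\<lambda>_. 0)"
      "type_component (su3_J (\<kappa> c x) (\<Omega> c x)) 3 1 (ext_deriv (\<lambda>y. su3_eps (\<kappa> c y) (\<Omega> c y)) x) = (\<lambda>_. 0)"
      if "x \<in> chart_img c" for x
      using assms(2) c that unfolding generalized_calabi_yau_def by blast+
  qed
  have main: "su3_scalar_curvature \<kappa> \<Omega> c p \<le> 0"
    "su3_scalar_curvature \<kappa> \<Omega> c p = 0 \<longleftrightarrow> (let \<tau> = torsion_at \<kappa> \<Omega> c p in
          pi0 \<tau> = 0 \<and> sigma0 \<tau> = 0 \<and> pi1 \<tau> = (\<lambda>_. 0) \<and> nu1 \<tau> = (\<lambda>_. 0) \<and>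
          pi2 \<tau> = (\<lambda>_. 0) \<and> sigma2 \<tau> = (\<lambda>_. 0) \<and> nu3 \<tau> = (\<lambda>_. 0))"
    if c: "c \<in> A" and p: "p \<in> chart_dom c" for c p
  proof -
    interpret gcy_chart "chart_img c" "\<kappa> c" "\<Omega> c" by (rule chart[OF c])
    have x: "chart_map c p \<in> chart_img c" using p by blast
    have s: "su3_scalar_curvature \<kappa> \<Omega> c p = scalar_curvature metric_matrix (chart_map c p)"
      by (simp add: su3_scalar_curvature_def metric_matrix_def[abs_def])
    show "su3_scalar_curvature \<kappa> \<Omega> c p \<le> 0" unfolding s by (rule scalar_curvature_nonpos[OF x])
    show "su3_scalar_curvature \<kappa> \<Omega> c p = 0 \<longleftrightarrow> (let \<tau> = torsion_at \<kappa> \<Omega> c p in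
          pi0 \<tau> = 0 \<and> sigma0 \<tau> = 0 \<and> pi1 \<tau> = (\<lambda>_. 0) \<and> nu1 \<tau> = (\<lambda>_. 0) \<and>
          pi2 \<tau> = (\<lambda>_. 0) \<and> sigma2 \<tau> = (\<lambda>_. 0) \<and> nu3 \<tau> = (\<lambda>_. 0))"
      unfolding s scalar_curvature_eq_0_iff[OF x] torsion_form_eq_0_iff[OF x, symmetric]
      by (simp add: torsion_at_def Let_def torsion_eq[OF x])
  qed
  show ?thesis
    unfolding torsion_free_def using main by blast
qed

end
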